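(* Let $M\subset\mathbb{R}^d$ be convex and let $(\varphi,\lambda)$ be a smooth solution on $[0,T]\times M$ of the $H(\mathrm{div})$ geodesic equations on the cone, with associated pressure $P$, and set $\Psi_p(t,x,r):=P(t,x)r^2$. Let $r_{min}:=\min_{(t,x)\in[0,T]\times M}\lambda_t(x)$, $r_{max}:=\max_{(t,x)\in[0,T]\times M}\lambda_t(x)$ and $\varrho:=2r_{max}/r_{min}$. For $x\in M$ let $z^{*}_t=z^{*,x}_t:=[\varphi_t(x),\lambda_t(x)]\in\mathcal{C}$. There exists a constant $C_0>0$ such that, if (i) for all $x\in M$, all $t\in[0,T]$ and all $w\in T_{z^*_t}\mathcal{C}$, $$|\mathrm{Hess}^{g_{\mathcal{C}}}\,\Psi_p(w,w)|\le \frac{C_0\pi^2}{T^2}|w|^2_{g_{\mathcal{C}}};$$ (ii) for all $x\in M$ and all $t_0,t_1\in[0,T]$, $d_{\mathcal{C}}(z^*_{t_0},z^*_{t_1})\le \frac{r_{min}}{4}$; (iii) $\left[\varrho^2+(\varrho+1)^2\right]\|P\|_{C^0}\le \frac{3}{2T^2}$; then the dynamic plan $\boldsymbol{\mu}^*=(\varphi,\lambda)_\#\rho_0$ is an optimal solution of the generalized $H(\mathrm{div})$ geodesic problem with coupling $\boldsymbol{\gamma}=[(\varphi_0,\lambda_0),(\varphi_T,\lambda_T)]_\#\rho_0$. If moreover the inequalities in (i) and (iii) are strict, the solution $\boldsymbol{\mu}^*$ is unique in the following sense: for any minimizer $\boldsymbol{\mu}$, the restriction $\boldsymbol{\mu}^{\mathrm{o}}$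 of $\boldsymbol{\mu}$ to $\Omega\setminus\{\mathrm{o}\}$, where $\mathrm{o}$ is the constant path at the apex, is equal to $\boldsymbol{\mu}^*$ up to rescaling.
   Context: Setting. $M$ is the closure of a bounded open subset of $\mathbb{R}^d$ with Lipschitz boundary, $\rho_0$ is the Lebesgue measure on $M$ normalized so that $\rho_0(M)=1$, and $T>0$ is fixed. $\mathcal{C}=(M\times\mathbb{R}_{\ge0})/(M\times\{0\})$ is the cone over $M$, with points $[x,r]$ and apex $o=[x,0]$. Fix $\bar x\in M$; $\pi_x([x,r])=x$ if $r>0$, $\pi_x(o)=\bar x$, $\pi_r([x,r])=r$. The cone carries the metric tensor $g_{\mathcal{C}}=r^2g+\mathrm{d}r^2$ on $M\times\mathbb{R}_{>0}$ ($g$ the Euclidean metric), with norm $|\cdot|_{g_{\mathcal{C}}}$ and Hessian $\mathrm{Hess}^{g_{\mathcal{C}}}$, and the distance $d_{\mathcal{C}}([x_1,r_1],[x_2,r_2])^2=r_1^2+r_2^2-2r_1r_2\cos(\min(|x_1-x_2|,\pi))$. $\Omega=C^0([0,T];\mathcal{C})$ is the space of continuous paths $\mathrm{z}:t\mapsto z_t=[x_t,r_t]$, with $x_t=\pi_x(z_t)$, $r_t=\pi_r(z_t)$; $\mathrm{o}\in\Omega$ is the path constantly equal to $o$. $AC^2([0,T];\mathcal{C})$ is the set of absolutely continuous paths whose metric derivative is in $L^2$; for such paths $|\dot z_t|^2_{g_{\mathcal{C}}}=r_t^2|\dot x_t|^2+\dot r_t^2$ where $r_t>0$ and the derivatives exist,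 and $0$ otherwise. $\mathcal{A}(\mathrm{z})=\int_0^T|\dot z_t|^2_{g_{\mathcal{C}}}\mathrm{d}t$ if $\mathrm{z}\in AC^2([0,T];\mathcal{C})$, $+\infty$ otherwise; $\mathcal{A}(\boldsymbol{\mu})=\int_\Omega\mathcal{A}(\mathrm{z})\,\mathrm{d}\boldsymbol{\mu}(\mathrm{z})$. A function $f:\mathcal{C}^2\to\mathbb{R}$ is 2-homogeneous if $f([x_1,\lambda r_1],[x_2,\lambda r_2])=\lambda^2f([x_1,r_1],[x_2,r_2])$ for all $\lambda>0$. Generalized $H(\mathrm{div})$ geodesic problem: given $\boldsymbol{\gamma}\in\mathcal{P}_2(\mathcal{C}^2)$ (Borel probability measures with finite second moment), minimize $\mathcal{A}(\boldsymbol{\mu})$ among dynamic plans $\boldsymbol{\mu}\in\mathcal{P}(\Omega)$ satisfying the homogeneous coupling constraint $\int_\Omega f(z_0,z_T)\,\mathrm{d}\boldsymbol{\mu}=\int_{\mathcal{C}^2}f\,\mathrm{d}\boldsymbol{\gamma}$ for all 2-homogeneous continuous $f:\mathcal{C}^2\to\mathbb{R}$, and the homogeneous marginal constraint $\int_\Omega\int_0^Tf(t,x_t)r_t^2\,\mathrm{d}t\,\mathrm{d}\boldsymbol{\mu}=\int_M\int_0^Tf(t,x)\,\mathrm{d}t\,\mathrm{d}\rho_0$ for all $f\in C^0([0,T]\times M)$. Smooth solutions. A smooth solution of the $H(\mathrm{div})$ geodesic equations on the cone on $[0,T]\times M$ is a smooth curve $t\mapsto(\varphi_t,\lambda_t)$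 with $\varphi_t\in\mathrm{Diff}(M)$ (smooth diffeomorphisms of $M$), $\lambda_t\in C^\infty(M;\mathbb{R}_{>0})$, $(\varphi_t)_\#(\lambda_t^2\rho_0)=\rho_0$ for all $t$, together with a smooth pressure $P$ on $[0,T]\times M$ such that $$\lambda\ddot\varphi+2\dot\lambda\dot\varphi+\tfrac12\lambda\,\nabla P\circ\varphi=0,\qquad \ddot\lambda-\lambda|\dot\varphi|^2+\lambda\,P\circ\varphi=0 .$$ $(\varphi,\lambda)_\#\rho_0\in\mathcal{P}(\Omega)$ is the push-forward of $\rho_0$ under $x\mapsto(t\mapsto[\varphi_t(x),\lambda_t(x)])$; $[(\varphi_0,\lambda_0),(\varphi_T,\lambda_T)]_\#\rho_0$ is the push-forward of $\rho_0$ under $x\mapsto([\varphi_0(x),\lambda_0(x)],[\varphi_T(x),\lambda_T(x)])$. Rescaling. For $\theta:\Omega\to\mathbb{R}$ with $\theta>0$ $\boldsymbol{\mu}$-a.e., let $\mathrm{prod}_\theta(\mathrm{z})=(t\mapsto[x_t,r_t/\theta(\mathrm{z})])$ and $\mathrm{dil}_{\theta,2}(\boldsymbol{\mu})=(\mathrm{prod}_\theta)_\#(\theta^2\boldsymbol{\mu})$. A functional $\sigma:\Omega\to\mathbb{R}$ is 1-homogeneous if $\sigma(t\mapsto[x_t,\lambda r_t])=\lambda\sigma(\mathrm{z})$ for all $\lambda>0$. A measure $\boldsymbol{\mu}$ equals $\boldsymbol{\nu}$ up to rescaling if $\boldsymbol{\nu}=\mathrm{dil}_{\sigma/C,2}(\boldsymbol{\mu})$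 for some (Borel) 1-homogeneous $\sigma$ with $\sigma>0$ $\boldsymbol{\mu}$-a.e. and $C=(\int_\Omega\sigma^2\mathrm{d}\boldsymbol{\mu})^{1/2}<\infty$. *)

theory Defs
  imports "HOL-Probability.Probability"
begin

subsection \<open>Domains and smooth maps up to the boundary\<close>

definition lipschitz_boundary :: "'a::euclidean_space set \<Rightarrow> bool" where
  "lipschitz_boundary U \<longleftrightarrow>
     (\<forall>p\<in>frontier U. \<exists>e \<delta> L h. norm e = 1 \<and> \<delta> > 0 \<and> L-lipschitz_on UNIV (h :: 'a \<Rightarrow> real) \<and>
        U \<inter> ball p \<delta> = {y \<in> ball p \<delta>. y \<bullet> e < h (y - (y \<bullet> e) *\<^sub>R e)})"

definition lipschitz_body :: "'a::euclidean_space set \<Rightarrow> bool" where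
  "lipschitz_body M \<longleftrightarrow>
     (\<exists>U. open U \<and> bounded U \<and> U \<noteq> {} \<and> lipschitz_boundary U \<and> M = closure U)"

definition normalized_lebesgue :: "'a::euclidean_space set \<Rightarrow> 'a measure" where
  "normalized_lebesgue M = uniform_measure (restrict_space lborel M) M"

fun Ck_on :: "nat \<Rightarrow> 'a::real_normed_vector set \<Rightarrow> ('a \<Rightarrow> 'b::real_normed_vector) \<Rightarrow> bool" where
  "Ck_on 0 U f \<longleftrightarrow> continuous_on U f"
| "Ck_on (Suc k) U f \<longleftrightarrow>
     (\<forall>x\<in>U. f differentiable at x) \<and> (\<forall>v. Ck_on k U (\<lambda>x. frechet_derivative f (at x) v))"

text \<open>Smoothness on a set that need not be open (such as \<open>M\<close> or \<open>[0,T] \<times> M\<close>) means, as usual,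
  being the restriction of a \<open>C\<^sup>\<infinity>\<close> map defined on an open neighbourhood.\<close>

definition smooth_on :: "'a::real_normed_vector set \<Rightarrow> ('a \<Rightarrow> 'b::real_normed_vector) \<Rightarrow> bool" where
  "smooth_on S f \<longleftrightarrow>
     (\<exists>U g. open U \<and> S \<subseteq> U \<and> (\<forall>k. Ck_on k U g) \<and> (\<forall>x\<in>S. g x = f x))"

definition smooth_diffeo :: "'a::real_normed_vector set \<Rightarrow> ('a \<Rightarrow> 'a) \<Rightarrow> bool" where
  "smooth_diffeo M \<phi> \<longleftrightarrow> bij_betw \<phi> M M \<and> smooth_on M \<phi> \<and> smooth_on M (the_inv_into M \<phi>)"

definition gradient_within :: "'a::real_inner set \<Rightarrow> ('a \<Rightarrow> real) \<Rightarrow> 'a \<Rightarrow> 'a" where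
  "gradient_within M f x = (THE D. (f has_derivative (\<lambda>h. D \<bullet> h)) (at x within M))"

subsection \<open>The cone as a metric space\<close>

text \<open>A point of \<open>(M \<times> \<real>\<^sub>\<ge>\<^sub>0) / (M \<times> {0})\<close> is represented by the pair
  \<open>(\<pi>\<^sub>x z, \<pi>\<^sub>r z)\<close>; thus the apex is \<open>(x\<^sub>0, 0)\<close> for the fixed base point \<open>x\<^sub>0 \<in> M\<close> (written
  \<open>\<bar>x\<close> informally), and \<open>\<pi>\<^sub>x = fst\<close>, \<open>\<pi>\<^sub>r = snd\<close>.  The class \<open>[x, r]\<close> is \<open>cone_pt x\<^sub>0 x r\<close>.\<close>

definition cone_pt :: "'a \<Rightarrow> 'a \<Rightarrow> real \<Rightarrow> 'a \<times> real" where
  "cone_pt x\<^sub>0 x r = (if r = 0 then (x\<^sub>0, 0) else (x, r))"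

definition cone :: "'a \<Rightarrow> 'a set \<Rightarrow> ('a \<times> real) set" where
  "cone x\<^sub>0 M = {cone_pt x\<^sub>0 x r | x r. x \<in> M \<and> r \<ge> 0}"

definition cone_dist :: "'a::metric_space \<times> real \<Rightarrow> 'a \<times> real \<Rightarrow> real" where
  "cone_dist z w =
     sqrt ((snd z)\<^sup>2 + (snd w)\<^sup>2 - 2 * snd z * snd w * cos (min (dist (fst z) (fst w)) pi))"

text \<open>\<open>\<lambda> \<cdot> [x, r] = [x, \<lambda> r]\<close>; for \<open>\<lambda> > 0\<close> this preserves the normal form of points.\<close>

definition cone_scale :: "real \<Rightarrow> 'a \<times> real \<Rightarrow> 'a \<times> real" where
  "cone_scale c z = (fst z, c * snd z)"

lemma cone_dist_sqrt_nonneg: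
  fixes r s c :: real
  assumes "r \<ge> 0" "s \<ge> 0" "c \<le> 1"
  shows "(r - s)\<^sup>2 \<le> r\<^sup>2 + s\<^sup>2 - 2 * r * s * c"
proof -
  have "r * s * c \<le> r * s"
    using assms by (simp add: mult_left_le)
  then show ?thesis by (simp add: power2_diff)
qed

lemma cmod_cis_diff:
  "cmod (of_real r * cis a - of_real s * cis b) = sqrt (r\<^sup>2 + s\<^sup>2 - 2 * r * s * cos (a - b))"
proof -
  have "(cmod (of_real r * cis a - of_real s * cis b))\<^sup>2
      = (r * cos a - s * cos b)\<^sup>2 + (r * sin a - s * sin b)\<^sup>2"
    by (simp add: cmod_power2)
  also have "\<dots> = r\<^sup>2 * ((cos a)\<^sup>2 + (sin a)\<^sup>2) + s\<^sup>2 * ((cos b)\<^sup>2 + (sin b)\<^sup>2)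
      - 2 * r * s * (cos a * cos b + sin a * sin b)"
    by (simp only: power2_eq_square ring_distribs) (simp add: algebra_simps)
  also have "\<dots> = r\<^sup>2 + s\<^sup>2 - 2 * r * s * cos (a - b)"
    by (simp only: cos_diff sin_cos_squared_add2 mult_1_right)
  finally show ?thesis
    by (rule real_sqrt_unique[symmetric]) simp
qed

lemma Metric_space_cone: "Metric_space (cone x\<^sub>0 M) (cone_dist :: 'a::metric_space \<times> real \<Rightarrow> _)"
proof
  fix z w :: "'a \<times> real"
  show "cone_dist z w = cone_dist w z"
    by (simp add: cone_dist_def dist_commute algebra_simps)
  define c where "c = cos (min (dist (fst z) (fst w)) pi)"
  have "c\<^sup>2 \<le> 1"
    by (simp add: c_def abs_square_le_1)
  then have "(c * snd w)\<^sup>2 \<le> (snd w)\<^sup>2"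
    by (simp add: power_mult_distrib mult_left_le_one_le)
  moreover have "0 \<le> (snd z - c * snd w)\<^sup>2" by simp
  ultimately have "0 \<le> (snd z)\<^sup>2 + (snd w)\<^sup>2 - 2 * snd z * snd w * c"
    by (simp add: power2_diff algebra_simps)
  then show "0 \<le> cone_dist z w"
    by (simp add: cone_dist_def c_def)
next
  fix z w :: "'a \<times> real"
  assume z: "z \<in> cone x\<^sub>0 M" and w: "w \<in> cone x\<^sub>0 M"
  obtain x r where zx: "z = cone_pt x\<^sub>0 x r" "r \<ge> 0" using z by (auto simp: cone_def)
  obtain y s where wy: "w = cone_pt x\<^sub>0 y s" "s \<ge> 0" using w by (auto simp: cone_def)
  show "cone_dist z w = 0 \<longleftrightarrow> z = w"
  proof
    assume "z = w"
    then show "cone_dist z w = 0"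
      by (simp add: cone_dist_def power2_eq_square)
  next
    assume "cone_dist z w = 0"
    define \<theta> where "\<theta> = min (dist (fst z) (fst w)) pi"
    have r: "snd z = r" "snd w = s" using zx wy by (auto simp: cone_pt_def)
    have eq0: "r\<^sup>2 + s\<^sup>2 - 2 * r * s * cos \<theta> = 0"
      using \<open>cone_dist z w = 0\<close> by (simp add: cone_dist_def r \<theta>_def)
    have "(r - s)\<^sup>2 \<le> 0"
      using cone_dist_sqrt_nonneg[OF zx(2) wy(2) cos_le_one[of \<theta>]] eq0 by simp
    then have rs: "r = s" by simp
    show "z = w"
    proof (cases "r = 0")
      case True
      then show ?thesis using rs zx wy by (simp add: cone_pt_def)
    next
      case False
      have "2 * r\<^sup>2 * (1 - cos \<theta>) = 0"
        using eq0 rs by (simp add: power2_eq_square algebra_simps)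
      then have "cos \<theta> = 1" using False by simp
      moreover have "0 \<le> \<theta>" "\<theta> \<le> pi" by (auto simp: \<theta>_def)
      ultimately have "\<theta> = 0" by (metis arccos_1 arccos_cos)
      then have "fst z = fst w" by (auto simp: \<theta>_def min_def split: if_splits)
      then show ?thesis using r rs by (simp add: prod_eq_iff)
    qed
  qed
next
  fix z w v :: "'a \<times> real"
  assume zwv: "z \<in> cone x\<^sub>0 M" "w \<in> cone x\<^sub>0 M" "v \<in> cone x\<^sub>0 M"
  define a b c where "a = min (dist (fst z) (fst w)) pi" and "b = min (dist (fst w) (fst v)) pi"
    and "c = min (dist (fst z) (fst v)) pi"
  define b' where "b' = min b (pi - a)"
  have rng: "0 \<le> a" "a \<le> pi" "0 \<le> b" "b \<le> pi" "0 \<le> c" "c \<le> pi" "0 \<le> b'" "b' \<le> b" "a + b' \<le> pi"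
    by (auto simp: a_def b_def c_def b'_def)
  have "dist (fst z) (fst v) \<le> dist (fst z) (fst w) + dist (fst w) (fst v)"
    by (rule dist_triangle)
  moreover have "0 \<le> dist (fst z) (fst w)" "0 \<le> dist (fst w) (fst v)"
    by simp_all
  ultimately have "c \<le> a + b'"
    using pi_gt_zero unfolding a_def b_def c_def b'_def by linarith
  have nn: "snd z \<ge> 0" "snd w \<ge> 0" "snd v \<ge> 0"
    using zwv by (auto simp: cone_def cone_pt_def split: if_splits)
  let ?z = "of_real (snd z) * cis a" and ?w = "of_real (snd w) * cis 0"
    and ?v = "of_real (snd v) * cis (- b')"
  have "cos (a + b') \<le> cos c"
    using rng \<open>c \<le> a + b'\<close> by (intro cos_monotone_0_pi_le) auto
  then have 1: "cone_dist z v \<le> cmod (?z - ?v)"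
    unfolding cmod_cis_diff using nn
    by (simp add: cone_dist_def c_def[symmetric] mult_left_mono)
  have 2: "cmod (?z - ?w) = cone_dist z w"
    unfolding cmod_cis_diff by (simp add: cone_dist_def a_def[symmetric])
  have "cos b \<le> cos b'"
    using rng by (intro cos_monotone_0_pi_le) auto
  then have 3: "cmod (?w - ?v) \<le> cone_dist w v"
    unfolding cmod_cis_diff using nn
    by (simp add: cone_dist_def b_def[symmetric] mult_left_mono)
  show "cone_dist z v \<le> cone_dist z w + cone_dist w v"
    using 1 2 3 norm_triangle_ineq[of "?z - ?w" "?w - ?v"] by simp
qed

definition cone_metric :: "'a::metric_space \<Rightarrow> 'a set \<Rightarrow> ('a \<times> real) metric" where
  "cone_metric x\<^sub>0 M = metric (cone x\<^sub>0 M, cone_dist)"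

lemma mspace_cone_metric [simp]: "mspace (cone_metric x\<^sub>0 M) = cone x\<^sub>0 M"
  and mdist_cone_metric [simp]: "mdist (cone_metric x\<^sub>0 M) = cone_dist"
  by (simp_all add: cone_metric_def Metric_space.mspace_metric Metric_space.mdist_metric
      Metric_space_cone)

abbreviation cone_top :: "'a::metric_space \<Rightarrow> 'a set \<Rightarrow> ('a \<times> real) topology" where
  "cone_top x\<^sub>0 M \<equiv> mtopology_of (cone_metric x\<^sub>0 M)"

abbreviation cone2_top ::
    "'a::metric_space \<Rightarrow> 'a set \<Rightarrow> (('a \<times> real) \<times> ('a \<times> real)) topology" where
  "cone2_top x\<^sub>0 M \<equiv> prod_topology (cone_top x\<^sub>0 M) (cone_top x\<^sub>0 M)"

subsection \<open>Riemannian structure of the cone\<close>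

definition cone_tensor :: "'a::real_inner \<times> real \<Rightarrow> 'a \<times> real \<Rightarrow> 'a \<times> real \<Rightarrow> real" where
  "cone_tensor p v w = (snd p)\<^sup>2 * (fst v \<bullet> fst w) + snd v * snd w"

text \<open>For a metric tensor \<open>G\<close> on a subset of a vector space, \<open>christoffel G p u v\<close> is
  \<open>\<nabla>\<^sub>u v\<close> at \<open>p\<close> for constant vector fields \<open>u, v\<close>, as given by Koszul's formula, and
  \<open>hessian S G f p w\<close> is \<open>(Hess f)\<^sub>p(w, w) = D\<^sup>2f(w, w) - Df(\<nabla>\<^sub>w w)\<close>.  Derivatives of \<open>f\<close> are
  taken within \<open>S\<close>, where \<open>f\<close> is defined, so as to make sense at boundary points too.\<close>

definition christoffel :: "('b \<Rightarrow> 'b \<Rightarrow> 'b \<Rightarrow> real) \<Rightarrow> 'b::real_normed_vector \<Rightarrow> 'b \<Rightarrow> 'b \<Rightarrow> 'b" where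
  "christoffel G p u v =
     (THE c. \<forall>w. 2 * G p c w =
        frechet_derivative (\<lambda>q. G q v w) (at p) u
      + frechet_derivative (\<lambda>q. G q u w) (at p) v
      - frechet_derivative (\<lambda>q. G q u v) (at p) w)"

definition hessian ::
    "'b set \<Rightarrow> ('b \<Rightarrow> 'b \<Rightarrow> 'b \<Rightarrow> real) \<Rightarrow> ('b \<Rightarrow> real) \<Rightarrow> 'b::real_normed_vector \<Rightarrow> 'b \<Rightarrow> real" where
  "hessian S G f p w =
     frechet_derivative (\<lambda>q. frechet_derivative f (at q within S) w) (at p within S) w
   - frechet_derivative f (at p within S) (christoffel G p w w)"

lemma christoffel_cone_tensor:
  fixes x \<xi> \<eta> :: "'a::euclidean_space"
  assumes "r > 0"
  shows "christoffel cone_tensor (x, r) (\<xi>, a) (\<eta>, b)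
           = ((1 / r) *\<^sub>R (a *\<^sub>R \<eta> + b *\<^sub>R \<xi>), - r * (\<xi> \<bullet> \<eta>))"
proof -
  have fd: "frechet_derivative (\<lambda>q. cone_tensor q v w) (at (x, r)) u
      = 2 * r * snd u * (fst v \<bullet> fst w)" for u v w :: "'a \<times> real"
  proof -
    have "((\<lambda>q. cone_tensor q v w) has_derivative (\<lambda>u. 2 * r * snd u * (fst v \<bullet> fst w))) (at (x, r))"
      unfolding cone_tensor_def by (auto intro!: derivative_eq_intros)
    then show ?thesis by (metis frechet_derivative_at)
  qed
  show ?thesis
    unfolding christoffel_def fd
  proof (rule the_equality)
    show "\<forall>w. 2 * cone_tensor (x, r) ((1 / r) *\<^sub>R (a *\<^sub>R \<eta> + b *\<^sub>R \<xi>), - r * (\<xi> \<bullet> \<eta>)) w =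
        2 * r * snd (\<xi>, a) * (fst (\<eta>, b) \<bullet> fst w) + 2 * r * snd (\<eta>, b) * (fst (\<xi>, a) \<bullet> fst w)
        - 2 * r * snd w * (fst (\<xi>, a) \<bullet> fst (\<eta>, b))"
      using assms by (simp add: cone_tensor_def inner_add_left power2_eq_square field_simps)
  next
    fix c :: "'a \<times> real"
    assume c: "\<forall>w. 2 * cone_tensor (x, r) c w =
        2 * r * snd (\<xi>, a) * (fst (\<eta>, b) \<bullet> fst w) + 2 * r * snd (\<eta>, b) * (fst (\<xi>, a) \<bullet> fst w)
        - 2 * r * snd w * (fst (\<xi>, a) \<bullet> fst (\<eta>, b))"
    have "snd c = - r * (\<xi> \<bullet> \<eta>)"
      using c[rule_format, of "(0, 1)"] by (simp add: cone_tensor_def)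
    moreover have "fst c = (1 / r) *\<^sub>R (a *\<^sub>R \<eta> + b *\<^sub>R \<xi>)"
    proof (rule vector_eq_rdot[THEN iffD1], rule allI)
      fix k
      have "2 * (r\<^sup>2 * (fst c \<bullet> k)) = 2 * r * a * (\<eta> \<bullet> k) + 2 * r * b * (\<xi> \<bullet> k)"
        using c[rule_format, of "(k, 0)"] by (simp add: cone_tensor_def)
      then have "r * (r * (fst c \<bullet> k)) = r * (a * (\<eta> \<bullet> k) + b * (\<xi> \<bullet> k))"
        by (simp add: power2_eq_square algebra_simps)
      then have "r * (fst c \<bullet> k) = a * (\<eta> \<bullet> k) + b * (\<xi> \<bullet> k)"
        using assms by simp
      then show "fst c \<bullet> k = (1 / r) *\<^sub>R (a *\<^sub>R \<eta> + b *\<^sub>R \<xi>) \<bullet> k"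
        using assms by (simp add: inner_add_left field_simps)
    qed
    ultimately show "c = ((1 / r) *\<^sub>R (a *\<^sub>R \<eta> + b *\<^sub>R \<xi>), - r * (\<xi> \<bullet> \<eta>))"
      by (simp add: prod_eq_iff)
  qed
qed

subsection \<open>Path space, absolutely continuous paths and the action\<close>

text \<open>Paths \<open>[0,T] \<rightarrow> \<C>\<close> are extensional functions, with the topology of uniform convergence.\<close>

definition path_space :: "real \<Rightarrow> 'a::metric_space \<Rightarrow> 'a set \<Rightarrow> (real \<Rightarrow> 'a \<times> real) metric" where
  "path_space T x\<^sub>0 M = cfunspace (top_of_set {0..T}) (cone_metric x\<^sub>0 M)"

abbreviation paths :: "real \<Rightarrow> 'a::metric_space \<Rightarrow> 'a set \<Rightarrow> (real \<Rightarrow> 'a \<times> real) set" where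
  "paths T x\<^sub>0 M \<equiv> mspace (path_space T x\<^sub>0 M)"

definition apex_path :: "real \<Rightarrow> 'a \<Rightarrow> real \<Rightarrow> 'a \<times> real" where
  "apex_path T x\<^sub>0 = (\<lambda>t\<in>{0..T}. (x\<^sub>0, 0))"

definition scale_path :: "real \<Rightarrow> real \<Rightarrow> (real \<Rightarrow> 'a \<times> real) \<Rightarrow> real \<Rightarrow> 'a \<times> real" where
  "scale_path T c z = (\<lambda>t\<in>{0..T}. cone_scale c (z t))"

definition metric_speed :: "real \<Rightarrow> (real \<Rightarrow> 'a::metric_space \<times> real) \<Rightarrow> real \<Rightarrow> real" where
  "metric_speed T z t = Lim (at t within {0..T}) (\<lambda>s. cone_dist (z s) (z t) / \<bar>s - t\<bar>)"

definition abs_cont :: "real \<Rightarrow> (real \<Rightarrow> 'a::metric_space \<times> real) \<Rightarrow> bool" where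
  "abs_cont T z \<longleftrightarrow>
     (\<exists>m. set_integrable lebesgue {0..T} m \<and>
        (\<forall>s t. 0 \<le> s \<longrightarrow> s \<le> t \<longrightarrow> t \<le> T \<longrightarrow>
           cone_dist (z s) (z t) \<le> (LINT u:{s..t}|lebesgue. m u)))"

definition AC2 :: "real \<Rightarrow> 'a::metric_space \<Rightarrow> 'a set \<Rightarrow> (real \<Rightarrow> 'a \<times> real) set" where
  "AC2 T x\<^sub>0 M = {z \<in> paths T x\<^sub>0 M. abs_cont T z \<and>
     set_integrable lebesgue {0..T} (\<lambda>t. (metric_speed T z t)\<^sup>2)}"

definition path_speed_sq :: "real \<Rightarrow> (real \<Rightarrow> 'a::real_inner \<times> real) \<Rightarrow> real \<Rightarrow> real" where
  "path_speed_sq T z t =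
     (if snd (z t) > 0 \<and> (\<lambda>s. fst (z s)) differentiable (at t within {0..T})
         \<and> (\<lambda>s. snd (z s)) differentiable (at t within {0..T})
      then (let v = (vector_derivative (\<lambda>s. fst (z s)) (at t within {0..T}),
                     vector_derivative (\<lambda>s. snd (z s)) (at t within {0..T}))
            in cone_tensor (z t) v v)
      else 0)"

definition path_action ::
    "real \<Rightarrow> 'a::euclidean_space \<Rightarrow> 'a set \<Rightarrow> (real \<Rightarrow> 'a \<times> real) \<Rightarrow> ennreal" where
  "path_action T x\<^sub>0 M z =
     (if z \<in> AC2 T x\<^sub>0 M then \<integral>\<^sup>+t\<in>{0..T}. ennreal (path_speed_sq T z t) \<partial>lebesgue else \<infinity>)"

definition plan_action ::
    "real \<Rightarrow> 'a::euclidean_space \<Rightarrow> 'a set \<Rightarrow> (real \<Rightarrow> 'a \<times> real) measure \<Rightarrow> ennreal" where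
  "plan_action T x\<^sub>0 M \<mu> = (\<integral>\<^sup>+z. path_action T x\<^sub>0 M z \<partial>\<mu>)"

subsection \<open>The generalized geodesic problem\<close>

definition borel_of :: "'b topology \<Rightarrow> 'b measure" where
  "borel_of X = sigma (topspace X) {U. openin X U}"

abbreviation path_borel ::
    "real \<Rightarrow> 'a::metric_space \<Rightarrow> 'a set \<Rightarrow> (real \<Rightarrow> 'a \<times> real) measure" where
  "path_borel T x\<^sub>0 M \<equiv> borel_of (mtopology_of (path_space T x\<^sub>0 M))"

definition borel_probs :: "'b topology \<Rightarrow> 'b measure set" where
  "borel_probs X = {\<mu>. prob_space \<mu> \<and> sets \<mu> = sets (borel_of X)}"

text \<open>The second moment is taken with respect to the apex: \<open>d\<^sub>\<C>([x, r], o) = r\<close>.\<close>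

definition P2_cone2 ::
    "'a::metric_space \<Rightarrow> 'a set \<Rightarrow> (('a \<times> real) \<times> ('a \<times> real)) measure set" where
  "P2_cone2 x\<^sub>0 M = {\<gamma> \<in> borel_probs (cone2_top x\<^sub>0 M).
     integrable \<gamma> (\<lambda>(z, w). (snd z)\<^sup>2 + (snd w)\<^sup>2)}"

definition two_homogeneous ::
    "'a::metric_space \<Rightarrow> 'a set \<Rightarrow> (('a \<times> real) \<times> ('a \<times> real) \<Rightarrow> real) \<Rightarrow> bool" where
  "two_homogeneous x\<^sub>0 M f \<longleftrightarrow>
     (\<forall>z\<in>cone x\<^sub>0 M. \<forall>w\<in>cone x\<^sub>0 M. \<forall>c>0. f (cone_scale c z, cone_scale c w) = c\<^sup>2 * f (z, w))"

text \<open>In both constraints integrability with respect to the plan is explicit, since the Bochner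
  integral of a non-integrable function is \<open>0\<close> by convention.\<close>

definition homogeneous_coupling ::
    "real \<Rightarrow> 'a::metric_space \<Rightarrow> 'a set \<Rightarrow> (('a \<times> real) \<times> ('a \<times> real)) measure
      \<Rightarrow> (real \<Rightarrow> 'a \<times> real) measure \<Rightarrow> bool" where
  "homogeneous_coupling T x\<^sub>0 M \<gamma> \<mu> \<longleftrightarrow>
     (\<forall>f. continuous_map (cone2_top x\<^sub>0 M) euclideanreal f \<and> two_homogeneous x\<^sub>0 M f \<longrightarrow>
        integrable \<mu> (\<lambda>z. f (z 0, z T)) \<and>
        (\<integral>z. f (z 0, z T) \<partial>\<mu>) = (\<integral>p. f p \<partial>\<gamma>))"

definition homogeneous_marginal ::
    "real \<Rightarrow> 'a::euclidean_space set \<Rightarrow> (real \<Rightarrow> 'a \<times> real) measure \<Rightarrow> bool" where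
  "homogeneous_marginal T M \<mu> \<longleftrightarrow>
     (\<forall>f. continuous_on ({0..T} \<times> M) f \<longrightarrow>
        integrable \<mu> (\<lambda>z. LINT t:{0..T}|lborel. f (t, fst (z t)) * (snd (z t))\<^sup>2) \<and>
        (\<integral>z. (LINT t:{0..T}|lborel. f (t, fst (z t)) * (snd (z t))\<^sup>2) \<partial>\<mu>)
          = (\<integral>x. (LINT t:{0..T}|lborel. f (t, x)) \<partial>normalized_lebesgue M))"

definition feasible_plan ::
    "real \<Rightarrow> 'a::euclidean_space \<Rightarrow> 'a set \<Rightarrow> (('a \<times> real) \<times> ('a \<times> real)) measure
      \<Rightarrow> (real \<Rightarrow> 'a \<times> real) measure \<Rightarrow> bool" where
  "feasible_plan T x\<^sub>0 M \<gamma> \<mu> \<longleftrightarrow>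
     \<mu> \<in> borel_probs (mtopology_of (path_space T x\<^sub>0 M)) \<and>
     homogeneous_coupling T x\<^sub>0 M \<gamma> \<mu> \<and> homogeneous_marginal T M \<mu>"

definition generalized_Hdiv_minimizer ::
    "real \<Rightarrow> 'a::euclidean_space \<Rightarrow> 'a set \<Rightarrow> (('a \<times> real) \<times> ('a \<times> real)) measure
      \<Rightarrow> (real \<Rightarrow> 'a \<times> real) measure \<Rightarrow> bool" where
  "generalized_Hdiv_minimizer T x\<^sub>0 M \<gamma> \<mu> \<longleftrightarrow>
     \<gamma> \<in> P2_cone2 x\<^sub>0 M \<and> feasible_plan T x\<^sub>0 M \<gamma> \<mu> \<and>
     (\<forall>\<nu>. feasible_plan T x\<^sub>0 M \<gamma> \<nu> \<longrightarrow> plan_action T x\<^sub>0 M \<mu> \<le> plan_action T x\<^sub>0 M \<nu>)"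

subsection \<open>Rescaling of plans\<close>

text \<open>\<open>\<theta>\<close> is only required to be positive almost everywhere; on the remaining null set the path is
  left unchanged.\<close>

definition prod_path ::
    "real \<Rightarrow> ((real \<Rightarrow> 'a \<times> real) \<Rightarrow> real) \<Rightarrow> (real \<Rightarrow> 'a \<times> real) \<Rightarrow> real \<Rightarrow> 'a \<times> real" where
  "prod_path T \<theta> z = (if \<theta> z > 0 then scale_path T (1 / \<theta> z) z else z)"

definition dil2 ::
    "real \<Rightarrow> 'a::metric_space \<Rightarrow> 'a set \<Rightarrow> ((real \<Rightarrow> 'a \<times> real) \<Rightarrow> real)
      \<Rightarrow> (real \<Rightarrow> 'a \<times> real) measure \<Rightarrow> (real \<Rightarrow> 'a \<times> real) measure" where
  "dil2 T x\<^sub>0 M \<theta> \<mu> =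
     distr (density \<mu> (\<lambda>z. ennreal ((\<theta> z)\<^sup>2))) (path_borel T x\<^sub>0 M) (prod_path T \<theta>)"

definition one_homogeneous ::
    "real \<Rightarrow> 'a::metric_space \<Rightarrow> 'a set \<Rightarrow> ((real \<Rightarrow> 'a \<times> real) \<Rightarrow> real) \<Rightarrow> bool" where
  "one_homogeneous T x\<^sub>0 M \<sigma> \<longleftrightarrow>
     (\<forall>z\<in>paths T x\<^sub>0 M. \<forall>c>0. \<sigma> (scale_path T c z) = c * \<sigma> z)"

definition equal_up_to_rescaling ::
    "real \<Rightarrow> 'a::metric_space \<Rightarrow> 'a set \<Rightarrow> (real \<Rightarrow> 'a \<times> real) measure
      \<Rightarrow> (real \<Rightarrow> 'a \<times> real) measure \<Rightarrow> bool" where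
  "equal_up_to_rescaling T x\<^sub>0 M \<mu> \<nu> \<longleftrightarrow>
     (\<exists>\<sigma>. \<sigma> \<in> borel_measurable (path_borel T x\<^sub>0 M) \<and> one_homogeneous T x\<^sub>0 M \<sigma> \<and>
        (AE z in \<mu>. \<sigma> z > 0) \<and> integrable \<mu> (\<lambda>z. (\<sigma> z)\<^sup>2) \<and>
        \<nu> = dil2 T x\<^sub>0 M (\<lambda>z. \<sigma> z / sqrt (\<integral>z. (\<sigma> z)\<^sup>2 \<partial>\<mu>)) \<mu>)"

text \<open>The restriction of \<open>\<mu>\<close> to \<open>\<Omega> - {o}\<close>, kept as a measure on all of \<open>\<Omega>\<close>.\<close>

definition off_apex ::
    "real \<Rightarrow> 'a \<Rightarrow> (real \<Rightarrow> 'a \<times> real) measure \<Rightarrow> (real \<Rightarrow> 'a \<times> real) measure" where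
  "off_apex T x\<^sub>0 \<mu> = density \<mu> (indicator (space \<mu> - {apex_path T x\<^sub>0}))"

subsection \<open>Smooth solutions\<close>

definition smooth_Hdiv_solution ::
    "real \<Rightarrow> 'a::euclidean_space set \<Rightarrow> (real \<Rightarrow> 'a \<Rightarrow> 'a) \<Rightarrow> (real \<Rightarrow> 'a \<Rightarrow> real)
      \<Rightarrow> (real \<Rightarrow> 'a \<Rightarrow> real) \<Rightarrow> bool" where
  "smooth_Hdiv_solution T M \<phi> lam P \<longleftrightarrow>
     smooth_on ({0..T} \<times> M) (\<lambda>(t, x). \<phi> t x) \<and>
     smooth_on ({0..T} \<times> M) (\<lambda>(t, x). lam t x) \<and>
     smooth_on ({0..T} \<times> M) (\<lambda>(t, x). P t x) \<and>
     (\<forall>t\<in>{0..T}. smooth_diffeo M (\<phi> t) \<and> (\<forall>x\<in>M. lam t x > 0) \<and>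
        distr (density (normalized_lebesgue M) (\<lambda>x. ennreal ((lam t x)\<^sup>2)))
          (normalized_lebesgue M) (\<phi> t) = normalized_lebesgue M) \<and>
     (\<forall>t\<in>{0..T}. \<forall>x\<in>M.
        let D = (\<lambda>f s. vector_derivative f (at s within {0..T}));
            D' = (\<lambda>f s. vector_derivative f (at s within {0..T}));
            \<phi>\<^sub>1 = D (\<lambda>s. \<phi> s x); \<phi>\<^sub>2 = D \<phi>\<^sub>1;
            lam\<^sub>1 = D' (\<lambda>s. lam s x); lam\<^sub>2 = D' lam\<^sub>1
        in lam t x *\<^sub>R \<phi>\<^sub>2 t + (2 * lam\<^sub>1 t) *\<^sub>R \<phi>\<^sub>1 t
             + (lam t x / 2) *\<^sub>R gradient_within M (P t) (\<phi> t x) = 0 \<and>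
           lam\<^sub>2 t - lam t x * (norm (\<phi>\<^sub>1 t))\<^sup>2 + lam t x * P t (\<phi> t x) = 0)"

text \<open>\<open>solution_path T x\<^sub>0 \<phi> lam x\<close> is the path \<open>t \<mapsto> [\<phi>\<^sub>t(x), \<lambda>\<^sub>t(x)]\<close>; pushing \<open>\<rho>\<^sub>0\<close> forward along
  it, respectively along its endpoints, gives the plan and the coupling of a smooth solution.\<close>

definition solution_path ::
    "real \<Rightarrow> 'a \<Rightarrow> (real \<Rightarrow> 'a \<Rightarrow> 'a) \<Rightarrow> (real \<Rightarrow> 'a \<Rightarrow> real) \<Rightarrow> 'a \<Rightarrow> real \<Rightarrow> 'a \<times> real" where
  "solution_path T x\<^sub>0 \<phi> lam x = (\<lambda>t\<in>{0..T}. cone_pt x\<^sub>0 (\<phi> t x) (lam t x))"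

definition solution_plan ::
    "real \<Rightarrow> 'a::euclidean_space \<Rightarrow> 'a set \<Rightarrow> (real \<Rightarrow> 'a \<Rightarrow> 'a) \<Rightarrow> (real \<Rightarrow> 'a \<Rightarrow> real)
      \<Rightarrow> (real \<Rightarrow> 'a \<times> real) measure" where
  "solution_plan T x\<^sub>0 M \<phi> lam =
     distr (normalized_lebesgue M) (path_borel T x\<^sub>0 M) (solution_path T x\<^sub>0 \<phi> lam)"

definition solution_coupling ::
    "real \<Rightarrow> 'a::euclidean_space \<Rightarrow> 'a set \<Rightarrow> (real \<Rightarrow> 'a \<Rightarrow> 'a) \<Rightarrow> (real \<Rightarrow> 'a \<Rightarrow> real)
      \<Rightarrow> (('a \<times> real) \<times> ('a \<times> real)) measure" where
  "solution_coupling T x\<^sub>0 M \<phi> lam =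
     distr (normalized_lebesgue M) (borel_of (cone2_top x\<^sub>0 M))
       (\<lambda>x. (cone_pt x\<^sub>0 (\<phi> 0 x) (lam 0 x), cone_pt x\<^sub>0 (\<phi> T x) (lam T x)))"

end

theory Submission
  imports Defs
begin

text \<open>
  On paths \<open>z = [x, r]\<close> put \<open>\<B>(z) = \<A>(z) - \<integral> P(t, x\<^sub>t) r\<^sub>t\<^sup>2 dt\<close>.  The marginal constraint fixes the integral of the
  potential term over every admissible plan, so it suffices to compare \<open>\<B>\<close> path by path.  The curves
  \<open>z\<^sup>*\<close> are critical for \<open>\<B>\<close>, and \<open>\<B>\<close> is strictly convex along geodesics of the cone, which is
  nonpositively curved over a convex set, as soon as the Hessian of \<open>P r\<^sup>2\<close> is small compared with
  \<open>1 / T\<^sup>2\<close>.  Concretely, let \<open>(b, a)\<close> be the polar coordinates of \<open>z\<close> seen from \<open>z\<^sup>* = [x\<^sup>*, r\<^sup>*]\<close>, so that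
  \<open>b\<close> has length \<open>r sin (min \<theta> \<pi>)\<close> and \<open>a = r cos (min \<theta> \<pi>)\<close> with \<open>\<theta> = |x - x\<^sup>*|\<close>; then
  \<open>|z'|\<^sup>2 - P r\<^sup>2\<close> dominates the derivative of
  \<open>2 (r\<^sup>* x\<^sup>*' \<cdot> b + r\<^sup>*' a) - r\<^sup>* r\<^sup>*' + k d(z, z\<^sup>*)\<^sup>2\<close> plus \<open>d(z, z\<^sup>*)\<^sup>2 / (2 T\<^sup>2)\<close>, for an affine weight \<open>k\<close>.
  Hence \<open>\<B>(z) \<ge> \<B>(c z\<^sup>*) + \<integral> d(z, c z\<^sup>*)\<^sup>2 dt / (2 T\<^sup>2)\<close> whenever \<open>z\<close> has the endpoints of \<open>c z\<^sup>*\<close>, \<open>c \<ge> 0\<close>.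

  The homogeneous coupling forces almost every path of an admissible plan to have the endpoints of
  some \<open>c z\<^sup>*\<close>, and \<open>\<B>(c z\<^sup>*) = [r r']\<^sub>0\<^sup>T\<close> is a 2-homogeneous function of the initial point, so its integral
  is determined by the coupling.  Equality forces \<open>z = c z\<^sup>*\<close>, and \<open>c\<close>, read off the initial point, is the
  1-homogeneous functional that rescales a minimizer to \<open>\<mu>\<^sup>*\<close>.
\<close>

section \<open>Absolutely continuous functions\<close>

text \<open>The position x of a path need not even be continuous where r reaches 0, and the
  logarithm is not smooth at angle pi. Hence only products with the radius are differentiated: at a
  fixed time r, r x, a and b are Lipschitz on the cone, so they inherit a dominating density from
  the path. The lower bound is then a pointwise inequality for the derivative of an absolutely
  continuous function, integrated afterwards.

  The weight comes from completing a square. With V the logarithm, 0 \<le> |V' - k V|^2 gives |V'|^2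
  \<ge> (k |V|^2)' - (k' + k^2) |V|^2, so k' + k^2 \<le> -1/T^2 leaves |V|^2 / T^2 to spend. If K
  bounds the Hessian of P r^2, the second-order remainder of the potential costs 64 K |V|^2; with K
  = 1/(128 T^2) this is half of the margin, and the other half is the distance term that detects
  equality.

  For a fixed motion the two equations are linear in the radius, so a critical path multiplied by c
  \<ge> 0 is again critical. This is why paths that match the prescribed endpoints only up to a
  factor can be compared at all, the factor 0 included.\<close>

lemma indefinite_integral_deriv_AE:
  fixes f :: "real \<Rightarrow> real"
  assumes f: "f integrable_on {a..b}"
  obtains Z where "negligible Z"
    "\<And>t. t \<in> {a<..<b} \<Longrightarrow> t \<notin> Z \<Longrightarrow> ((\<lambda>s. integral {a..s} f) has_real_derivative f t) (at t)"
proof -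
  define h where "h t = (if t \<in> {a..b} then f t else 0)" for t
  have "h integrable_on UNIV"
    using f unfolding h_def integrable_restrict_UNIV by simp
  then have hi: "h integrable_on cbox c d" for c d
    by (rule integrable_on_subcbox) simp
  \<comment> \<open>The differentiation theorem for averages over cubes looks only at [t, t + k],
    that is to the right of t. Left difference quotients come from the reflected function, whose
    exceptional set is reflected back.\<close>
  have hi': "(\<lambda>t. h (- t)) integrable_on cbox c d" for c d
    using hi[of "-d" "-c"] integrable_reflect[of h "-c" "-d"] unfolding minus_minus by blast
  obtain Z1 where Z1: "negligible Z1" "\<And>t e. t \<notin> Z1 \<Longrightarrow> 0 < e \<Longrightarrow>
      \<exists>d>0. \<forall>k. 0 < k \<and> k < d \<longrightarrow> norm (integral (cbox t (t + k)) h /\<^sub>R k - h t) < e"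
    using integrable_ccontinuous_explicit[OF hi] by auto
  obtain Z2 where Z2: "negligible Z2" "\<And>t e. t \<notin> Z2 \<Longrightarrow> 0 < e \<Longrightarrow>
      \<exists>d>0. \<forall>k. 0 < k \<and> k < d \<longrightarrow> norm (integral (cbox t (t + k)) (\<lambda>t. h (- t)) /\<^sub>R k - h (- t)) < e"
    using integrable_ccontinuous_explicit[OF hi'] by auto
  show thesis
  proof (rule that)
    show "negligible (Z1 \<union> uminus ` Z2)"
      by (intro negligible_Un Z1 negligible_differentiable_image_negligible[OF order_refl Z2(1)])
        (auto simp: differentiable_on_def intro!: derivative_intros)
  next
    fix t assume t: "t \<in> {a<..<b}" "t \<notin> Z1 \<union> uminus ` Z2"
    then have tZ: "t \<notin> Z1" "- t \<notin> Z2"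
      by (auto simp: image_iff)
    define G where "G = (\<lambda>s. integral {a..s} f)"
    have diff: "G v - G u = integral (cbox u v) h" if "a \<le> u" "u \<le> v" "v \<le> b" for u v
    proof -
      have "f integrable_on {a..v}"
        using f that by (auto intro: integrable_on_subinterval)
      then have "G u + integral {u..v} f = G v"
        unfolding G_def using that by (intro Henstock_Kurzweil_Integration.integral_combine) auto
      moreover have "integral {u..v} f = integral {u..v} h"
        using that by (intro integral_cong) (auto simp: h_def)
      ultimately show ?thesis by simp
    qed
    have ft: "h t = f t" using t by (simp add: h_def)
    have R: "((\<lambda>s. (G s - G t) / (s - t)) \<longlongrightarrow> f t) (at_right t)"
    proof (rule tendstoI)
      fix e :: real assume "0 < e"
      then obtain d where d: "d > 0" "\<And>k. 0 < k \<Longrightarrow> k < d \<Longrightarrow>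
          norm (integral (cbox t (t + k)) h /\<^sub>R k - h t) < e"
        using Z1(2)[OF tZ(1)] by blast
      show "\<forall>\<^sub>F s in at_right t. dist ((G s - G t) / (s - t)) (f t) < e"
        unfolding eventually_at_right_field
      proof (intro exI conjI allI impI)
        show "t < min b (t + d)" using t d by auto
        fix s assume s: "t < s" "s < min b (t + d)"
        then show "dist ((G s - G t) / (s - t)) (f t) < e"
          using d(2)[of "s - t"] diff[of t s] t ft by (simp add: dist_norm divide_inverse mult.commute)
      qed
    qed
    have L: "((\<lambda>s. (G s - G t) / (s - t)) \<longlongrightarrow> f t) (at_left t)"
    proof (rule tendstoI)
      fix e :: real assume "0 < e"
      then obtain d where d: "d > 0" "\<And>k. 0 < k \<Longrightarrow> k < d \<Longrightarrow>
          norm (integral (cbox (- t) (- t + k)) (\<lambda>t. h (- t)) /\<^sub>R k - h t) < e"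
        using Z2(2)[OF tZ(2)] by fastforce
      show "\<forall>\<^sub>F s in at_left t. dist ((G s - G t) / (s - t)) (f t) < e"
        unfolding eventually_at_left_field
      proof (intro exI conjI allI impI)
        show "max a (t - d) < t" using t d by auto
        fix s assume s: "max a (t - d) < s" "s < t"
        have "integral (cbox (- t) (- s)) (\<lambda>t. h (- t)) = integral (cbox s t) h"
          by (rule integral_reflect)
        then have eq: "integral (cbox (- t) (- s)) (\<lambda>t. h (- t)) = G t - G s"
          using diff[of s t] s t by auto
        have "(G t - G s) /\<^sub>R (t - s) = (G s - G t) / (s - t)"
          by (simp add: divide_inverse mult.commute minus_divide_left[symmetric])
             (metis minus_diff_eq minus_mult_minus inverse_minus_eq mult.commute)
        then show "dist ((G s - G t) / (s - t)) (f t) < e"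
          using d(2)[of "t - s"] eq s ft by (simp add: dist_norm)
      qed
    qed
    show "(G has_real_derivative f t) (at t)"
      unfolding has_field_derivative_iff using filterlim_split_at[OF L R] by simp
  qed
qed

text \<open>Absolute continuity in the metric form, by a dominating density instead of an
  epsilon-delta condition: a map that is Lipschitz on the cone turns the density of a path into one
  of its image.\<close>

definition ac :: "real \<Rightarrow> (real \<Rightarrow> 'b::real_normed_vector) \<Rightarrow> bool" where
  "ac T f \<longleftrightarrow> (\<exists>m. m integrable_on {0..T} \<and> (\<forall>u. 0 \<le> m u) \<and>
     (\<forall>s t. 0 \<le> s \<longrightarrow> s \<le> t \<longrightarrow> t \<le> T \<longrightarrow> norm (f t - f s) \<le> integral {s..t} m))"

lemma acI:
  assumes "m integrable_on {0..T}" "\<And>u. 0 \<le> m u"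
    "\<And>s t. 0 \<le> s \<Longrightarrow> s \<le> t \<Longrightarrow> t \<le> T \<Longrightarrow> norm (f t - f s) \<le> integral {s..t} m"
  shows "ac T f"
  using assms unfolding ac_def by blast

lemma acE:
  assumes "ac T f"
  obtains m where "m integrable_on {0..T}" "\<And>u. 0 \<le> m u"
    "\<And>s t. 0 \<le> s \<Longrightarrow> s \<le> t \<Longrightarrow> t \<le> T \<Longrightarrow> norm (f t - f s) \<le> integral {s..t} m"
  using assms unfolding ac_def by blast

lemma ac_lipschitz:
  assumes "C-lipschitz_on {0..T} f"
  shows "ac T f"
proof (rule acI)
  show "(\<lambda>_. C) integrable_on {0..T}" by (rule integrable_const_ivl)
  show "0 \<le> C" using assms by (rule lipschitz_on_nonneg)
  fix s t assume "0 \<le> s" "s \<le> t" "t \<le> T"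
  then show "norm (f t - f s) \<le> integral {s..t} (\<lambda>_. C)"
    using lipschitz_onD[OF assms, of t s] by (simp add: dist_norm mult.commute)
qed

lemma lipschitz_on_continuous_deriv:
  fixes f :: "real \<Rightarrow> 'b::real_normed_vector"
  assumes d: "\<And>t. t \<in> {0..T} \<Longrightarrow> (f has_vector_derivative f' t) (at t within {0..T})"
    and c: "continuous_on {0..T} f'"
  obtains C where "C-lipschitz_on {0..T} f"
proof -
  have "bounded (f' ` {0..T})"
    by (intro compact_imp_bounded compact_continuous_image c) simp
  then obtain C where C: "C > 0" "\<And>t. t \<in> {0..T} \<Longrightarrow> norm (f' t) \<le> C"
    unfolding bounded_pos by auto
  have "C-lipschitz_on {0..T} f"
  proof (rule bounded_derivative_imp_lipschitz)
    show "(f has_derivative (\<lambda>h. h *\<^sub>R f' t)) (at t within {0..T})" if "t \<in> {0..T}" for t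
      using d[OF that] by (simp add: has_vector_derivative_def)
    show "onorm (\<lambda>h. h *\<^sub>R f' t) \<le> C" if "t \<in> {0..T}" for t
      using C(2)[OF that] by (intro onorm_le) (simp add: mult.commute[of C] mult_left_mono)
  qed (use C in auto)
  then show ?thesis by (rule that)
qed

lemma ac_C1:
  fixes f :: "real \<Rightarrow> 'b::real_normed_vector"
  assumes "\<And>t. t \<in> {0..T} \<Longrightarrow> (f has_vector_derivative f' t) (at t within {0..T})"
    "continuous_on {0..T} f'"
  shows "ac T f"
  using lipschitz_on_continuous_deriv[OF assms] ac_lipschitz by metis

lemma integrable_on_sub0:
  fixes m :: "real \<Rightarrow> 'b::banach"
  assumes "m integrable_on {0..T}" "0 \<le> s" "t \<le> T"
  shows "m integrable_on {s..t}"
  using assms by (auto intro: integrable_on_subinterval)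

lemma ac_continuous_on:
  assumes "ac T f"
  shows "continuous_on {0..T} f"
proof -
  obtain m where m: "m integrable_on {0..T}" "\<And>u. 0 \<le> m u"
    "\<And>s t. 0 \<le> s \<Longrightarrow> s \<le> t \<Longrightarrow> t \<le> T \<Longrightarrow> norm (f t - f s) \<le> integral {s..t} m"
    using assms by (rule acE) blast
  define G where "G t = integral {0..t} m" for t
  have G: "continuous_on {0..T} G"
    unfolding G_def using m(1) by (rule indefinite_integral_continuous_1)
  have le: "norm (f t - f s) \<le> \<bar>G t - G s\<bar>" if "0 \<le> s" "s \<le> t" "t \<le> T" for s t
  proof -
    have "G s + integral {s..t} m = G t"
      unfolding G_def using that
      by (intro Henstock_Kurzweil_Integration.integral_combine integrable_on_sub0[OF m(1)]) auto
    then show ?thesis using m(3)[OF that] by linarith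
  qed
  have le': "dist (f t) (f s) \<le> dist (G t) (G s)" if "s \<in> {0..T}" "t \<in> {0..T}" for s t
    using le[of s t] le[of t s] that by (cases "s \<le> t") (auto simp: dist_norm norm_minus_commute abs_minus_commute)
  show ?thesis
    unfolding continuous_on_iff
  proof (intro ballI allI impI)
    fix x e assume "x \<in> {0..T}" "(0::real) < e"
    then obtain d where "d > 0" "\<And>x'. x' \<in> {0..T} \<Longrightarrow> dist x' x < d \<Longrightarrow> dist (G x') (G x) < e"
      using G unfolding continuous_on_iff by meson
    then show "\<exists>d>0. \<forall>x'\<in>{0..T}. dist x' x < d \<longrightarrow> dist (f x') (f x) < e"
      using le'[OF \<open>x \<in> {0..T}\<close>] by (meson le_less_trans)
  qed
qed

lemma ac_bounded:
  assumes "ac T f"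
  obtains B where "B > 0" "\<And>t. t \<in> {0..T} \<Longrightarrow> norm (f t) \<le> B"
proof -
  have "bounded (f ` {0..T})"
    by (intro compact_imp_bounded compact_continuous_image ac_continuous_on[OF assms]) simp
  then show ?thesis
    unfolding bounded_pos using that by auto
qed

text \<open>Sums, differences and bilinear products all reduce to this estimate. For a product, C
  and D are sup bounds of the opposite factor times the norm of the bilinear map.\<close>

lemma ac_dominated:
  fixes f :: "real \<Rightarrow> 'b::real_normed_vector" and g :: "real \<Rightarrow> 'c::real_normed_vector"
    and h :: "real \<Rightarrow> 'd::real_normed_vector"
  assumes f: "ac T f" and g: "ac T g" and C: "0 \<le> C" "0 \<le> D"
    and le: "\<And>s t. 0 \<le> s \<Longrightarrow> s \<le> t \<Longrightarrow> t \<le> T \<Longrightarrow> norm (h t - h s) \<le> C * norm (f t - f s) + D * norm (g t - g s)"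
  shows "ac T h"
proof -
  obtain m where m: "m integrable_on {0..T}" "\<And>u. 0 \<le> m u"
    "\<And>s t. 0 \<le> s \<Longrightarrow> s \<le> t \<Longrightarrow> t \<le> T \<Longrightarrow> norm (f t - f s) \<le> integral {s..t} m"
    using f by (rule acE) blast
  obtain n where n: "n integrable_on {0..T}" "\<And>u. 0 \<le> n u"
    "\<And>s t. 0 \<le> s \<Longrightarrow> s \<le> t \<Longrightarrow> t \<le> T \<Longrightarrow> norm (g t - g s) \<le> integral {s..t} n"
    using g by (rule acE) blast
  show ?thesis
  proof (rule acI)
    show "(\<lambda>u. C * m u + D * n u) integrable_on {0..T}"
      by (intro integrable_add integrable_on_mult_right m n)
    show "0 \<le> C * m u + D * n u" for u using m n C by simp
    fix s t assume st: "0 \<le> s" "s \<le> t" "t \<le> T"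
    have "integral {s..t} (\<lambda>u. C * m u + D * n u) = C * integral {s..t} m + D * integral {s..t} n"
      using integrable_on_sub0[OF m(1), of s t] integrable_on_sub0[OF n(1), of s t] st
      by (subst integral_add) (auto intro!: integrable_on_mult_right)
    moreover have "C * norm (f t - f s) \<le> C * integral {s..t} m" "D * norm (g t - g s) \<le> D * integral {s..t} n"
      using m(3)[OF st] n(3)[OF st] C by (auto intro: mult_left_mono)
    ultimately show "norm (h t - h s) \<le> integral {s..t} (\<lambda>u. C * m u + D * n u)"
      using le[OF st] by linarith
  qed
qed

lemma ac_add: "ac T f \<Longrightarrow> ac T g \<Longrightarrow> ac T (\<lambda>t. f t + g t)"
  by (rule ac_dominated[of T f g 1 1]) (auto simp: add_diff_add norm_triangle_ineq)

lemma ac_diff: "ac T f \<Longrightarrow> ac T g \<Longrightarrow> ac T (\<lambda>t. f t - g t)"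
proof (rule ac_dominated[of T f g 1 1])
  show "norm (f t - g t - (f s - g s)) \<le> 1 * norm (f t - f s) + 1 * norm (g t - g s)" for s t
    using norm_triangle_ineq4[of "f t - f s" "g t - g s"] by (simp add: algebra_simps)
qed auto

lemma ac_bilinear:
  assumes pr: "bounded_bilinear pr" and f: "ac T f" and g: "ac T g"
  shows "ac T (\<lambda>t. pr (f t) (g t))"
proof -
  interpret bounded_bilinear pr by fact
  obtain A where A: "A > 0" "\<And>t. t \<in> {0..T} \<Longrightarrow> norm (f t) \<le> A"
    using f by (rule ac_bounded) blast
  obtain B where B: "B > 0" "\<And>t. t \<in> {0..T} \<Longrightarrow> norm (g t) \<le> B"
    using g by (rule ac_bounded) blast
  obtain K where K: "K > 0" "\<And>a b. norm (pr a b) \<le> norm a * norm b * K"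
    using pos_bounded by blast
  show ?thesis
  proof (rule ac_dominated[OF f g])
    show "0 \<le> B * K" "0 \<le> A * K" using A B K by auto
    fix s t assume st: "0 \<le> s" "s \<le> t" "t \<le> T"
    have "pr (f t) (g t) - pr (f s) (g s) = pr (f t - f s) (g t) + pr (f s) (g t - g s)"
      by (simp add: diff_left diff_right)
    moreover have "norm (pr (f t - f s) (g t)) \<le> norm (f t - f s) * B * K"
      using K(2)[of "f t - f s" "g t"] B(2)[of t] st K(1)
      by (meson atLeastAtMost_iff mult_left_mono mult_right_mono norm_ge_zero order_trans less_imp_le)
    moreover have "norm (pr (f s) (g t - g s)) \<le> A * norm (g t - g s) * K"
      using K(2)[of "f s" "g t - g s"] A(2)[of s] st K(1)
      by (meson atLeastAtMost_iff mult_left_mono mult_right_mono norm_ge_zero order_trans less_imp_le)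
    ultimately show "norm (pr (f t) (g t) - pr (f s) (g s)) \<le> B * K * norm (f t - f s) + A * K * norm (g t - g s)"
      using norm_triangle_ineq[of "pr (f t - f s) (g t)" "pr (f s) (g t - g s)"] by (simp add: mult_ac)
  qed
qed

lemmas ac_mult = ac_bilinear[OF bounded_bilinear_mult]
lemmas ac_inner = ac_bilinear[OF bounded_bilinear_inner]

lemma ac_const: "ac T (\<lambda>_. c)"
  by (rule acI[of "\<lambda>_. 0"]) auto

section \<open>Derivatives of absolutely continuous functions through the Radon-Nikodym
  theorem\<close>

lemma absolutely_continuous_if_sum_eq:
  assumes s: "sets \<nu> = sets M" "sets \<eta> = sets M"
    and E: "Int_stable E" "E \<subseteq> Pow \<Omega>" "sets M = sigma_sets \<Omega> E"
    and A: "range A \<subseteq> E" "(\<Union>i::nat. A i) = \<Omega>"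
    and fin: "\<And>X. X \<in> E \<Longrightarrow> emeasure (density M g) X \<noteq> \<infinity>"
    and g: "g \<in> borel_measurable M"
    and eq: "\<And>X. X \<in> E \<Longrightarrow> emeasure \<nu> X + emeasure \<eta> X = emeasure (density M g) X"
  shows "absolutely_continuous M \<nu>"
proof -
  define S where "S = measure_of \<Omega> (sets M) (\<lambda>X. emeasure \<nu> X + emeasure \<eta> X)"
  have sp: "space M = \<Omega>"
    using E by (metis sets_measure_of space_measure_of sets_eq_imp_space_eq)
  have sa: "sigma_algebra \<Omega> (sets M)" using sets.sigma_algebra_axioms[of M] sp by simp
  have setsS: "sets S = sets M"
    unfolding S_def using sa by (simp add: sigma_algebra.sets_measure_of_eq)
  have em: "emeasure S X = emeasure \<nu> X + emeasure \<eta> X" if "X \<in> sets M" for X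
    unfolding S_def
  proof (rule emeasure_measure_of_sigma[OF sa])
    show "positive (sets M) (\<lambda>X. emeasure \<nu> X + emeasure \<eta> X)"
      by (simp add: positive_def)
    show "countably_additive (sets M) (\<lambda>X. emeasure \<nu> X + emeasure \<eta> X)"
    proof (rule countably_additiveI)
      fix B :: "nat \<Rightarrow> _" assume B: "range B \<subseteq> sets M" "disjoint_family B" "(\<Union>i. B i) \<in> sets M"
      have "(\<Sum>i. emeasure \<nu> (B i) + emeasure \<eta> (B i)) = (\<Sum>i. emeasure \<nu> (B i)) + (\<Sum>i. emeasure \<eta> (B i))"
        by (rule suminf_add[symmetric]) auto
      then show "(\<Sum>i. emeasure \<nu> (B i) + emeasure \<eta> (B i)) = emeasure \<nu> (\<Union>i. B i) + emeasure \<eta> (\<Union>i. B i)"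
        using B s by (simp add: suminf_emeasure)
    qed
  qed fact
  have ES: "X \<in> sets M" if "X \<in> E" for X using that E(3) by auto
  \<comment> \<open>\<open>S\<close> is the sum of the two measures. Agreement on the Int-stable
    generator identifies it with the density, so a null set of \<open>M\<close> is null for the sum
    and hence for each summand.\<close>
  have "S = density M g"
  proof (rule measure_eqI_generator_eq[OF E(1,2) _ _ _ A])
    show "emeasure S X = emeasure (density M g) X" if "X \<in> E" for X
      using em[OF ES[OF that]] eq[OF that] by simp
    show "emeasure S (A i) \<noteq> \<infinity>" for i
    proof -
      have "A i \<in> E" using A by auto
      then show ?thesis using fin em[OF ES] eq by metis
    qed
  qed (use setsS E in auto)
  show ?thesis
    unfolding absolutely_continuous_def
  proof
    fix N assume N: "N \<in> null_sets M"
    then have NM: "N \<in> sets M" and e: "emeasure M N = 0" by auto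
    have "emeasure (density M g) N = 0"
      using N g by (simp add: emeasure_density null_sets_def nn_integral_null_set)
    then have "emeasure \<nu> N + emeasure \<eta> N = 0" using em[OF NM] \<open>S = density M g\<close> by simp
    then show "N \<in> null_sets \<nu>" using NM s by auto
  qed
qed

text \<open>The Stieltjes measures of \<open>F\<close> and \<open>H\<close> add up to \<open>m\<close> times Lebesgue measure, so that of \<open>F\<close> has a
  density.\<close>

lemma ac_mono_density:
  fixes F H :: "real \<Rightarrow> real"
  assumes T: "0 < T" and m: "m integrable_on {0..T}" "\<And>u. 0 \<le> m u"
    and F: "\<And>s t. 0 \<le> s \<Longrightarrow> s \<le> t \<Longrightarrow> t \<le> T \<Longrightarrow> F s \<le> F t"
    and H: "\<And>s t. 0 \<le> s \<Longrightarrow> s \<le> t \<Longrightarrow> t \<le> T \<Longrightarrow> H s \<le> H t"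
    and FH: "\<And>s t. 0 \<le> s \<Longrightarrow> s \<le> t \<Longrightarrow> t \<le> T \<Longrightarrow> (F t - F s) + (H t - H s) = integral {s..t} m"
    and cont: "continuous_on {0..T} F" "continuous_on {0..T} H"
  obtains g where "\<And>t. 0 \<le> g t" "\<And>t. t \<in> {0..T} \<Longrightarrow> (g has_integral (F t - F 0)) {0..t}"
proof -
  \<comment> \<open>Stieltjes measures ask for functions on the whole line. Clamping the argument
    extends F and H by constants, so the measures charge only [0, T].\<close>
  define cl where "cl t = max 0 (min T t)" for t :: real
  have cl: "cl t \<in> {0..T}" "t \<in> {0..T} \<Longrightarrow> cl t = t" for t using T by (auto simp: cl_def)
  have clm: "cl s \<le> cl t" if "s \<le> t" for s t using that by (auto simp: cl_def)
  have clc: "continuous_on UNIV cl" unfolding cl_def by (intro continuous_intros)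
  have cc: "continuous (at_right a) (\<lambda>t. G (cl t))" if "continuous_on {0..T} G" for a and G :: "real \<Rightarrow> real"
  proof -
    have "continuous_on UNIV (\<lambda>t. G (cl t))"
      by (rule continuous_on_compose2[OF that clc]) (use cl in auto)
    then show ?thesis
      by (metis UNIV_I continuous_on_eq_continuous_within continuous_within_subset subset_UNIV)
  qed
  define \<nu> where "\<nu> = interval_measure (\<lambda>t. F (cl t))"
  define \<eta> where "\<eta> = interval_measure (\<lambda>t. H (cl t))"
  have nu: "emeasure \<nu> {a<..b} = F (cl b) - F (cl a)" if "a \<le> b" for a b
    unfolding \<nu>_def using that cl clm F
    by (intro emeasure_interval_measure_Ioc cc cont) auto
  have eta: "emeasure \<eta> {a<..b} = H (cl b) - H (cl a)" if "a \<le> b" for a b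
    unfolding \<eta>_def using that cl clm H
    by (intro emeasure_interval_measure_Ioc cc cont) auto
  \<comment> \<open>\<open>m\<close> is only Lebesgue measurable whereas the Stieltjes measures are
    Borel; it is exchanged for a Borel function that agrees with it almost everywhere.\<close>
  have "(\<lambda>u. indicator {0..T} u *\<^sub>R m u) \<in> borel_measurable lebesgue"
    by (rule has_integral_implies_lebesgue_measurable[OF integrable_integral[OF m(1)]])
  then obtain m' where m': "m' \<in> borel_measurable borel" "AE u in lborel. indicator {0..T} u *\<^sub>R m u = m' u"
    using completion_ex_borel_measurable_real[of _ lborel] by auto
  have dens: "emeasure (density lborel (\<lambda>u. ennreal (m' u))) {a<..b} = integral {cl a..cl b} m" if "a \<le> b" for a b
  proof -
    have "emeasure (density lborel (\<lambda>u. ennreal (m' u))) {a<..b} = (\<integral>\<^sup>+u. ennreal (m' u) * indicator {a<..b} u \<partial>lborel)"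
      using m' by (intro emeasure_density) auto
    also have "\<dots> = (\<integral>\<^sup>+u. indicator {cl a..cl b} u * m u \<partial>lborel)"
    proof (rule nn_integral_cong_AE)
      have "AE u in lborel. u \<noteq> cl a \<and> u \<noteq> cl b \<and> u \<noteq> a"
        by (intro AE_conjI AE_lborel_singleton)
      then show "AE u in lborel. ennreal (m' u) * indicator {a<..b} u = ennreal (indicator {cl a..cl b} u * m u)"
        using m'(2)
      proof eventually_elim
        case (elim u)
        then show ?case using T that
          by (cases "u \<in> {cl a..cl b}"; cases "u \<in> {a<..b}")
             (auto simp: indicator_def cl_def max_def min_def split: if_splits)
      qed
    qed
    also have "\<dots> = integral {cl a..cl b} m"
      using m cl[of a] cl[of b]
      by (intro nn_integral_has_integral_lebesgue integrable_integral integrable_on_sub0[OF m(1)]) auto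
    finally show ?thesis .
  qed
  let ?E = "range (\<lambda>(a, b). {a <.. b::real})"
  have "absolutely_continuous lborel \<nu>"
  proof (rule absolutely_continuous_if_sum_eq[where \<nu>=\<nu> and \<eta>=\<eta> and M=lborel and E="?E" and \<Omega>=UNIV
        and A="\<lambda>i. {- real i<..real i}" and g="\<lambda>u. ennreal (m' u)"])
    show "sets \<nu> = sets lborel" "sets \<eta> = sets lborel" by (auto simp: \<nu>_def \<eta>_def)
    show "Int_stable ?E"
    proof (rule Int_stableI)
      fix X Y assume "X \<in> ?E" "Y \<in> ?E"
      then obtain a b c d where "X = {a<..b}" "Y = {c<..d}" by auto
      then have "X \<inter> Y = (\<lambda>(a, b). {a<..b}) (max a c, min b d)" by auto
      then show "X \<inter> Y \<in> ?E" by blast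
    qed
    show "?E \<subseteq> Pow UNIV" by auto
    show "sets lborel = sigma_sets UNIV ?E" by (simp add: borel_sigma_sets_Ioc)
    show "range (\<lambda>i::nat. {- real i<..real i}) \<subseteq> ?E" by auto
    show "(\<Union>i::nat. {- real i<..real i}) = UNIV"
    proof (intro set_eqI iffI)
      fix x :: real
      obtain n :: nat where "\<bar>x\<bar> < n" using reals_Archimedean2 by blast
      then show "x \<in> (\<Union>i::nat. {- real i<..real i})" by (intro UN_I[of n]) auto
    qed auto
    show "(\<lambda>u. ennreal (m' u)) \<in> borel_measurable lborel" using m' by auto
    fix X assume "X \<in> ?E"
    then obtain a b where X: "X = {a<..b}" by auto
    show "emeasure (density lborel (\<lambda>u. ennreal (m' u))) X \<noteq> \<infinity>"
      using dens[of a b] unfolding X by (cases "a \<le> b") auto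
    show "emeasure \<nu> X + emeasure \<eta> X = emeasure (density lborel (\<lambda>u. ennreal (m' u))) X"
    proof (cases "a \<le> b")
      case True
      have "emeasure \<nu> X + emeasure \<eta> X = ennreal ((F (cl b) - F (cl a)) + (H (cl b) - H (cl a)))"
        unfolding X nu[OF True] eta[OF True]
        using F[of "cl a" "cl b"] H[of "cl a" "cl b"] cl[of a] cl[of b] clm[OF True]
        by (intro ennreal_plus[symmetric]) auto
      also have "\<dots> = integral {cl a..cl b} m"
        using FH[of "cl a" "cl b"] cl[of a] cl[of b] clm[OF True] by auto
      finally show ?thesis unfolding X dens[OF True] .
    qed (simp add: X)
  qed
  then obtain g0 where g0: "g0 \<in> borel_measurable lborel" "density lborel g0 = \<nu>"
    using sigma_finite_measure.Radon_Nikodym[OF sigma_finite_lborel, of \<nu>] by (auto simp: \<nu>_def)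
  \<comment> \<open>The Radon-Nikodym density may be infinite at some points. The mass of each (0,
    t] is finite, so this happens only on a null set there and the real version has the same
    integrals.\<close>
  define g where "g u = enn2real (g0 u)" for u
  have gb: "g \<in> borel_measurable borel" unfolding g_def using g0 by auto
  show thesis
  proof (rule that)
    show "0 \<le> g t" for t by (simp add: g_def)
    fix t assume t: "t \<in> {0..T}"
    have i: "(\<integral>\<^sup>+u. g0 u * indicator {0<..t} u \<partial>lborel) = F t - F 0"
      using nu[of 0 t] t cl(2)[of t] cl(2)[of 0] T emeasure_density[OF g0(1), of "{0<..t}"]
      by (simp add: g0(2))
    then have "(\<integral>\<^sup>+u. g0 u * indicator {0<..t} u \<partial>lborel) \<noteq> \<infinity>" by simp
    then have "AE u in lborel. g0 u * indicator {0<..t} u \<noteq> \<infinity>"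
      using g0(1) by (intro nn_integral_PInf_AE) auto
    moreover have "AE u in lborel. u \<noteq> (0::real)" by (rule AE_lborel_singleton)
    ultimately have "AE u in lborel. ennreal (indicator {0..t} u * g u) = g0 u * indicator {0<..t} u"
    proof eventually_elim
      case (elim u)
      then show ?case by (auto simp: indicator_def g_def less_top split: if_splits)
    qed
    then have "(\<integral>\<^sup>+u. ennreal (indicator {0..t} u * g u) \<partial>lborel) = ennreal (F t - F 0)"
      using i by (subst nn_integral_cong_AE) auto
    moreover have "(\<lambda>u. indicator {0..t} u * g u) \<in> borel_measurable borel"
      using gb by measurable
    ultimately have "((\<lambda>u. indicator {0..t} u * g u) has_integral (F t - F 0)) UNIV"
      using F[of 0 t] t by (intro nn_integral_has_integral) (auto simp: g_def)
    moreover have "(\<lambda>u. indicator {0..t} u * g u) = (\<lambda>u. if u \<in> {0..t} then g u else 0)"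
      by (auto simp: indicator_def)
    ultimately show "(g has_integral (F t - F 0)) {0..t}"
      by (simp only: has_integral_restrict_UNIV)
  qed
qed

text \<open>A Jordan decomposition in which the primitive G of the dominating density stands in for
  the total variation: G + f and G - f are both nondecreasing and add up to the primitive of 2 m.
  The Stieltjes argument gives a density of G + f, and subtracting m leaves one of f.\<close>

lemma ac_real_derivative:
  fixes f :: "real \<Rightarrow> real"
  assumes f: "ac T f" and T: "0 < T"
  obtains g Z where "g absolutely_integrable_on {0..T}" "negligible Z"
    "f T - f 0 = integral {0..T} g"
    "\<And>t. t \<in> {0<..<T} \<Longrightarrow> t \<notin> Z \<Longrightarrow> (f has_real_derivative g t) (at t)"
proof -
  obtain m where m: "m integrable_on {0..T}" "\<And>u. 0 \<le> m u"
    "\<And>s t. 0 \<le> s \<Longrightarrow> s \<le> t \<Longrightarrow> t \<le> T \<Longrightarrow> norm (f t - f s) \<le> integral {s..t} m"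
    using f by (rule acE) blast
  define G where "G t = integral {0..t} m" for t
  have Gc: "continuous_on {0..T} G"
    unfolding G_def using m(1) by (rule indefinite_integral_continuous_1)
  have Gd: "G t - G s = integral {s..t} m" if "0 \<le> s" "s \<le> t" "t \<le> T" for s t
  proof -
    have "G s + integral {s..t} m = G t"
      unfolding G_def using that
      by (intro Henstock_Kurzweil_Integration.integral_combine integrable_on_sub0[OF m(1)]) auto
    then show ?thesis by simp
  qed
  have fle: "\<bar>f t - f s\<bar> \<le> G t - G s" if "0 \<le> s" "s \<le> t" "t \<le> T" for s t
    using m(3)[OF that] Gd[OF that] by simp
  obtain g1 where g1: "\<And>t. 0 \<le> g1 t" "\<And>t. t \<in> {0..T} \<Longrightarrow> (g1 has_integral ((G t + f t) - (G 0 + f 0))) {0..t}"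
  proof (rule ac_mono_density[OF T, of "\<lambda>u. 2 * m u" "\<lambda>t. G t + f t" "\<lambda>t. G t - f t"])
    show "(\<lambda>u. 2 * m u) integrable_on {0..T}" using m by (intro integrable_on_mult_right)
    show "0 \<le> 2 * m u" for u using m by simp
    fix s t assume st: "0 \<le> s" "s \<le> t" "t \<le> T"
    show "G s + f s \<le> G t + f t" "G s - f s \<le> G t - f t" using fle[OF st] by linarith+
    show "G t + f t - (G s + f s) + (G t - f t - (G s - f s)) = integral {s..t} (\<lambda>u. 2 * m u)"
      using Gd[OF st] by simp
  qed (use Gc ac_continuous_on[OF f] in \<open>auto intro!: continuous_intros\<close>)
  define g where "g t = g1 t - m t" for t
  have gi: "(g has_integral (f t - f 0)) {0..t}" if "t \<in> {0..T}" for t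
  proof -
    have "(m has_integral G t) {0..t}"
      unfolding G_def using that by (intro integrable_integral integrable_on_sub0[OF m(1)]) auto
    from has_integral_diff[OF g1(2)[OF that] this] show ?thesis
      unfolding g_def by (simp add: G_def)
  qed
  have T0: "T \<in> {0..T}" using T by auto
  have ai: "g absolutely_integrable_on {0..T}"
    unfolding g_def using g1 m T0
    by (intro set_integral_diff nonnegative_absolutely_integrable_1) (auto intro: has_integral_integrable)
  obtain Z where Z: "negligible Z" "\<And>t. t \<in> {0<..<T} \<Longrightarrow> t \<notin> Z \<Longrightarrow> ((\<lambda>s. integral {0..s} g) has_real_derivative g t) (at t)"
    using indefinite_integral_deriv_AE[of g 0 T] gi[OF T0] by (metis has_integral_integrable)
  show thesis
  proof (rule that[OF ai Z(1)])
    show "f T - f 0 = integral {0..T} g" using gi[OF T0] by (simp add: integral_unique)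
    fix t assume t: "t \<in> {0<..<T}" "t \<notin> Z"
    have "((\<lambda>s. integral {0..s} g + f 0) has_real_derivative g t) (at t)"
      using Z(2)[OF t] by (auto intro!: derivative_eq_intros)
    then show "(f has_real_derivative g t) (at t)"
    proof (rule has_field_derivative_transform_within_open)
      show "integral {0..s} g + f 0 = f s" if "s \<in> {0<..<T}" for s
        using gi[of s] that by (auto dest: integral_unique)
    qed (use t in auto)
  qed
qed

lemma ac_differentiable_AE:
  fixes f :: "real \<Rightarrow> 'b::euclidean_space"
  assumes f: "ac T f" and T: "0 < T"
  obtains Z where "negligible Z" "\<And>t. t \<in> {0<..<T} \<Longrightarrow> t \<notin> Z \<Longrightarrow> f differentiable (at t)"
proof -
  have "\<exists>Z. negligible Z \<and> (\<forall>t\<in>{0<..<T} - Z. (\<lambda>t. f t \<bullet> i) differentiable (at t))" for i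
  proof -
    have "ac T (\<lambda>t. f t \<bullet> i)" by (intro ac_inner f ac_const)
    from ac_real_derivative[OF this T] show ?thesis
      by (metis DiffE real_differentiable_def)
  qed
  then obtain Z where Z: "\<And>i. negligible (Z i)" "\<And>i t. t \<in> {0<..<T} - Z i \<Longrightarrow> (\<lambda>t. f t \<bullet> i) differentiable (at t)"
    by metis
  show thesis
  proof (rule that)
    show "negligible (\<Union>i\<in>Basis. Z i)" using Z(1) by (intro negligible_Union) auto
    show "f differentiable (at t)" if "t \<in> {0<..<T}" "t \<notin> (\<Union>i\<in>Basis. Z i)" for t
      using Z(2) that by (subst differentiable_componentwise_within) auto
  qed
qed

text \<open>The fundamental theorem of calculus joined to a pointwise bound. \<open>S\<close> is an
  arbitrary function, so the right-hand side is a nonnegative extended integral and only its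
  monotonicity is used; the passage to the positive part is harmless because \<open>ennreal\<close>
  sends negative reals to 0.\<close>

lemma ac_integral_le:
  fixes f h S :: "real \<Rightarrow> real"
  assumes f: "ac T f" and T: "0 < T" and h: "continuous_on {0..T} h" and Z: "negligible Z"
    and le: "\<And>t D. t \<in> {0<..<T} \<Longrightarrow> t \<notin> Z \<Longrightarrow> (f has_real_derivative D) (at t) \<Longrightarrow> D + h t \<le> S t"
  shows "ennreal (f T - f 0 + integral {0..T} h) \<le> (\<integral>\<^sup>+t\<in>{0..T}. ennreal (S t) \<partial>lebesgue)"
proof -
  obtain g Y where g: "g absolutely_integrable_on {0..T}" "negligible Y"
    "f T - f 0 = integral {0..T} g"
    "\<And>t. t \<in> {0<..<T} \<Longrightarrow> t \<notin> Y \<Longrightarrow> (f has_real_derivative g t) (at t)"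
    using ac_real_derivative[OF f T] by blast
  have h': "h absolutely_integrable_on {0..T}"
    using absolutely_integrable_continuous[of 0 T h] h by simp
  have gh: "set_integrable lebesgue {0..T} (\<lambda>t. g t + h t)"
    using g(1) h' by (rule set_integral_add)
  have "f T - f 0 + integral {0..T} h = (LINT t:{0..T}|lebesgue. g t + h t)"
    unfolding set_lebesgue_integral_eq_integral(2)[OF gh] g(3)
    by (rule Henstock_Kurzweil_Integration.integral_add[symmetric])
      (rule set_lebesgue_integral_eq_integral(1)[OF g(1)] set_lebesgue_integral_eq_integral(1)[OF h'])+
  also have "ennreal \<dots> \<le> (\<integral>\<^sup>+t. ennreal (indicator {0..T} t * (g t + h t)) \<partial>lebesgue)"
  proof -
    have i: "integrable lebesgue (\<lambda>t. indicator {0..T} t * (g t + h t))"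
      using gh by (simp add: set_integrable_def)
    have "(LINT t|lebesgue. indicator {0..T} t * (g t + h t)) \<le> (LINT t|lebesgue. max 0 (indicator {0..T} t * (g t + h t)))"
      using i by (intro integral_mono) auto
    then have "ennreal (LINT t|lebesgue. indicator {0..T} t * (g t + h t)) \<le> ennreal (LINT t|lebesgue. max 0 (indicator {0..T} t * (g t + h t)))"
      by (rule ennreal_leI)
    also have "\<dots> = (\<integral>\<^sup>+t. ennreal (max 0 (indicator {0..T} t * (g t + h t))) \<partial>lebesgue)"
      using i by (intro nn_integral_eq_integral[symmetric]) auto
    also have "\<dots> = (\<integral>\<^sup>+t. ennreal (indicator {0..T} t * (g t + h t)) \<partial>lebesgue)"
      by (intro nn_integral_cong) (auto simp: max_def ennreal_neg)
    finally show ?thesis by (simp add: set_lebesgue_integral_def)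
  qed
  also have "\<dots> \<le> (\<integral>\<^sup>+t\<in>{0..T}. ennreal (S t) \<partial>lebesgue)"
  proof (rule nn_integral_mono_AE)
    have "AE t in lebesgue. t \<notin> Z \<union> Y \<union> {0, T}"
    proof (rule AE_not_in)
      show "Z \<union> Y \<union> {0, T} \<in> null_sets lebesgue"
        using Z g(2) by (simp add: negligible_iff_null_sets[symmetric] negligible_Un negligible_finite)
    qed
    then show "AE t in lebesgue. ennreal (indicator {0..T} t * (g t + h t)) \<le> ennreal (S t) * indicator {0..T} t"
    proof eventually_elim
      case (elim t)
      then show ?case
        using le[of t "g t"] g(4)[of t]
        by (cases "t \<in> {0..T}") (auto intro!: ennreal_leI)
    qed
  qed
  finally show ?thesis .
qed

section \<open>The cone distance\<close>

text \<open>The derivative of sin x - x cos x is x sin x. Geometrically this is the curvature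
  inequality of the cone: it gives the sign of the orthogonal remainder in
  \<open>speed_minorant_generic\<close>.\<close>

lemma x_cos_le_sin:
  fixes x :: real
  assumes "0 \<le> x" "x \<le> pi"
  shows "x * cos x \<le> sin x"
proof -
  have "sin 0 - 0 * cos 0 \<le> sin x - x * cos x"
  proof (rule DERIV_nonneg_imp_nondecreasing[OF assms(1)])
    fix u assume u: "0 \<le> u" "u \<le> x"
    have "((\<lambda>x. sin x - x * cos x) has_real_derivative u * sin u) (at u)"
      by (auto intro!: derivative_eq_intros)
    then show "\<exists>y. ((\<lambda>x. sin x - x * cos x) has_real_derivative y) (at u) \<and> 0 \<le> y"
      using u assms sin_ge_zero[of u] by (intro exI conjI) (assumption, auto)
  qed
  then show ?thesis by simp
qed

text \<open>Since 1 - cos x = 2 sin^2 (x/2), it suffices that sin u \<ge> u/2 for u = x/2 \<le>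
  pi/2, and this follows from \<open>x_cos_le_sin\<close> at u/2 by half-angle formulas. The
  constant is not sharp.\<close>

lemma one_minus_cos_ge:
  fixes x :: real
  assumes "0 \<le> x" "x \<le> pi"
  shows "x\<^sup>2 / 8 \<le> 1 - cos x"
proof -
  define u where "u = x / 2"
  have u: "0 \<le> u" "u \<le> pi / 2" using assms by (auto simp: u_def)
  have "u * (1 + cos u) = 2 * u * (cos (u / 2))\<^sup>2"
    using cos_double_cos[of "u / 2"] by simp
  also have "\<dots> = 4 * cos (u / 2) * (u / 2 * cos (u / 2))"
    by (simp add: power2_eq_square)
  also have "\<dots> \<le> 4 * cos (u / 2) * sin (u / 2)"
    using u x_cos_le_sin[of "u / 2"] cos_ge_zero[of "u / 2"] by (intro mult_left_mono) auto
  also have "\<dots> = 2 * sin u" using sin_double[of "u / 2"] by simp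
  finally have "u * (1 + cos u) \<le> 2 * sin u" .
  moreover have "0 \<le> u * cos u" using u cos_ge_zero[of u] by simp
  ultimately have "u / 2 \<le> sin u" by (simp add: algebra_simps)
  then have "(u / 2)\<^sup>2 \<le> (sin u)\<^sup>2" using u by (intro power_mono) auto
  moreover have "1 - cos x = 2 * (sin u)\<^sup>2"
    using cos_double_sin[of u] by (simp add: u_def)
  ultimately show ?thesis by (simp add: u_def power_divide)
qed

lemma cone_dist_sq:
  assumes "0 \<le> snd z" "0 \<le> snd w"
  shows "(cone_dist z w)\<^sup>2 = (snd z - snd w)\<^sup>2 + 2 * snd z * snd w * (1 - cos (min (dist (fst z) (fst w)) pi))"
proof -
  have "0 \<le> (snd z - snd w)\<^sup>2 + 2 * snd z * snd w * (1 - cos (min (dist (fst z) (fst w)) pi))"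
    using assms by (intro add_nonneg_nonneg mult_nonneg_nonneg) auto
  moreover have "(snd z - snd w)\<^sup>2 + 2 * snd z * snd w * (1 - cos (min (dist (fst z) (fst w)) pi))
    = (snd z)\<^sup>2 + (snd w)\<^sup>2 - 2 * snd z * snd w * cos (min (dist (fst z) (fst w)) pi)"
    by (simp add: power2_diff algebra_simps)
  ultimately show ?thesis unfolding cone_dist_def by simp
qed

lemma cone_dist_nonneg: "0 \<le> snd z \<Longrightarrow> 0 \<le> snd w \<Longrightarrow> 0 \<le> cone_dist z w"
  unfolding cone_dist_def
  using cone_dist_sqrt_nonneg[of "snd z" "snd w" "cos (min (dist (fst z) (fst w)) pi)"]
  by (intro real_sqrt_ge_zero order_trans[OF zero_le_power2]) auto

lemma cone_dist_ge_radial: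
  assumes "0 \<le> snd z" "0 \<le> snd w"
  shows "\<bar>snd z - snd w\<bar> \<le> cone_dist z w"
proof (rule abs_le_square_iff[THEN iffD2, of _ "cone_dist z w", simplified, THEN order_trans])
  have "0 \<le> 2 * snd z * snd w * (1 - cos (min (dist (fst z) (fst w)) pi))"
    using assms by (intro mult_nonneg_nonneg) auto
  then show "(snd z - snd w)\<^sup>2 \<le> (cone_dist z w)\<^sup>2" unfolding cone_dist_sq[OF assms] by simp
qed (use cone_dist_nonneg[OF assms] in auto)

text \<open>The angular part of the squared distance is 2 r s (1 - cos), and r s is at least the
  square of the smaller radius. No larger weight could be expected: near the apex the angle carries
  no information.\<close>

lemma cone_dist_ge_angular:
  assumes "0 \<le> snd z" "0 \<le> snd w"
  shows "min (snd z) (snd w) * min (dist (fst z) (fst w)) pi \<le> 2 * cone_dist z w"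
proof (rule power2_le_imp_le)
  define m where "m = min (dist (fst z) (fst w)) pi"
  have m: "0 \<le> m" "m \<le> pi" by (auto simp: m_def)
  have "(min (snd z) (snd w) * m)\<^sup>2 \<le> (snd z * snd w) * m\<^sup>2"
  proof -
    have "(min (snd z) (snd w))\<^sup>2 \<le> snd z * snd w"
      using assms by (auto simp: power2_eq_square min_def intro: mult_left_mono mult_right_mono)
    then show ?thesis unfolding power_mult_distrib by (rule mult_right_mono) simp
  qed
  also have "\<dots> \<le> (snd z * snd w) * (8 * (1 - cos m))"
    using assms one_minus_cos_ge[OF m] by (intro mult_left_mono) auto
  also have "\<dots> = 4 * (2 * snd z * snd w * (1 - cos m))" by simp
  also have "\<dots> \<le> 4 * (cone_dist z w)\<^sup>2"
    unfolding cone_dist_sq[OF assms] m_def[symmetric] by (intro mult_left_mono) auto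
  finally show "(min (snd z) (snd w) * min (dist (fst z) (fst w)) pi)\<^sup>2 \<le> (2 * cone_dist z w)\<^sup>2"
    by (simp add: m_def power_mult_distrib)
qed (use cone_dist_nonneg[OF assms] in simp)

text \<open>The difference is split so that g x - g y carries the smaller radius, the only weight
  with which \<open>cone_dist_ge_angular\<close> controls the angle. For angles beyond pi the
  Lipschitz bound of g gives way to 2 B \<le> pi B.\<close>

lemma cone_radial_lipschitz:
  fixes g :: "'a::metric_space \<Rightarrow> 'b::real_normed_vector"
  assumes zw: "0 \<le> snd z" "0 \<le> snd w"
    and B: "norm (g (fst z)) \<le> B" "norm (g (fst w)) \<le> B"
    and L: "norm (g (fst z) - g (fst w)) \<le> L * dist (fst z) (fst w)" "0 \<le> L"
  shows "norm (snd z *\<^sub>R g (fst z) - snd w *\<^sub>R g (fst w)) \<le> (3 * B + 2 * L) * cone_dist z w"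
proof -
  define d m where "d = cone_dist z w" and "m = min (dist (fst z) (fst w)) pi"
  have B0: "0 \<le> B" using B(1) norm_ge_zero order_trans by blast
  have gm: "norm (g (fst z) - g (fst w)) \<le> (L + B) * m"
  proof (cases "dist (fst z) (fst w) \<le> pi")
    case True
    then show ?thesis using L B0 by (simp add: m_def distrib_right) (smt (verit) mult_nonneg_nonneg zero_le_dist)
  next
    case False
    have "norm (g (fst z) - g (fst w)) \<le> 2 * B" using norm_triangle_ineq4[of "g (fst z)" "g (fst w)"] B by simp
    also have "\<dots> \<le> pi * B" using B0 pi_ge_two by (intro mult_right_mono) auto
    also have "\<dots> \<le> (L + B) * pi" using L by (simp add: algebra_simps)
    finally show ?thesis using False by (simp add: m_def)
  qed
  have *: "norm (r *\<^sub>R u - s *\<^sub>R v) \<le> \<bar>r - s\<bar> * B + min r s * norm (u - v)"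
    if "0 \<le> r" "0 \<le> s" "norm u \<le> B" "norm v \<le> B" for r s :: real and u v :: 'b
  proof (cases "r \<le> s")
    case True
    have "r *\<^sub>R u - s *\<^sub>R v = r *\<^sub>R (u - v) + (r - s) *\<^sub>R v" by (simp add: algebra_simps)
    then have "norm (r *\<^sub>R u - s *\<^sub>R v) \<le> r * norm (u - v) + \<bar>r - s\<bar> * norm v"
      using that by (metis abs_of_nonneg norm_scaleR norm_triangle_ineq)
    also have "\<dots> \<le> r * norm (u - v) + \<bar>r - s\<bar> * B" using that by (intro add_left_mono mult_left_mono) auto
    finally show ?thesis using True by simp
  next
    case False
    have "r *\<^sub>R u - s *\<^sub>R v = s *\<^sub>R (u - v) + (r - s) *\<^sub>R u" by (simp add: algebra_simps)
    then have "norm (r *\<^sub>R u - s *\<^sub>R v) \<le> s * norm (u - v) + \<bar>r - s\<bar> * norm u"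
      using that by (metis abs_of_nonneg norm_scaleR norm_triangle_ineq)
    also have "\<dots> \<le> s * norm (u - v) + \<bar>r - s\<bar> * B" using that by (intro add_left_mono mult_left_mono) auto
    finally show ?thesis using False by simp
  qed
  have "norm (snd z *\<^sub>R g (fst z) - snd w *\<^sub>R g (fst w))
      \<le> \<bar>snd z - snd w\<bar> * B + min (snd z) (snd w) * norm (g (fst z) - g (fst w))"
    by (rule *) fact+
  also have "\<dots> \<le> d * B + min (snd z) (snd w) * ((L + B) * m)"
    using cone_dist_ge_radial[OF zw] gm zw B0 unfolding d_def
    by (intro add_mono mult_right_mono mult_left_mono) auto
  also have "\<dots> = d * B + (L + B) * (min (snd z) (snd w) * m)" by simp
  also have "\<dots> \<le> d * B + (L + B) * (2 * d)"
    using cone_dist_ge_angular[OF zw] L B0 unfolding d_def m_def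
    by (intro add_left_mono mult_left_mono) auto
  finally show ?thesis by (simp add: d_def algebra_simps)
qed

text \<open>This is the source of all absolute continuity along a path: r, r x, a and b have this
  form for suitable g, while the bare position does not. The dependence of g on time costs only a
  constant in the density.\<close>

lemma ac_cone_radial:
  fixes g :: "real \<Rightarrow> 'a::metric_space \<Rightarrow> 'b::real_normed_vector"
  assumes m: "m integrable_on {0..T}" "\<And>u. 0 \<le> m u"
    and z: "\<And>s t. 0 \<le> s \<Longrightarrow> s \<le> t \<Longrightarrow> t \<le> T \<Longrightarrow> cone_dist (z s) (z t) \<le> integral {s..t} m"
    and zM: "\<And>t. t \<in> {0..T} \<Longrightarrow> 0 \<le> snd (z t) \<and> fst (z t) \<in> M"
    and B: "\<And>t x. t \<in> {0..T} \<Longrightarrow> x \<in> M \<Longrightarrow> norm (g t x) \<le> B" and B0: "0 \<le> B"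
    and L: "\<And>t x y. t \<in> {0..T} \<Longrightarrow> x \<in> M \<Longrightarrow> y \<in> M \<Longrightarrow> norm (g t x - g t y) \<le> L * dist x y" "0 \<le> L"
    and L': "\<And>s t x. s \<in> {0..T} \<Longrightarrow> t \<in> {0..T} \<Longrightarrow> x \<in> M \<Longrightarrow> norm (g t x - g s x) \<le> L' * \<bar>t - s\<bar>" "0 \<le> L'"
  shows "ac T (\<lambda>t. snd (z t) *\<^sub>R g t (fst (z t)))"
proof -
  have r: "ac T (\<lambda>t. snd (z t))"
  proof (rule acI[OF m])
    fix s t assume st: "0 \<le> s" "s \<le> t" "t \<le> T"
    show "norm (snd (z t) - snd (z s)) \<le> integral {s..t} m"
      using cone_dist_ge_radial[of "z s" "z t"] z[OF st] zM[of s] zM[of t] st by auto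
  qed
  obtain R where R: "R > 0" "\<And>t. t \<in> {0..T} \<Longrightarrow> norm (snd (z t)) \<le> R"
    using r by (rule ac_bounded) blast
  define C where "C = 3 * B + 2 * L"
  have C0: "0 \<le> C" using B0 L by (simp add: C_def)
  show ?thesis
  proof (rule acI)
    show "(\<lambda>u. C * m u + R * L') integrable_on {0..T}"
      by (intro integrable_add integrable_on_mult_right m integrable_const_ivl)
    show "0 \<le> C * m u + R * L'" for u using C0 m R L' by simp
    fix s t assume st: "0 \<le> s" "s \<le> t" "t \<le> T"
    then have T: "s \<in> {0..T}" "t \<in> {0..T}" by auto
    have "snd (z t) *\<^sub>R g t (fst (z t)) - snd (z s) *\<^sub>R g s (fst (z s))
      = - (snd (z s) *\<^sub>R g t (fst (z s)) - snd (z t) *\<^sub>R g t (fst (z t)))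
        + snd (z s) *\<^sub>R (g t (fst (z s)) - g s (fst (z s)))"
      by (simp add: algebra_simps)
    then have "norm (snd (z t) *\<^sub>R g t (fst (z t)) - snd (z s) *\<^sub>R g s (fst (z s)))
      \<le> norm (snd (z s) *\<^sub>R g t (fst (z s)) - snd (z t) *\<^sub>R g t (fst (z t)))
        + norm (snd (z s) *\<^sub>R (g t (fst (z s)) - g s (fst (z s))))"
      by (metis norm_minus_cancel norm_triangle_ineq)
    also have "norm (snd (z s) *\<^sub>R g t (fst (z s)) - snd (z t) *\<^sub>R g t (fst (z t))) \<le> C * cone_dist (z s) (z t)"
      unfolding C_def using zM T B L by (intro cone_radial_lipschitz) auto
    also have "C * cone_dist (z s) (z t) \<le> C * integral {s..t} m"
      using z[OF st] C0 by (intro mult_left_mono)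
    also have "norm (snd (z s) *\<^sub>R (g t (fst (z s)) - g s (fst (z s)))) \<le> R * (L' * \<bar>t - s\<bar>)"
      using R(2)[OF T(1)] L'(1)[OF T, of "fst (z s)"] zM[OF T(1)] R(1)
      by (auto intro!: mult_mono)
    finally show "norm (snd (z t) *\<^sub>R g t (fst (z t)) - snd (z s) *\<^sub>R g s (fst (z s)))
        \<le> integral {s..t} (\<lambda>u. C * m u + R * L')"
      using integrable_on_sub0[OF m(1), of s t] st
      by (subst integral_add) (auto intro!: integrable_on_mult_right simp: mult_ac)
  qed
qed

lemma cone_dist_self_scale:
  "0 \<le> c \<Longrightarrow> cone_dist (cone_scale c z) (cone_scale c w) = c * cone_dist z w"
proof -
  assume c: "0 \<le> c"
  have "(snd (cone_scale c z))\<^sup>2 + (snd (cone_scale c w))\<^sup>2 - 2 * snd (cone_scale c z) * snd (cone_scale c w) * X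
     = c\<^sup>2 * ((snd z)\<^sup>2 + (snd w)\<^sup>2 - 2 * snd z * snd w * X)" for X
    by (simp add: cone_scale_def power2_eq_square algebra_simps)
  then show ?thesis using c
    unfolding cone_dist_def by (simp add: real_sqrt_mult cone_scale_def)
qed

section \<open>Polar coordinates on the cone\<close>

text \<open>The cap at pi mirrors \<open>cone_dist\<close>. Points at angle pi or more are joined
  through the apex, so the second point is placed on the opposite ray, with a = - r and b = 0; with
  the cap both coordinate functions are Lipschitz on the whole space.\<close>

definition polar_cos :: "'a::real_normed_vector \<Rightarrow> real" where
  "polar_cos y = cos (min (norm y) pi)"

definition polar_sin :: "'a::real_normed_vector \<Rightarrow> 'a" where
  "polar_sin y = sin (min (norm y) pi) *\<^sub>R sgn y"

lemma abs_cos_diff_le: "\<bar>cos x - cos y\<bar> \<le> \<bar>x - y\<bar>" for x y :: real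
proof -
  have "1-lipschitz_on UNIV (cos :: real \<Rightarrow> real)"
  proof (rule bounded_derivative_imp_lipschitz[where f'="\<lambda>x h. - sin x * h"])
    show "(cos has_derivative (\<lambda>h. - sin x * h)) (at x within UNIV)" for x :: real
      by (rule has_derivative_eq_rhs[OF DERIV_cos[of x, unfolded has_field_derivative_def]]) auto
    show "onorm (\<lambda>h. - sin x * h) \<le> 1" for x :: real
      by (intro onorm_le) (simp add: abs_mult mult_left_le_one_le)
  qed auto
  from lipschitz_onD[OF this] show ?thesis by (auto simp: dist_real_def)
qed

lemma abs_sin_diff_le: "\<bar>sin x - sin y\<bar> \<le> \<bar>x - y\<bar>" for x y :: real
  using abs_cos_diff_le[of "x - pi / 2" "y - pi / 2"]
  by (simp add: cos_diff)

lemma polar_cos_bound: "\<bar>polar_cos y\<bar> \<le> 1"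
  by (simp add: polar_cos_def)

lemma norm_polar_sin: "norm (polar_sin y) = sin (min (norm y) pi)"
  using sin_ge_zero[of "min (norm y) pi"] by (auto simp: polar_sin_def norm_sgn)

lemma norm_polar_sin_le: "norm (polar_sin y) \<le> 1"
  by (simp add: norm_polar_sin)

lemma polar_cos_lipschitz: "\<bar>polar_cos x - polar_cos y\<bar> \<le> norm (x - y)"
proof -
  have "\<bar>polar_cos x - polar_cos y\<bar> \<le> \<bar>min (norm x) pi - min (norm y) pi\<bar>"
    unfolding polar_cos_def by (rule abs_cos_diff_le)
  also have "\<dots> \<le> \<bar>norm x - norm y\<bar>" by (auto simp: min_def)
  also have "\<dots> \<le> norm (x - y)" by (rule norm_triangle_ineq3)
  finally show ?thesis .
qed

text \<open>The direction \<open>sgn\<close> is not Lipschitz near 0, but its variation is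
  multiplied by the sine of the shorter vector, which is at most the length of that vector. The
  directions contribute 2 and the lengths 1.\<close>

lemma polar_sin_lipschitz: "norm (polar_sin x - polar_sin y) \<le> 3 * norm (x - y)"
proof -
  have *: "norm (polar_sin x - polar_sin y) \<le> 3 * norm (x - y)" if "norm x \<le> norm y" for x y :: 'a
  proof -
    define a b where "a = sin (min (norm x) pi)" and "b = sin (min (norm y) pi)"
    have "polar_sin x - polar_sin y = a *\<^sub>R (sgn x - sgn y) + (a - b) *\<^sub>R sgn y"
      by (simp add: polar_sin_def a_def b_def algebra_simps)
    then have "norm (polar_sin x - polar_sin y) \<le> \<bar>a\<bar> * norm (sgn x - sgn y) + \<bar>a - b\<bar> * norm (sgn y)"
      by (metis norm_scaleR norm_triangle_ineq)
    moreover have "\<bar>a - b\<bar> * norm (sgn y) \<le> norm (x - y)"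
    proof -
      have "\<bar>a - b\<bar> \<le> \<bar>min (norm x) pi - min (norm y) pi\<bar>"
        unfolding a_def b_def by (rule abs_sin_diff_le)
      also have "\<dots> \<le> \<bar>norm x - norm y\<bar>" by (auto simp: min_def)
      also have "\<dots> \<le> norm (x - y)" by (rule norm_triangle_ineq3)
      finally show ?thesis by (simp add: norm_sgn)
    qed
    moreover have "\<bar>a\<bar> * norm (sgn x - sgn y) \<le> 2 * norm (x - y)"
    proof (cases "x = 0")
      case True
      then show ?thesis by (simp add: a_def)
    next
      case False
      then have y: "y \<noteq> 0" using that by auto
      have "\<bar>a\<bar> \<le> norm x" using abs_sin_x_le_abs_x[of "min (norm x) pi"] by (auto simp: a_def)
      then have "\<bar>a\<bar> * norm (sgn x - sgn y) \<le> norm x * norm (sgn x - sgn y)"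
        by (intro mult_right_mono) auto
      also have "\<dots> = norm (norm x *\<^sub>R (sgn x - sgn y))" by simp
      also have "norm x *\<^sub>R (sgn x - sgn y) = (x - y) + (norm y - norm x) *\<^sub>R sgn y"
        using False y by (simp add: sgn_div_norm algebra_simps)
      also have "norm \<dots> \<le> norm (x - y) + \<bar>norm y - norm x\<bar>"
        by (rule order_trans[OF norm_triangle_ineq]) (simp add: norm_sgn)
      also have "\<dots> \<le> 2 * norm (x - y)"
        using norm_triangle_ineq3[of y x] by (simp add: norm_minus_commute)
      finally show ?thesis .
    qed
    ultimately show ?thesis by simp
  qed
  show ?thesis
  proof (cases "norm x \<le> norm y")
    case False
    then show ?thesis using *[of y x] by (simp add: norm_minus_commute)
  qed (rule *)
qed

section \<open>Lower bounds for the squared speed in polar coordinates\<close>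

lemma deriv_zero_at_min:
  fixes f :: "real \<Rightarrow> real"
  assumes "(f has_real_derivative D) (at t)" "\<forall>\<^sub>F s in nhds t. 0 \<le> f s" "f t = 0"
  shows "D = 0"
proof -
  obtain d where "d > 0" "\<And>s. dist s t < d \<Longrightarrow> 0 \<le> f s"
    using assms(2) unfolding eventually_nhds_metric by blast
  then show ?thesis
    using assms(3) by (intro DERIV_local_min[OF assms(1), of d]) (auto simp: dist_real_def abs_minus_commute)
qed

text \<open>With \<open>W = (b' + a p, a' - b \<cdot> p)\<close>, the covariant derivative along \<open>z\<^sup>*\<close> of the logarithm of
  \<open>z\<close> plus the velocity of \<open>z\<^sup>*\<close>, the right-hand side bounds
  \<open>- |z\<^sup>*'|\<^sup>2 + 2 \<langle>z\<^sup>*', W\<rangle> + k d/dt |V|\<^sup>2 - k\<^sup>2 |V|\<^sup>2\<close>.\<close>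

definition speed_minorant ::
    "real \<Rightarrow> real \<Rightarrow> real \<Rightarrow> real \<Rightarrow> real \<Rightarrow> 'a::real_inner \<Rightarrow> real \<Rightarrow> 'a \<Rightarrow> real \<Rightarrow> 'a \<Rightarrow> real" where
  "speed_minorant k r r' s s' p a b a' b' =
     2 * (s * (p \<bullet> (b' + a *\<^sub>R p)) + s' * (a' - b \<bullet> p)) - (s\<^sup>2 * (p \<bullet> p) + s'\<^sup>2)
     + k * (2 * r * r' + 2 * s * s' - 2 * s' * a - 2 * s * a') - k\<^sup>2 * (r\<^sup>2 + s\<^sup>2 - 2 * s * a)"

text \<open>As in the next three lemmas, the squared speed minus the minorant is written out and
  seen to be nonnegative. One square is the radial part of V' - k V, which is how the weight
  enters.\<close>

lemma speed_minorant_apex: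
  "speed_minorant k 0 0 s s' p 0 0 0 0 \<le> 0"
proof -
  have "0 \<le> (s' - k * s)\<^sup>2 + s\<^sup>2 * (p \<bullet> p)" by simp
  then show ?thesis
    unfolding speed_minorant_def by (simp add: power2_eq_square algebra_simps)
qed

lemma speed_minorant_through_apex:
  assumes "0 \<le> r" "0 \<le> s"
  shows "speed_minorant k r r' s s' p (- r) 0 (- r') 0 \<le> r\<^sup>2 * (u \<bullet> u) + r'\<^sup>2"
proof -
  have "r\<^sup>2 * (u \<bullet> u) + r'\<^sup>2 - speed_minorant k r r' s s' p (- r) 0 (- r') 0
    = r\<^sup>2 * (u \<bullet> u) + (s\<^sup>2 + 2 * s * r) * (p \<bullet> p) + (r' + s' - k * (r + s))\<^sup>2"
    unfolding speed_minorant_def by (simp add: power2_eq_square algebra_simps)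
  moreover have "0 \<le> \<dots>" using assms by (intro add_nonneg_nonneg mult_nonneg_nonneg) auto
  ultimately show ?thesis by linarith
qed

lemma speed_minorant_same_base:
  "speed_minorant k r r' s s' p r 0 r' (r *\<^sub>R (u - p)) \<le> r\<^sup>2 * (u \<bullet> u) + r'\<^sup>2"
proof -
  have "r\<^sup>2 * (u \<bullet> u) + r'\<^sup>2 - speed_minorant k r r' s s' p r 0 r' (r *\<^sub>R (u - p))
    = (r *\<^sub>R u - s *\<^sub>R p) \<bullet> (r *\<^sub>R u - s *\<^sub>R p) + (r' - s' - k * (r - s))\<^sup>2"
    unfolding speed_minorant_def
    by (simp add: power2_eq_square inner_diff inner_commute algebra_simps)
  moreover have "0 \<le> \<dots>" by (intro add_nonneg_nonneg) auto
  ultimately show ?thesis by linarith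
qed

text \<open>Both velocities are split along the connecting direction e and orthogonally to it. In
  the plane spanned by e and the radius the cone is flat, which leaves two exact squares. The
  orthogonal parts leave \<open>R\<close>, where negative curvature shows as the discrepancy between
  \<sigma> = sin \<theta> / \<theta> and cos \<theta>: \<sigma> \<le> 1 makes its quadratic form in
  v and q nonnegative and cos \<theta> \<le> \<sigma> its last term.\<close>

lemma speed_minorant_generic:
  fixes e u p :: "'a::real_inner"
  assumes r: "0 \<le> r" "0 \<le> s" and e: "e \<bullet> e = 1" and th: "0 < \<theta>" "\<theta> < pi"
    and om: "\<omega> = e \<bullet> (u - p)"
    and a: "a = r * cos \<theta>" "a' = r' * cos \<theta> - r * sin \<theta> * \<omega>"
    and b: "b = (r * sin \<theta>) *\<^sub>R e"
      "b' = (r' * sin \<theta> + r * cos \<theta> * \<omega>) *\<^sub>R e + (r * sin \<theta> / \<theta>) *\<^sub>R (u - p - \<omega> *\<^sub>R e)"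
  shows "speed_minorant k r r' s s' p a b a' b' \<le> r\<^sup>2 * (u \<bullet> u) + r'\<^sup>2"
proof -
  define \<sigma> S C where "\<sigma> = sin \<theta> / \<theta>" and "S = sin \<theta>" and "C = cos \<theta>"
  define p1 u1 where "p1 = e \<bullet> p" and "u1 = e \<bullet> u"
  define q v where "q = p - p1 *\<^sub>R e" and "v = u - u1 *\<^sub>R e"
  have SC: "S\<^sup>2 + C\<^sup>2 = 1" by (simp add: S_def C_def)
  have orth: "e \<bullet> q = 0" "e \<bullet> v = 0" using e by (simp_all add: q_def v_def p1_def u1_def inner_diff_right)
  have p: "p = p1 *\<^sub>R e + q" and u: "u = u1 *\<^sub>R e + v" by (simp_all add: q_def v_def)
  have om': "\<omega> = u1 - p1" by (simp add: om u1_def p1_def inner_diff_right)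
  have pp: "p \<bullet> p = p1\<^sup>2 + q \<bullet> q" and uu: "u \<bullet> u = u1\<^sup>2 + v \<bullet> v"
    unfolding p u using orth e by (simp_all add: inner_add power2_eq_square inner_commute)
  have bp: "b \<bullet> p = r * S * p1" by (simp add: b p1_def S_def)
  have "u - p - \<omega> *\<^sub>R e = v - q" by (simp add: u p om' algebra_simps)
  then have b'': "b' = (r' * S + r * C * \<omega>) *\<^sub>R e + (r * \<sigma>) *\<^sub>R (v - q)"
    by (simp add: b S_def C_def \<sigma>_def)
  have pb: "p \<bullet> b' = p1 * (r' * S + r * C * \<omega>) + r * \<sigma> * (q \<bullet> v - q \<bullet> q)"
    unfolding b'' p using orth e by (simp add: inner_add inner_diff inner_commute algebra_simps)
  define R where "R = r\<^sup>2 * (v \<bullet> v) + s\<^sup>2 * (q \<bullet> q) - 2 * s * r * \<sigma> * (q \<bullet> v) + 2 * s * r * (\<sigma> - C) * (q \<bullet> q)"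
  have "r\<^sup>2 * (u \<bullet> u) + r'\<^sup>2 - speed_minorant k r r' s s' p a b a' b'
    = (r' * S + r * C * u1 - s * p1 - k * (r * S))\<^sup>2 + (r' * C - r * S * u1 - s' - k * (r * C - s))\<^sup>2 + R"
    unfolding speed_minorant_def inner_add_right pb bp inner_scaleR_right pp uu R_def a(1) a(2)
      S_def[symmetric] C_def[symmetric] om'
    using SC by algebra
  moreover have "0 \<le> R"
  proof -
    have s1: "C \<le> \<sigma>" using x_cos_le_sin[of \<theta>] th by (simp add: \<sigma>_def C_def field_simps)
    have s0: "0 \<le> \<sigma>" "\<sigma> \<le> 1"
      using th sin_ge_zero[of \<theta>] sin_x_le_x[of \<theta>] by (auto simp: \<sigma>_def field_simps)
    have "\<sigma> * (q \<bullet> v) \<le> \<sigma> * (norm q * norm v)"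
      using s0 norm_cauchy_schwarz by (intro mult_left_mono) auto
    also have "\<dots> \<le> norm q * norm v" using s0 by (simp add: mult_left_le_one_le)
    finally have "2 * s * r * (\<sigma> * (q \<bullet> v)) \<le> 2 * s * r * (norm q * norm v)"
      using r by (intro mult_left_mono) auto
    moreover have "0 \<le> (r * norm v - s * norm q)\<^sup>2" by simp
    moreover have "0 \<le> 2 * s * r * (\<sigma> - C) * (q \<bullet> q)" using r s1 by (intro mult_nonneg_nonneg) auto
    ultimately show ?thesis
      unfolding R_def by (simp add: power2_diff power_mult_distrib power2_norm_eq_inner algebra_simps)
  qed
  ultimately show ?thesis by (smt (verit) zero_le_power2)
qed

text \<open>Here \<open>p\<close>, \<open>q\<close> are the values of \<open>P\<close> at the two base points and \<open>g\<close> is the differential of \<open>P\<close>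
  applied to their difference.\<close>

lemma potential_remainder_le:
  fixes r s \<theta> :: real
  assumes r: "0 \<le> r" "0 \<le> s" and th: "0 \<le> \<theta>" "\<theta> < pi"
    and p: "\<bar>p\<bar> \<le> K / 2" and g: "\<bar>g\<bar> \<le> K * \<theta>" and q: "\<bar>q - p - g\<bar> \<le> K * \<theta>\<^sup>2"
  shows "q * r\<^sup>2 - p * s\<^sup>2 - r * s * (sin \<theta> / \<theta>) * g - 2 * s * p * (r * cos \<theta> - s)
    \<le> 64 * K * (r\<^sup>2 + s\<^sup>2 - 2 * r * s * cos \<theta>)"
proof -
  define E where "E = (r - s)\<^sup>2 + 2 * r * s * (1 - cos \<theta>)"
  have E: "E = r\<^sup>2 + s\<^sup>2 - 2 * r * s * cos \<theta>" by (simp add: E_def power2_diff algebra_simps)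
  have K: "0 \<le> K" using p by linarith
  have c: "0 \<le> 2 * r * s * (1 - cos \<theta>)" using r by (intro mult_nonneg_nonneg) auto
  have E0: "0 \<le> E" using c by (simp add: E_def)
  have pi2: "pi\<^sup>2 \<le> 10" 
  proof -
    have "pi < 3.15" using pi_approx by simp
    then have "pi\<^sup>2 \<le> 3.15\<^sup>2" by (intro power_mono) auto
    then show ?thesis by (simp add: power2_eq_square)
  qed
  \<comment> \<open>If r \<le> 2 s, then r^2 \<le> 2 r s and the angular part of E controls the
    angle. Otherwise the radial part alone gives r^2 \<le> 4 E, and the squared angle is at most
    pi^2 \<le> 10; this second regime fixes the constant 40.\<close>
  have rth: "r\<^sup>2 * \<theta>\<^sup>2 \<le> 40 * E"
  proof (cases "r \<le> 2 * s")
    case True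
    have "r\<^sup>2 * \<theta>\<^sup>2 \<le> (2 * r * s) * \<theta>\<^sup>2"
      using mult_left_mono[OF True r(1)] by (intro mult_right_mono) (auto simp: power2_eq_square mult_ac)
    also have "\<dots> \<le> (2 * r * s) * (8 * (1 - cos \<theta>))"
      using one_minus_cos_ge[of \<theta>] th r by (intro mult_left_mono) auto
    also have "\<dots> = 8 * (2 * r * s * (1 - cos \<theta>))" by simp
    also have "\<dots> \<le> 8 * E" unfolding E_def by (intro mult_left_mono) auto
    finally show ?thesis using E0 by simp
  next
    case False
    have "r\<^sup>2 \<le> (2 * (r - s))\<^sup>2" using False r by (intro power_mono) auto
    also have "\<dots> = 4 * (r - s)\<^sup>2" by (simp only: power_mult_distrib) simp
    also have "\<dots> \<le> 4 * E" using c by (simp add: E_def)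
    finally have "r\<^sup>2 * \<theta>\<^sup>2 \<le> (4 * E) * pi\<^sup>2"
      using th E0 by (intro mult_mono power_mono) auto
    also have "\<dots> \<le> (4 * E) * 10" using pi2 E0 by (intro mult_left_mono) auto
    finally show ?thesis by simp
  qed
  \<comment> \<open>The first summand of the splitting is bounded by half of (40 + 1) E through 2 |x
    y| \<le> x^2 + y^2, the second by 2 E; together 22.5, rounded up.\<close>
  have t2: "\<bar>r\<^sup>2 * \<theta> - r * s * sin \<theta>\<bar> \<le> 23 * E"
  proof -
    have "r\<^sup>2 * \<theta> - r * s * sin \<theta> = (r * \<theta>) * (r - s) + r * s * (\<theta> - sin \<theta>)"
      by (simp add: power2_eq_square algebra_simps)
    moreover have "2 * \<bar>(r * \<theta>) * (r - s)\<bar> \<le> (r * \<theta>)\<^sup>2 + (r - s)\<^sup>2"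
    proof -
      have "0 \<le> (r * \<theta> - (r - s))\<^sup>2" "0 \<le> (r * \<theta> + (r - s))\<^sup>2" by simp_all
      then show ?thesis by (simp add: power2_diff power2_sum abs_if)
    qed
    moreover have "(r - s)\<^sup>2 \<le> E" using c by (simp add: E_def)
    moreover have "\<bar>r * s * (\<theta> - sin \<theta>)\<bar> \<le> 2 * E"
    proof -
      have "\<theta> - sin \<theta> \<le> \<theta> * (1 - cos \<theta>)" using x_cos_le_sin[of \<theta>] th by (simp add: algebra_simps)
      also have "\<dots> \<le> 4 * (1 - cos \<theta>)" using th pi_less_4 by (intro mult_right_mono) auto
      finally have "r * s * (\<theta> - sin \<theta>) \<le> r * s * (4 * (1 - cos \<theta>))" using r by (intro mult_left_mono) auto
      also have "\<dots> = 2 * (2 * r * s * (1 - cos \<theta>))" by simp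
      also have "\<dots> \<le> 2 * E" unfolding E_def by (intro mult_left_mono) auto
      finally show ?thesis using r th sin_x_le_x[of \<theta>] by simp
    qed
    ultimately show ?thesis using rth E0 by (simp add: power_mult_distrib)
  qed
  have g2: "g * r\<^sup>2 - r * s * (sin \<theta> / \<theta>) * g \<le> 23 * K * E"
  proof (cases "\<theta> = 0")
    case True
    then show ?thesis using g K E0 by simp
  next
    case False
    have "g * r\<^sup>2 - r * s * (sin \<theta> / \<theta>) * g = (g / \<theta>) * (r\<^sup>2 * \<theta> - r * s * sin \<theta>)"
      using False by (simp add: field_simps)
    also have "\<dots> \<le> \<bar>g / \<theta>\<bar> * \<bar>r\<^sup>2 * \<theta> - r * s * sin \<theta>\<bar>" by (metis abs_ge_self abs_mult)
    also have "\<dots> \<le> K * (23 * E)"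
      using t2 K g False th by (intro mult_mono) (auto simp: field_simps)
    finally show ?thesis by simp
  qed
  \<comment> \<open>The remainder splits into a zeroth-order part p E, the Taylor error X of P, and
    Y, the mismatch between the gradient term with weight r^2 and the one with weight r s sin
    \<theta> / \<theta>. Their constants 1, 40 and 23 add up to the 64 of the statement.\<close>
  define X Y where "X = (q - p - g) * r\<^sup>2" and "Y = g * r\<^sup>2 - r * s * (sin \<theta> / \<theta>) * g"
  have "p * E \<le> K * E" using p E0 K by (intro mult_right_mono) auto
  moreover have "X \<le> K * \<theta>\<^sup>2 * r\<^sup>2" unfolding X_def using q by (intro mult_right_mono) auto
  moreover have "K * \<theta>\<^sup>2 * r\<^sup>2 \<le> 40 * (K * E)"
    using mult_left_mono[OF rth K] by (simp add: mult_ac)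
  moreover have "Y \<le> 23 * (K * E)" using g2 by (simp add: Y_def)
  ultimately have "p * E + X + Y \<le> 64 * (K * E)" by linarith
  moreover have "q * r\<^sup>2 - p * s\<^sup>2 - r * s * (sin \<theta> / \<theta>) * g - 2 * s * p * (r * cos \<theta> - s)
    = p * E + X + Y"
    by (simp add: E X_def Y_def power2_eq_square algebra_simps)
  ultimately show ?thesis by (simp add: E[symmetric])
qed

text \<open>Past angle pi the squared distance is (r + s)^2 and dominates every product of the
  radii, so the sup bound on P is enough and no Taylor expansion enters.\<close>

lemma potential_remainder_far_le:
  fixes r s :: real
  assumes r: "0 \<le> r" "0 \<le> s" and p: "\<bar>p\<bar> \<le> K / 2" and q: "\<bar>q\<bar> \<le> K / 2"
  shows "q * r\<^sup>2 - p * s\<^sup>2 - 2 * s * p * (- r - s) \<le> 64 * K * (r\<^sup>2 + s\<^sup>2 + 2 * r * s)"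
proof -
  have "q * r\<^sup>2 \<le> K / 2 * r\<^sup>2" "p * (s\<^sup>2 + 2 * r * s) \<le> K / 2 * (s\<^sup>2 + 2 * r * s)"
    using p q r by (intro mult_right_mono; auto)+
  moreover have "0 \<le> K * (r\<^sup>2 + s\<^sup>2 + 2 * r * s)" using p r by (intro mult_nonneg_nonneg) auto
  ultimately show ?thesis by (simp add: power2_eq_square algebra_simps)
qed

lemma polar_sin_has_derivative_0: "(polar_sin has_derivative (\<lambda>h. h)) (at (0::'a::real_normed_vector))"
proof -
  have "((\<lambda>y::'a. 1 - cos (norm y)) \<longlongrightarrow> 1 - cos (norm (0::'a))) (at 0)"
    by (intro tendsto_intros)
  then have lim: "((\<lambda>y::'a. 1 - cos (norm y)) \<longlongrightarrow> 0) (at 0)" by simp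
  have "((\<lambda>y::'a. norm (polar_sin y - polar_sin 0 - (y - 0)) / norm (y - 0)) \<longlongrightarrow> 0) (at 0)"
  proof (rule Lim_null_comparison[OF _ lim])
    have "\<forall>\<^sub>F y in at (0::'a). norm y < pi"
      unfolding eventually_at by (intro exI[of _ pi]) (auto simp: dist_norm)
    moreover have "\<forall>\<^sub>F y in at (0::'a). y \<noteq> 0"
      unfolding eventually_at by (intro exI[of _ 1]) auto
    ultimately show "\<forall>\<^sub>F y in at (0::'a). norm (norm (polar_sin y - polar_sin 0 - (y - 0)) / norm (y - 0)) \<le> 1 - cos (norm y)"
    proof eventually_elim
      case (elim y)
      have "polar_sin y - polar_sin 0 - (y - 0) = (sin (norm y) - norm y) *\<^sub>R sgn y"
        using elim by (simp add: polar_sin_def algebra_simps) (simp add: sgn_div_norm)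
      then have "norm (polar_sin y - polar_sin 0 - (y - 0)) = norm y - sin (norm y)"
        using elim sin_x_le_x[of "norm y"] by (simp add: norm_sgn)
      moreover have "norm y - sin (norm y) \<le> (1 - cos (norm y)) * norm y"
        using elim x_cos_le_sin[of "norm y"] by (simp add: algebra_simps)
      ultimately show ?case using elim sin_x_le_x[of "norm y"] by (simp add: divide_le_eq)
    qed
  qed
  then show ?thesis
    unfolding has_derivative_iff_norm by (simp add: bounded_linear_ident)
qed

text \<open>At the apex and at the cut locus \<open>|x - x\<^sup>*| = \<pi>\<close> the chain rule is not available; there the
  derivatives of \<open>a\<close> and \<open>b\<close> are forced by inequalities that are attained at \<open>t\<close>.\<close>

lemma speed_minorant_le:
  fixes x xs :: "real \<Rightarrow> 'a::euclidean_space" and r :: "real \<Rightarrow> real"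
  defines "a \<equiv> \<lambda>t. r t * polar_cos (x t - xs t)"
    and "b \<equiv> \<lambda>t. r t *\<^sub>R polar_sin (x t - xs t)"
  assumes r: "\<forall>\<^sub>F s in nhds t. 0 \<le> r s" and dr: "(r has_real_derivative r') (at t)"
    and da: "(a has_real_derivative a') (at t)" and db: "(b has_vector_derivative b') (at t)"
    and dxs: "(xs has_vector_derivative p) (at t)"
    and dx: "r t > 0 \<Longrightarrow> (x has_vector_derivative u) (at t)" and s: "0 \<le> s"
  shows "speed_minorant k (r t) r' s s' p (a t) (b t) a' b' \<le> (if r t > 0 then (r t)\<^sup>2 * (u \<bullet> u) + r'\<^sup>2 else 0)"
proof -
  have rt: "0 \<le> r t" using eventually_nhds_x_imp_x[OF r] .
  define y where "y t = x t - xs t" for t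
  have db': "((\<lambda>t. b t \<bullet> i) has_real_derivative b' \<bullet> i) (at t)" for i
    using bounded_linear.has_vector_derivative[OF bounded_linear_inner_left db, of i]
    by (simp add: has_real_derivative_iff_has_vector_derivative)
  have b_le: "\<bar>b s \<bullet> i\<bar> \<le> r s" if "0 \<le> r s" "i \<in> Basis" for s i
  proof -
    have "\<bar>b s \<bullet> i\<bar> \<le> norm (b s)" using that(2) by (rule Basis_le_norm)
    also have "\<dots> \<le> r s" using that norm_polar_sin_le[of "x s - xs s"]
      by (simp add: b_def mult_left_le)
    finally show ?thesis .
  qed
  have a_le: "\<bar>a s\<bar> \<le> r s" if "0 \<le> r s" for s
    using that polar_cos_bound[of "x s - xs s"] by (simp add: a_def abs_mult mult_left_le)
  show ?thesis
  \<comment> \<open>At the apex r attains its minimum 0. The functions r - a and r minus a component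
    of b are nonnegative nearby and vanish there too, so all these derivatives are 0 and only the
    motion of the base point is left in the minorant.\<close>
  proof (cases "r t = 0")
    case True
    have r0: "r' = 0" by (rule deriv_zero_at_min[OF dr r True])
    have "r' - a' = 0"
    proof (rule deriv_zero_at_min[of "\<lambda>t. r t - a t"])
      show "\<forall>\<^sub>F s in nhds t. 0 \<le> r s - a s"
        using eventually_mono[OF r, of "\<lambda>s. 0 \<le> r s - a s"] a_le by (simp add: abs_le_iff)
    qed (use True dr da in \<open>auto simp: a_def intro: derivative_intros\<close>)
    moreover have "b' = 0"
    proof (rule euclidean_eqI)
      fix i :: 'a assume i: "i \<in> Basis"
      have "r' - b' \<bullet> i = 0"
      proof (rule deriv_zero_at_min[of "\<lambda>t. r t - b t \<bullet> i"])
        show "\<forall>\<^sub>F s in nhds t. 0 \<le> r s - b s \<bullet> i"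
          using eventually_mono[OF r, of "\<lambda>s. 0 \<le> r s - b s \<bullet> i"] b_le[OF _ i] by (simp add: abs_le_iff)
      qed (use True dr db' in \<open>auto simp: b_def intro: derivative_intros\<close>)
      then show "b' \<bullet> i = 0 \<bullet> i" using r0 by simp
    qed
    ultimately show ?thesis
      using r0 True speed_minorant_apex[of k s s' p] by (simp add: a_def b_def)
  next
    case False
    then have pos: "0 < r t" using rt by simp
    have dy: "(y has_vector_derivative u - p) (at t)"
      unfolding y_def using dx[OF pos] dxs by (intro derivative_intros)
    have ycont: "isCont y t" using dy has_vector_derivative_continuous by blast
    consider "pi \<le> norm (y t)" | "y t = 0" | "0 < norm (y t)" "norm (y t) < pi" by force
    then have "speed_minorant k (r t) r' s s' p (a t) (b t) a' b' \<le> (r t)\<^sup>2 * (u \<bullet> u) + r'\<^sup>2"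
    proof cases
      case 1
      have at: "a t = - r t" using 1 by (simp add: a_def polar_cos_def y_def min_absorb2)
      have bt: "b t = 0" using 1 by (simp add: b_def polar_sin_def y_def min_absorb2)
      have "r' + a' = 0"
      proof (rule deriv_zero_at_min[of "\<lambda>t. r t + a t"])
        show "\<forall>\<^sub>F s in nhds t. 0 \<le> r s + a s"
          using eventually_mono[OF r, of "\<lambda>s. 0 \<le> r s + a s"] a_le by (force simp: abs_le_iff)
      qed (use at dr da in \<open>auto intro: derivative_intros\<close>)
      then have a': "a' = - r'" by simp
      define e where "e = sgn (y t)"
      have y0: "y t \<noteq> 0" using 1 pi_gt_zero by (metis norm_zero not_le)
      have "((\<lambda>s. sgn (y s) \<bullet> e) \<longlongrightarrow> sgn (y t) \<bullet> e) (nhds t)"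
        using ycont y0 unfolding isCont_def tendsto_at_iff_tendsto_nhds by (intro tendsto_intros)
      moreover have "sgn (y t) \<bullet> e = 1"
        using y0 by (simp add: e_def power2_norm_eq_inner[symmetric] norm_sgn)
      ultimately have ev: "\<forall>\<^sub>F s in nhds t. 1 / 2 < sgn (y s) \<bullet> e"
        by (intro order_tendstoD) auto
      \<comment> \<open>At angle pi or more b vanishes, and nearby it is a nonnegative multiple of a
        direction close to e. So its e-component has a minimum and, doubled, dominates every
        coordinate of b; both facts together force b' = 0.\<close>
      have be: "\<forall>\<^sub>F s in nhds t. norm (b s) \<le> 2 * (b s \<bullet> e)"
        using ev r
      proof eventually_elim
        case (elim s)
        define S where "S = r s * sin (min (norm (y s)) pi)"
        have S: "0 \<le> S" unfolding S_def using elim by (intro mult_nonneg_nonneg sin_ge_zero) auto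
        have bs: "b s = S *\<^sub>R sgn (y s)" by (simp add: b_def S_def polar_sin_def y_def)
        have "norm (b s) \<le> S" using S by (simp add: bs norm_sgn)
        also have "S * 1 \<le> S * (2 * (sgn (y s) \<bullet> e))" using elim S by (intro mult_left_mono) auto
        finally show ?case by (simp add: bs)
      qed
      have be0: "b' \<bullet> e = 0"
      proof (rule deriv_zero_at_min[of "\<lambda>t. b t \<bullet> e", OF db'[of e]])
        show "\<forall>\<^sub>F s in nhds t. 0 \<le> b s \<bullet> e"
        proof (rule eventually_mono[OF be])
          show "0 \<le> b s \<bullet> e" if "norm (b s) \<le> 2 * (b s \<bullet> e)" for s
            using that norm_ge_zero[of "b s"] by linarith
        qed
      qed (simp add: bt)
      have b': "b' = 0"
      proof (rule euclidean_eqI)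
        fix i :: 'a assume i: "i \<in> Basis"
        have "2 * (b' \<bullet> e) - b' \<bullet> i = 0"
        proof (rule deriv_zero_at_min[of "\<lambda>t. 2 * (b t \<bullet> e) - b t \<bullet> i"])
          show "((\<lambda>t. 2 * (b t \<bullet> e) - b t \<bullet> i) has_real_derivative 2 * (b' \<bullet> e) - b' \<bullet> i) (at t)"
            by (intro derivative_intros DERIV_cmult db')
          show "\<forall>\<^sub>F s in nhds t. 0 \<le> 2 * (b s \<bullet> e) - b s \<bullet> i"
          proof (rule eventually_mono[OF be])
            show "0 \<le> 2 * (b s \<bullet> e) - b s \<bullet> i" if "norm (b s) \<le> 2 * (b s \<bullet> e)" for s
              using that Basis_le_norm[OF i, of "b s"] by linarith
          qed
        qed (simp add: bt)
        then show "b' \<bullet> i = 0 \<bullet> i" using be0 by simp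
      qed
      show ?thesis
        unfolding at bt a' b' using rt s by (rule speed_minorant_through_apex)
    next
      case 2
      have at: "a t = r t" "b t = 0" using 2 by (simp_all add: a_def b_def polar_cos_def polar_sin_def y_def)
      have "r' - a' = 0"
      proof (rule deriv_zero_at_min[of "\<lambda>t. r t - a t"])
        show "\<forall>\<^sub>F s in nhds t. 0 \<le> r s - a s"
          using eventually_mono[OF r, of "\<lambda>s. 0 \<le> r s - a s"] a_le by (simp add: abs_le_iff)
      qed (use at dr da in \<open>auto intro: derivative_intros\<close>)
      then have a': "a' = r'" by simp
      have "((\<lambda>t. polar_sin (y t)) has_vector_derivative (u - p)) (at t)"
        using has_derivative_compose[OF dy[unfolded has_vector_derivative_def], of polar_sin "\<lambda>h. h"]
          polar_sin_has_derivative_0 2 by (simp add: has_vector_derivative_def)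
      from has_vector_derivative_scaleR[OF dr this]
      have "(b has_vector_derivative r t *\<^sub>R (u - p)) (at t)"
        by (simp add: b_def y_def[symmetric] 2 polar_sin_def)
      then have b': "b' = r t *\<^sub>R (u - p)" using db vector_derivative_unique_at by blast
      show ?thesis
        unfolding at a' b' by (rule speed_minorant_same_base)
    next
      case 3
      define \<theta> e \<omega> where "\<theta> = norm (y t)" and "e = sgn (y t)" and "\<omega> = e \<bullet> (u - p)"
      have y0: "y t \<noteq> 0" and th: "0 < \<theta>" "\<theta> < pi" using 3 by (auto simp: \<theta>_def)
      have ye: "y t = \<theta> *\<^sub>R e" using y0 by (simp add: \<theta>_def e_def sgn_div_norm)
      have ee: "e \<bullet> e = 1" using y0 by (simp add: e_def power2_norm_eq_inner[symmetric] norm_sgn)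
      have dn: "((\<lambda>t. norm (y t)) has_real_derivative \<omega>) (at t)"
        unfolding has_field_derivative_def
      proof (rule has_derivative_eq_rhs)
        show "((\<lambda>t. norm (y t)) has_derivative (\<lambda>h. (h *\<^sub>R (u - p)) \<bullet> sgn (y t))) (at t)"
          by (rule has_derivative_compose[OF dy[unfolded has_vector_derivative_def] has_derivative_norm[OF y0]])
      qed (simp add: fun_eq_iff \<omega>_def e_def inner_commute)
      have ev: "\<forall>\<^sub>F s in nhds t. 0 < norm (y s) \<and> norm (y s) < pi"
      proof -
        have "((\<lambda>s. norm (y s)) \<longlongrightarrow> norm (y t)) (nhds t)"
          using ycont unfolding isCont_def tendsto_at_iff_tendsto_nhds by (intro tendsto_intros)
        then show ?thesis using 3 by (intro eventually_conj order_tendstoD) auto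
      qed
      have "((\<lambda>t. r t * cos (norm (y t))) has_real_derivative (r' * cos \<theta> - r t * sin \<theta> * \<omega>)) (at t)"
        using dr dn by (auto intro!: derivative_eq_intros simp: \<theta>_def)
      moreover have ev_a: "\<forall>\<^sub>F s in nhds t. r s * cos (norm (y s)) = a s"
        using ev by eventually_elim (simp add: a_def polar_cos_def y_def)
      ultimately have "(a has_real_derivative (r' * cos \<theta> - r t * sin \<theta> * \<omega>)) (at t)"
        using DERIV_cong_ev[OF refl ev_a refl] by blast
      then have a': "a' = r' * cos \<theta> - r t * sin \<theta> * \<omega>" using da DERIV_unique by blast
      \<comment> \<open>Writing b as a scalar multiple of y rather than of its direction avoids
        differentiating \<open>sgn\<close>.\<close>
      define c where "c s = r s * (sin (norm (y s)) / norm (y s))" for s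
      define c' where "c' = r' * (sin \<theta> / \<theta>) + r t * ((cos \<theta> * \<omega> * \<theta> - sin \<theta> * \<omega>) / (\<theta> * \<theta>))"
      have "(c has_real_derivative c') (at t)"
        unfolding c_def c'_def using dr dn th
        by (auto intro!: derivative_eq_intros simp: \<theta>_def field_simps)
      from has_vector_derivative_scaleR[OF this dy]
      have "((\<lambda>s. c s *\<^sub>R y s) has_vector_derivative (c t *\<^sub>R (u - p) + c' *\<^sub>R y t)) (at t)" .
      moreover have ev_b: "\<forall>\<^sub>F s in nhds t. c s *\<^sub>R y s = b s"
        using ev by eventually_elim (simp add: b_def c_def polar_sin_def sgn_div_norm y_def divide_inverse)
      ultimately have "(b has_vector_derivative (c t *\<^sub>R (u - p) + c' *\<^sub>R y t)) (at t)"
        unfolding has_vector_derivative_def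
        using eventually_nhds_x_imp_x[OF ev_b] ev_b
        by (elim has_derivative_transform_eventually) (auto simp: eventually_at_filter elim: eventually_mono)
      then have "b' = c t *\<^sub>R (u - p) + c' *\<^sub>R y t" using db vector_derivative_unique_at by blast
      also have "\<dots> = (r t * sin \<theta> / \<theta>) *\<^sub>R (u - p) + (c' * \<theta>) *\<^sub>R e"
      proof -
        have "c t = r t * sin \<theta> / \<theta>" by (simp add: c_def \<theta>_def)
        then show ?thesis unfolding ye by simp
      qed
      also have "c' * \<theta> = (r' * sin \<theta> + r t * cos \<theta> * \<omega>) - (r t * sin \<theta> / \<theta>) * \<omega>"
        using th by (simp add: c'_def field_simps)
      finally have b': "b' = (r' * sin \<theta> + r t * cos \<theta> * \<omega>) *\<^sub>R e + (r t * sin \<theta> / \<theta>) *\<^sub>R (u - p - \<omega> *\<^sub>R e)"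
        by (simp add: algebra_simps)
      have at: "a t = r t * cos \<theta>" "b t = (r t * sin \<theta>) *\<^sub>R e"
        using th by (simp_all add: a_def b_def polar_cos_def polar_sin_def \<theta>_def e_def y_def)
      show ?thesis
        by (rule speed_minorant_generic[OF rt s ee th \<omega>_def at(1) a' at(2) b'])
    qed
    then show ?thesis using pos by simp
  qed
qed

section \<open>Comparison of a path with a critical path\<close>

lemma cone_pt_in_cone: "x \<in> M \<Longrightarrow> 0 \<le> r \<Longrightarrow> cone_pt x\<^sub>0 x r \<in> cone x\<^sub>0 M"
  by (auto simp: cone_def)

lemma cone_memD:
  assumes "z \<in> cone x\<^sub>0 M" "x\<^sub>0 \<in> M"
  shows "0 \<le> snd z" "fst z \<in> M" "snd z = 0 \<Longrightarrow> fst z = x\<^sub>0"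
  using assms by (auto simp: cone_def cone_pt_def split: if_splits)

lemma pathsD:
  assumes "z \<in> paths T x\<^sub>0 M" "x\<^sub>0 \<in> M" "t \<in> {0..T}"
  shows "z t \<in> cone x\<^sub>0 M" "0 \<le> snd (z t)" "fst (z t) \<in> M"
proof -
  show "z t \<in> cone x\<^sub>0 M" using assms by (auto simp: path_space_def)
  from cone_memD[OF this assms(2)] show "0 \<le> snd (z t)" "fst (z t) \<in> M" by auto
qed

text \<open>The position may jump at the apex, but f is bounded there and the factor r^2 tends to 0.
  Where r > 0 the position is the continuous quotient of r x by r.\<close>

lemma continuous_on_potential:
  fixes f :: "real \<Rightarrow> 'a::real_normed_vector \<Rightarrow> real"
  assumes f: "continuous_on (I \<times> M) (\<lambda>(t, x). f t x)" and I: "compact I" and M: "compact M"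
    and r: "continuous_on I r" and rx: "continuous_on I (\<lambda>t. r t *\<^sub>R x t)"
    and xM: "\<And>t. t \<in> I \<Longrightarrow> x t \<in> M" and r0: "\<And>t. t \<in> I \<Longrightarrow> 0 \<le> r t"
  shows "continuous_on I (\<lambda>t. f t (x t) * (r t)\<^sup>2)"
  unfolding continuous_on
proof
  fix t assume t: "t \<in> I"
  have rl: "(r \<longlongrightarrow> r t) (at t within I)" using r t by (auto simp: continuous_on)
  have "bounded ((\<lambda>(t, x). f t x) ` (I \<times> M))"
    by (intro compact_imp_bounded compact_continuous_image f compact_Times I M)
  then obtain B where B: "B > 0" "\<And>s y. s \<in> I \<Longrightarrow> y \<in> M \<Longrightarrow> \<bar>f s y\<bar> \<le> B"
    unfolding bounded_pos by fastforce
  have evI: "\<forall>\<^sub>F s in at t within I. s \<in> I" by (simp add: eventually_at_filter)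
  show "((\<lambda>t. f t (x t) * (r t)\<^sup>2) \<longlongrightarrow> f t (x t) * (r t)\<^sup>2) (at t within I)"
  proof (cases "r t = 0")
    case True
    have "((\<lambda>s. B * (r s)\<^sup>2) \<longlongrightarrow> B * (r t)\<^sup>2) (at t within I)" by (intro tendsto_intros rl)
    then have lim: "((\<lambda>s. B * (r s)\<^sup>2) \<longlongrightarrow> 0) (at t within I)" using True by simp
    have "((\<lambda>s. f s (x s) * (r s)\<^sup>2) \<longlongrightarrow> 0) (at t within I)"
    proof (rule Lim_null_comparison[OF _ lim])
      show "\<forall>\<^sub>F s in at t within I. norm (f s (x s) * (r s)\<^sup>2) \<le> B * (r s)\<^sup>2"
        using evI by eventually_elim (use B xM in \<open>auto simp: abs_mult intro!: mult_right_mono\<close>)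
    qed
    then show ?thesis using True by simp
  next
    case False
    then have pos: "0 < r t" using r0[OF t] by simp
    have "((\<lambda>s. (1 / r s) *\<^sub>R (r s *\<^sub>R x s)) \<longlongrightarrow> (1 / r t) *\<^sub>R (r t *\<^sub>R x t)) (at t within I)"
    proof (rule tendsto_scaleR)
      show "((\<lambda>s. 1 / r s) \<longlongrightarrow> 1 / r t) (at t within I)"
        using False by (intro tendsto_divide tendsto_const rl)
      show "((\<lambda>s. r s *\<^sub>R x s) \<longlongrightarrow> r t *\<^sub>R x t) (at t within I)"
        using rx t by (simp add: continuous_on)
    qed
    moreover have ev: "\<forall>\<^sub>F s in at t within I. 0 < r s" using rl pos by (rule order_tendstoD)
    then have "\<forall>\<^sub>F s in at t within I. (1 / r s) *\<^sub>R (r s *\<^sub>R x s) = x s"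
      by eventually_elim auto
    ultimately have "(x \<longlongrightarrow> (1 / r t) *\<^sub>R (r t *\<^sub>R x t)) (at t within I)"
      by (rule Lim_transform_eventually)
    then have xl: "(x \<longlongrightarrow> x t) (at t within I)" using False by simp
    have "((\<lambda>s. (\<lambda>(t, x). f t x) (s, x s)) \<longlongrightarrow> (\<lambda>(t, x). f t x) (t, x t)) (at t within I)"
    proof (rule continuous_on_tendsto_compose[OF f])
      show "((\<lambda>s. (s, x s)) \<longlongrightarrow> (t, x t)) (at t within I)" by (intro tendsto_intros xl)
      show "\<forall>\<^sub>F s in at t within I. (s, x s) \<in> I \<times> M" using evI by eventually_elim (simp add: xM)
    qed (use t xM in auto)
    then show ?thesis by (intro tendsto_mult tendsto_power rl) auto
  qed
qed

locale comparison =
  fixes T :: real and M :: "'a::euclidean_space set" and x\<^sub>0 :: 'a and P :: "real \<Rightarrow> 'a \<Rightarrow> real"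
    and K :: real and g xs x1 x2 :: "real \<Rightarrow> 'a" and rs r1 r2 :: "real \<Rightarrow> real"
  assumes T: "0 < T" and M: "compact M" "x\<^sub>0 \<in> M"
    and xs: "\<And>t. t \<in> {0..T} \<Longrightarrow> (xs has_vector_derivative x1 t) (at t within {0..T})"
      "\<And>t. t \<in> {0..T} \<Longrightarrow> (x1 has_vector_derivative x2 t) (at t within {0..T})"
      "continuous_on {0..T} x2" "\<And>t. t \<in> {0..T} \<Longrightarrow> xs t \<in> M"
    and rs: "\<And>t. t \<in> {0..T} \<Longrightarrow> (rs has_vector_derivative r1 t) (at t within {0..T})"
      "\<And>t. t \<in> {0..T} \<Longrightarrow> (r1 has_vector_derivative r2 t) (at t within {0..T})"
      "continuous_on {0..T} r2" "\<And>t. t \<in> {0..T} \<Longrightarrow> 0 \<le> rs t"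
    and el_x: "\<And>t. t \<in> {0..T} \<Longrightarrow> rs t *\<^sub>R x2 t + (2 * r1 t) *\<^sub>R x1 t + (rs t / 2) *\<^sub>R g t = 0"
    and el_r: "\<And>t. t \<in> {0..T} \<Longrightarrow> r2 t - rs t * (norm (x1 t))\<^sup>2 + rs t * P t (xs t) = 0"
    and P: "continuous_on ({0..T} \<times> M) (\<lambda>(t, x). P t x)"
      "\<And>t x. t \<in> {0..T} \<Longrightarrow> x \<in> M \<Longrightarrow> \<bar>P t x\<bar> \<le> K / 2"
      "\<And>t y. t \<in> {0..T} \<Longrightarrow> \<bar>g t \<bullet> y\<bar> \<le> K * norm y"
      "\<And>t x. t \<in> {0..T} \<Longrightarrow> x \<in> M \<Longrightarrow> \<bar>P t x - P t (xs t) - g t \<bullet> (x - xs t)\<bar> \<le> K * (norm (x - xs t))\<^sup>2"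
    and K: "64 * K \<le> 1 / (2 * T\<^sup>2)"
begin

definition gap :: "(real \<Rightarrow> 'a \<times> real) \<Rightarrow> real \<Rightarrow> real" where
  "gap z t = (cone_dist (z t) (xs t, rs t))\<^sup>2"

definition ca :: "(real \<Rightarrow> 'a \<times> real) \<Rightarrow> real \<Rightarrow> real" where
  "ca z t = snd (z t) * polar_cos (fst (z t) - xs t)"

definition cb :: "(real \<Rightarrow> 'a \<times> real) \<Rightarrow> real \<Rightarrow> 'a" where
  "cb z t = snd (z t) *\<^sub>R polar_sin (fst (z t) - xs t)"

text \<open>The weight solves \<open>k' + k\<^sup>2 \<le> - 1 / T\<^sup>2\<close> on \<open>[0,T]\<close>, a Riccati form of the Poincare inequality.\<close>

definition weight :: "real \<Rightarrow> real" where
  "weight t = - (2 / T\<^sup>2) * (t - T / 2)"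

text \<open>With V = (b, a - rs) the logarithm of z at the critical path, this is twice the inner
  product of V with the velocity of that path, plus \<open>rs * r1\<close>, plus k |V|^2. Where the
  two paths meet V is 0 and only \<open>rs * r1\<close> is left.\<close>

definition calib :: "(real \<Rightarrow> 'a \<times> real) \<Rightarrow> real \<Rightarrow> real" where
  "calib z t = 2 * (rs t * (x1 t \<bullet> cb z t) + r1 t * ca z t) - rs t * r1 t
     + weight t * ((snd (z t))\<^sup>2 + (rs t)\<^sup>2 - 2 * rs t * ca z t)"

lemma weight_riccati:
  assumes "t \<in> {0..T}"
  shows "1 / T\<^sup>2 \<le> 2 / T\<^sup>2 - (weight t)\<^sup>2"
proof -
  have "\<bar>t - T / 2\<bar> \<le> T / 2" using assms by (simp add: abs_le_iff field_simps)
  then have "(t - T / 2)\<^sup>2 \<le> (T / 2)\<^sup>2" by (metis abs_ge_zero power2_abs power_mono)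
  then have "(weight t)\<^sup>2 \<le> (2 / T\<^sup>2)\<^sup>2 * (T / 2)\<^sup>2"
    unfolding weight_def power_mult_distrib by (simp add: mult_left_mono)
  also have "\<dots> = 1 / T\<^sup>2" using T by (simp add: power2_eq_square field_simps)
  finally show ?thesis by (simp add: add_divide_distrib[symmetric] diff_divide_distrib[symmetric] field_simps)
qed

lemma gap_eq:
  assumes "z \<in> paths T x\<^sub>0 M" "t \<in> {0..T}"
  shows "gap z t = (snd (z t))\<^sup>2 + (rs t)\<^sup>2 - 2 * rs t * ca z t" "0 \<le> gap z t"
proof -
  have 1: "0 \<le> snd (z t)" "0 \<le> rs t" using pathsD[OF assms(1) M(2) assms(2)] rs(4)[OF assms(2)] by auto
  show "gap z t = (snd (z t))\<^sup>2 + (rs t)\<^sup>2 - 2 * rs t * ca z t"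
    unfolding gap_def using cone_dist_sq[of "z t" "(xs t, rs t)"] 1
    by (simp add: ca_def polar_cos_def dist_norm power2_diff algebra_simps)
  show "0 \<le> gap z t" by (simp add: gap_def)
qed

lemma continuous_derivs: "continuous_on {0..T} x1" "continuous_on {0..T} r1" "continuous_on {0..T} xs" "continuous_on {0..T} rs"
  unfolding continuous_on_eq_continuous_within
  by (intro ballI has_vector_derivative_continuous[OF xs(2)] has_vector_derivative_continuous[OF rs(2)]
      has_vector_derivative_continuous[OF xs(1)] has_vector_derivative_continuous[OF rs(1)]; assumption)+

text \<open>\<open>calib\<close> plays the role of a calibration: its derivative, increased by the
  potential and the distance term, stays below the squared speed almost everywhere. After
  integration only its boundary values remain, and they do not depend on z because the endpoints
  agree.\<close>

lemma action_ge:
  assumes z: "z \<in> AC2 T x\<^sub>0 M"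
    and e0: "snd (z 0) = rs 0" "rs 0 > 0 \<Longrightarrow> fst (z 0) = xs 0"
    and eT: "snd (z T) = rs T" "rs T > 0 \<Longrightarrow> fst (z T) = xs T"
  shows "ennreal (rs T * r1 T - rs 0 * r1 0
      + integral {0..T} (\<lambda>t. P t (fst (z t)) * (snd (z t))\<^sup>2 + gap z t / (2 * T\<^sup>2))) \<le> path_action T x\<^sub>0 M z"
proof -
  have zp: "z \<in> paths T x\<^sub>0 M" and za: "abs_cont T z" using z by (auto simp: AC2_def)
  note zM = pathsD[OF zp M(2)]
  obtain m0 where m0: "set_integrable lebesgue {0..T} m0" "\<And>s t. 0 \<le> s \<Longrightarrow> s \<le> t \<Longrightarrow> t \<le> T \<Longrightarrow>
      cone_dist (z s) (z t) \<le> (LINT u:{s..t}|lebesgue. m0 u)"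
    using za unfolding abs_cont_def by blast
  define m where "m u = \<bar>m0 u\<bar>" for u
  have m: "m integrable_on {0..T}" "\<And>u. 0 \<le> m u"
    using set_lebesgue_integral_eq_integral(1)[OF set_integrable_abs[OF m0(1)]] by (auto simp: m_def[abs_def])
  have zm: "cone_dist (z s) (z t) \<le> integral {s..t} m" if "0 \<le> s" "s \<le> t" "t \<le> T" for s t
  proof -
    have i: "set_integrable lebesgue {s..t} m0" using m0(1) by (rule set_integrable_subset) (use that in auto)
    have "(LINT u:{s..t}|lebesgue. m0 u) \<le> (LINT u:{s..t}|lebesgue. m u)"
      unfolding m_def by (intro set_integral_mono i set_integrable_abs) auto
    also have "\<dots> = integral {s..t} m"
      unfolding m_def by (intro set_lebesgue_integral_eq_integral set_integrable_abs i)
    finally show ?thesis using m0(2)[OF that] by simp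
  qed
  obtain Lx where Lx: "Lx-lipschitz_on {0..T} xs"
    using lipschitz_on_continuous_deriv[OF xs(1) continuous_derivs(1)] by blast
  have Lx': "norm (xs t - xs s) \<le> Lx * \<bar>t - s\<bar>" if "s \<in> {0..T}" "t \<in> {0..T}" for s t
    using lipschitz_onD[OF Lx that(2,1)] by (simp add: dist_norm)
  have Lx0: "0 \<le> Lx" using Lx by (rule lipschitz_on_nonneg)
  obtain B where B: "0 < B" "\<And>x. x \<in> M \<Longrightarrow> norm x \<le> B"
    using compact_imp_bounded[OF M(1)] unfolding bounded_pos by blast
  have zM': "0 \<le> snd (z t) \<and> fst (z t) \<in> M" if "t \<in> {0..T}" for t using zM[OF that] by auto
  note acr = ac_cone_radial[OF m zm zM']
  have ac_r: "ac T (\<lambda>t. snd (z t))"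
    using acr[of "\<lambda>_ _. 1::real" 1 0 0] by simp
  have ac_rx: "ac T (\<lambda>t. snd (z t) *\<^sub>R fst (z t))"
    using acr[of "\<lambda>_ x. x" B 1 0] B by (simp add: dist_norm)
  have ac_a: "ac T (ca z)"
  proof -
    have "ac T (\<lambda>t. snd (z t) *\<^sub>R polar_cos (fst (z t) - xs t))"
    proof (rule acr[of "\<lambda>t x. polar_cos (x - xs t)" 1 1 Lx])
      show "norm (polar_cos (x - xs t) - polar_cos (x - xs s)) \<le> Lx * \<bar>t - s\<bar>" if "s \<in> {0..T}" "t \<in> {0..T}" for s t x
        using polar_cos_lipschitz[of "x - xs t" "x - xs s"] Lx'[OF that] by (simp add: norm_minus_commute)
      show "norm (polar_cos (x - xs t) - polar_cos (y - xs t)) \<le> 1 * dist x y" for x y t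
        using polar_cos_lipschitz[of "x - xs t" "y - xs t"] by (simp add: dist_norm)
    qed (use Lx0 polar_cos_bound in auto)
    then show ?thesis unfolding ca_def[abs_def] by simp
  qed
  have ac_b: "ac T (cb z)"
    unfolding cb_def[abs_def]
  proof (rule acr[of "\<lambda>t x. polar_sin (x - xs t)" 1 3 "3 * Lx"])
    show "norm (polar_sin (x - xs t) - polar_sin (x - xs s)) \<le> 3 * Lx * \<bar>t - s\<bar>" if "s \<in> {0..T}" "t \<in> {0..T}" for s t x
      using polar_sin_lipschitz[of "x - xs t" "x - xs s"] Lx'[OF that] by (simp add: norm_minus_commute)
    show "norm (polar_sin (x - xs t) - polar_sin (y - xs t)) \<le> 3 * dist x y" for x y t
      using polar_sin_lipschitz[of "x - xs t" "y - xs t"] by (simp add: dist_norm)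
  qed (use Lx0 norm_polar_sin_le in auto)
  have ac_rs: "ac T rs" "ac T r1" "ac T x1"
    by (rule ac_C1[OF rs(1) continuous_derivs(2)] ac_C1[OF rs(2,3)] ac_C1[OF xs(2,3)]; assumption)+
  have ac_w: "ac T weight"
    by (rule ac_C1[where f'="\<lambda>_. - (2 / T\<^sup>2)"])
       (auto simp: weight_def[abs_def] intro!: derivative_eq_intros)
  have ac_N: "ac T (calib z)"
    unfolding calib_def[abs_def] power2_eq_square
    by (intro ac_add ac_diff ac_mult ac_inner ac_const ac_r ac_a ac_b ac_rs ac_w)
  obtain Zr where Zr: "negligible Zr" "\<And>t. t \<in> {0<..<T} \<Longrightarrow> t \<notin> Zr \<Longrightarrow> (\<lambda>t. snd (z t)) differentiable (at t)"
    using ac_differentiable_AE[OF ac_r T] by blast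
  obtain Zx where Zx: "negligible Zx" "\<And>t. t \<in> {0<..<T} \<Longrightarrow> t \<notin> Zx \<Longrightarrow> (\<lambda>t. snd (z t) *\<^sub>R fst (z t)) differentiable (at t)"
    using ac_differentiable_AE[OF ac_rx T] by blast
  obtain Za where Za: "negligible Za" "\<And>t. t \<in> {0<..<T} \<Longrightarrow> t \<notin> Za \<Longrightarrow> ca z differentiable (at t)"
    using ac_differentiable_AE[OF ac_a T] by blast
  obtain Zb where Zb: "negligible Zb" "\<And>t. t \<in> {0<..<T} \<Longrightarrow> t \<notin> Zb \<Longrightarrow> cb z differentiable (at t)"
    using ac_differentiable_AE[OF ac_b T] by blast
  define h where "h t = P t (fst (z t)) * (snd (z t))\<^sup>2 + gap z t / (2 * T\<^sup>2)" for t
  have h: "continuous_on {0..T} h"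
  proof -
    have "continuous_on {0..T} (\<lambda>t. P t (fst (z t)) * (snd (z t))\<^sup>2)"
      using P(1) M(1) ac_continuous_on[OF ac_r] ac_continuous_on[OF ac_rx] zM'
      by (intro continuous_on_potential[of _ M]) auto
    moreover have "continuous_on {0..T} (gap z)"
    proof (rule continuous_on_eq)
      show "continuous_on {0..T} (\<lambda>t. (snd (z t))\<^sup>2 + (rs t)\<^sup>2 - 2 * rs t * ca z t)"
        by (intro continuous_intros ac_continuous_on ac_r ac_rs ac_a)
    qed (simp add: gap_eq[OF zp])
    ultimately show ?thesis unfolding h_def[abs_def] using T
      by (intro continuous_on_add continuous_on_divide continuous_on_const) auto
  qed
  have "ennreal (calib z T - calib z 0 + integral {0..T} h) \<le> (\<integral>\<^sup>+t\<in>{0..T}. ennreal (path_speed_sq T z t) \<partial>lebesgue)"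
  proof (rule ac_integral_le[OF ac_N T h, of "Zr \<union> Zx \<union> Za \<union> Zb"])
    show "negligible (Zr \<union> Zx \<union> Za \<union> Zb)" using Zr(1) Zx(1) Za(1) Zb(1) by (simp add: negligible_Un)
    fix t D assume t: "t \<in> {0<..<T}" "t \<notin> Zr \<union> Zx \<union> Za \<union> Zb" and D: "(calib z has_real_derivative D) (at t)"
    have tT: "t \<in> {0..T}" using t by auto
    have at: "at t within {0..T} = at t" using t by (intro at_within_interior) auto
    obtain r' where dr: "((\<lambda>t. snd (z t)) has_real_derivative r') (at t)"
      using Zr(2)[of t] t by (auto simp: real_differentiable_def)
    obtain a' where da: "(ca z has_real_derivative a') (at t)"
      using Za(2)[of t] t by (auto simp: real_differentiable_def)
    obtain b' where db: "(cb z has_vector_derivative b') (at t)"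
      using Zb(2)[of t] t vector_derivative_works by blast
    have ev: "\<forall>\<^sub>F s in nhds t. s \<in> {0<..<T}" using t(1) by (intro eventually_nhds_in_open) auto
    have ev0: "\<forall>\<^sub>F s in nhds t. 0 \<le> snd (z s)"
      using ev by eventually_elim (use zM in auto)
    define u where "u = vector_derivative (\<lambda>s. fst (z s)) (at t)"
    \<comment> \<open>Only r x is known to be differentiable almost everywhere; where r > 0 the
      position is recovered as a quotient.\<close>
    have du: "((\<lambda>s. fst (z s)) has_vector_derivative u) (at t)" if pos: "0 < snd (z t)"
    proof -
      have rd: "(\<lambda>s. 1 / snd (z s)) differentiable (at t)"
        using dr pos by (intro differentiable_divide) (auto simp: real_differentiable_def)
      have "(\<lambda>s. (1 / snd (z s)) *\<^sub>R (snd (z s) *\<^sub>R fst (z s))) differentiable (at t)"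
        by (rule differentiable_scaleR[OF rd Zx(2)]) (use t in auto)
      moreover have "\<forall>\<^sub>F s in nhds t. 0 < snd (z s)"
      proof -
        have "isCont (\<lambda>s. snd (z s)) t" using dr by (rule DERIV_isCont)
        then have "((\<lambda>s. snd (z s)) \<longlongrightarrow> snd (z t)) (nhds t)"
          unfolding isCont_def using tendsto_at_iff_tendsto_nhds[of "\<lambda>s. snd (z s)" t] by simp
        then show ?thesis using pos by (rule order_tendstoD)
      qed
      then have e: "\<forall>\<^sub>F s in nhds t. (1 / snd (z s)) *\<^sub>R (snd (z s) *\<^sub>R fst (z s)) = fst (z s)"
        by eventually_elim auto
      ultimately obtain F where "((\<lambda>s. (1 / snd (z s)) *\<^sub>R (snd (z s) *\<^sub>R fst (z s))) has_derivative F) (at t)"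
        unfolding differentiable_def by blast
      then have "((\<lambda>s. fst (z s)) has_derivative F) (at t)"
        using eventually_nhds_x_imp_x[OF e] e
        by (elim has_derivative_transform_eventually) (auto simp: eventually_at_filter elim: eventually_mono)
      then have "(\<lambda>s. fst (z s)) differentiable (at t)" by (rule differentiableI)
      then show ?thesis unfolding u_def using vector_derivative_works by blast
    qed
    have speed: "path_speed_sq T z t = (if snd (z t) > 0 then (snd (z t))\<^sup>2 * (u \<bullet> u) + r'\<^sup>2 else 0)"
    proof (cases "snd (z t) > 0")
      case True
      have "(\<lambda>s. fst (z s)) differentiable (at t)" using du[OF True] by (rule differentiableI_vector)
      moreover have "(\<lambda>s. snd (z s)) differentiable (at t)" using dr by (auto simp: real_differentiable_def)
      moreover have "vector_derivative (\<lambda>s. snd (z s)) (at t) = r'"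
        using dr by (intro vector_derivative_at) (simp add: has_real_derivative_iff_has_vector_derivative)
      ultimately show ?thesis
        using True by (simp add: path_speed_sq_def at Let_def cone_tensor_def u_def power2_eq_square)
    qed (simp add: path_speed_sq_def)
    let ?r = "snd (z t)" and ?s = "rs t" and ?p = "x1 t" and ?a = "ca z t" and ?b = "cb z t" and ?k = "weight t"
    have s0: "0 \<le> ?s" "0 \<le> ?r" using rs(4) zM tT by auto
    have min: "speed_minorant ?k ?r r' ?s (r1 t) ?p ?a ?b a' b' \<le> path_speed_sq T z t"
      unfolding speed ca_def cb_def
      using dr da db du xs(1)[OF tT] s0 ev0 unfolding at ca_def[abs_def] cb_def[abs_def]
      by (intro speed_minorant_le) auto
    have drs: "(rs has_real_derivative r1 t) (at t)" "(r1 has_real_derivative r2 t) (at t)"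
      using rs(1,2)[OF tT] unfolding at by (auto simp: has_real_derivative_iff_has_vector_derivative)
    have dpb: "((\<lambda>t. x1 t \<bullet> cb z t) has_real_derivative (?p \<bullet> b' + x2 t \<bullet> ?b)) (at t)"
      unfolding has_real_derivative_iff_has_vector_derivative
      using xs(2)[OF tT] unfolding at
      by (intro bounded_bilinear.has_vector_derivative[OF bounded_bilinear_inner] db)
    have dw: "(weight has_real_derivative - (2 / T\<^sup>2)) (at t)"
    proof -
      have "((\<lambda>t. c * (t - T / 2)) has_real_derivative c) (at t)" for c
        by (auto intro!: derivative_eq_intros)
      then show ?thesis unfolding weight_def[abs_def] .
    qed
    define E where "E = ?r\<^sup>2 + ?s\<^sup>2 - 2 * ?s * ?a"
    define E' where "E' = 2 * ?r * r' + 2 * ?s * r1 t - 2 * r1 t * ?a - 2 * ?s * a'"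
    have "(calib z has_real_derivative
        (2 * ((r1 t * (?p \<bullet> ?b) + ?s * (?p \<bullet> b' + x2 t \<bullet> ?b)) + (r2 t * ?a + r1 t * a'))
         - (r1 t * r1 t + ?s * r2 t) + (- (2 / T\<^sup>2) * E + ?k * E'))) (at t)"
      unfolding calib_def[abs_def] E_def E'_def
      by (rule derivative_eq_intros drs dpb dw da dr refl)+ (simp add: algebra_simps)
    then have D': "D = 2 * ((r1 t * (?p \<bullet> ?b) + ?s * (?p \<bullet> b' + x2 t \<bullet> ?b)) + (r2 t * ?a + r1 t * a'))
         - (r1 t * r1 t + ?s * r2 t) + (- (2 / T\<^sup>2) * E + ?k * E')"
      using D DERIV_unique by blast
    have EG: "E = gap z t" "0 \<le> E" using gap_eq[OF zp tT] by (simp_all add: E_def)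
    have elx: "?s * (x2 t \<bullet> ?b) = - 2 * r1 t * (?p \<bullet> ?b) - ?s / 2 * (g t \<bullet> ?b)"
    proof -
      have "(?s *\<^sub>R x2 t + (2 * r1 t) *\<^sub>R ?p + (?s / 2) *\<^sub>R g t) \<bullet> ?b = 0"
        unfolding el_x[OF tT] by simp
      then show ?thesis by (simp add: inner_add_left)
    qed
    have elr: "r2 t = ?s * (?p \<bullet> ?p) - ?s * P t (xs t)"
      using el_r[OF tT] by (simp add: power2_norm_eq_inner)
    \<comment> \<open>The remainder of P r^2 after its first-order expansion at the critical path in
      the direction (b, a - rs). The linear part is exactly what the equations of motion put into
      the derivative of \<open>calib\<close> in place of the second derivatives.\<close>
    define R where "R = P t (fst (z t)) * ?r\<^sup>2 - P t (xs t) * ?s\<^sup>2 - ?s * (g t \<bullet> ?b) - 2 * ?s * P t (xs t) * (?a - ?s)"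
    have R: "R \<le> 64 * K * E"
    proof (cases "norm (fst (z t) - xs t) < pi")
      case True
      define \<theta> where "\<theta> = norm (fst (z t) - xs t)"
      have gb: "g t \<bullet> ?b = ?r * (sin \<theta> / \<theta>) * (g t \<bullet> (fst (z t) - xs t))"
        using True by (simp add: cb_def polar_sin_def \<theta>_def sgn_div_norm divide_inverse)
      have "P t (fst (z t)) * ?r\<^sup>2 - P t (xs t) * ?s\<^sup>2 - ?r * ?s * (sin \<theta> / \<theta>) * (g t \<bullet> (fst (z t) - xs t)) - 2 * ?s * P t (xs t) * (?r * cos \<theta> - ?s)
         \<le> 64 * K * (?r\<^sup>2 + ?s\<^sup>2 - 2 * ?r * ?s * cos \<theta>)"
        using P(2)[OF tT xs(4)[OF tT]] P(3,4)[OF tT] zM(3)[OF tT] True s0 unfolding \<theta>_def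
        by (intro potential_remainder_le) auto
      moreover have "?a = ?r * cos \<theta>" using True by (simp add: ca_def polar_cos_def \<theta>_def)
      ultimately show ?thesis unfolding R_def E_def gb by (simp add: mult_ac)
    next
      case False
      then have "?a = - ?r" "?b = 0" by (simp_all add: ca_def cb_def polar_cos_def polar_sin_def min_absorb2)
      then show ?thesis
        using potential_remainder_far_le[OF s0(2,1) P(2)[OF tT xs(4)[OF tT]] P(2)[OF tT zM(3)[OF tT]]]
        by (simp add: R_def E_def mult_ac)
    qed
    \<comment> \<open>The margin 1/T^2 left by the weight is divided evenly: one half absorbs
      \<open>R\<close>, the other survives as the distance term.\<close>
    have "64 * K * E \<le> 1 / (2 * T\<^sup>2) * E" using K EG(2) by (rule mult_right_mono)
    moreover have "1 / T\<^sup>2 * E \<le> (2 / T\<^sup>2 - ?k\<^sup>2) * E" using weight_riccati[OF tT] EG(2) by (rule mult_right_mono)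
    moreover have "1 / T\<^sup>2 * E = 1 / (2 * T\<^sup>2) * E + E / (2 * T\<^sup>2)" using T by (simp add: field_simps)
    ultimately have "P t (fst (z t)) * ?r\<^sup>2 + E / (2 * T\<^sup>2) \<le> P t (fst (z t)) * ?r\<^sup>2 - R + (2 / T\<^sup>2 - ?k\<^sup>2) * E"
      using R by linarith
    moreover have "D + (P t (fst (z t)) * ?r\<^sup>2 - R + (2 / T\<^sup>2 - ?k\<^sup>2) * E)
      = speed_minorant ?k ?r r' ?s (r1 t) ?p ?a ?b a' b'"
    proof -
      have "D = 2 * (?s * (?p \<bullet> b') - r1 t * (?p \<bullet> ?b) - ?s / 2 * (g t \<bullet> ?b) + r2 t * ?a + r1 t * a')
         - (r1 t * r1 t + ?s * r2 t) + (- (2 / T\<^sup>2) * E + ?k * E')"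
        unfolding D' distrib_left[of ?s] elx by (simp add: algebra_simps)
      then show ?thesis
        unfolding R_def speed_minorant_def elr E_def[symmetric] E'_def[symmetric]
        by (simp add: inner_add_right inner_commute[of ?b] power2_eq_square algebra_simps)
    qed
    ultimately show "D + h t \<le> path_speed_sq T z t"
      unfolding h_def EG(1)[symmetric] using min by linarith
  qed
  moreover have "calib z T = rs T * r1 T" "calib z 0 = rs 0 * r1 0"
  proof -
    \<comment> \<open>If \<open>rs\<close> is 0 the endpoint of z is the apex as well and every term
      vanishes, so positions are compared only at positive radius.\<close>
    have *: "calib z t = rs t * r1 t" if "t \<in> {0..T}" "snd (z t) = rs t" "rs t > 0 \<Longrightarrow> fst (z t) = xs t" for t
    proof (cases "rs t = 0")
      case False
      then have "fst (z t) = xs t" using that rs(4)[OF that(1)] by simp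
      then show ?thesis using that(2) by (simp add: calib_def ca_def cb_def polar_cos_def polar_sin_def power2_eq_square)
    qed (use that(2) in \<open>simp add: calib_def ca_def cb_def\<close>)
    show "calib z T = rs T * r1 T" "calib z 0 = rs 0 * r1 0" using *[of T] *[of 0] e0 eT T by auto
  qed
  ultimately show ?thesis
    using z unfolding path_action_def h_def[abs_def] by simp
qed

end

section \<open>Hessian bounds on the pressure\<close>

text \<open>The derivatives are partial derivatives of a smooth extension to an open neighbourhood,
  so the ends of the time interval and the boundary of M need no separate treatment.\<close>

lemma smooth_on_time_derivatives:
  fixes f :: "real \<Rightarrow> 'a::real_normed_vector \<Rightarrow> 'b::real_normed_vector"
  assumes f: "smooth_on ({0..T} \<times> M) (\<lambda>(t, x). f t x)"
  obtains f1 f2 where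
    "continuous_on ({0..T} \<times> M) (\<lambda>(t, x). f1 t x)" "continuous_on ({0..T} \<times> M) (\<lambda>(t, x). f2 t x)"
    "\<And>t x. t \<in> {0..T} \<Longrightarrow> x \<in> M \<Longrightarrow> ((\<lambda>s. f s x) has_vector_derivative f1 t x) (at t within {0..T})"
    "\<And>t x. t \<in> {0..T} \<Longrightarrow> x \<in> M \<Longrightarrow> ((\<lambda>s. f1 s x) has_vector_derivative f2 t x) (at t within {0..T})"
proof -
  obtain U g where U: "open U" "{0..T} \<times> M \<subseteq> U" "\<And>k. Ck_on k U g"
    "\<And>p. p \<in> {0..T} \<times> M \<Longrightarrow> g p = (\<lambda>(t, x). f t x) p"
    using f unfolding smooth_on_def by blast
  define g1 where "g1 = (\<lambda>p. frechet_derivative g (at p) (1, 0))"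
  define g2 where "g2 = (\<lambda>p. frechet_derivative g1 (at p) (1, 0))"
  have Ck1: "Ck_on k U g1" for k using U(3)[of "Suc k"] by (simp add: g1_def)
  have Ck2: "Ck_on k U g2" for k using Ck1[of "Suc k"] by (simp add: g2_def)
  have dg: "g differentiable at p" "g1 differentiable at p" if "p \<in> U" for p
    using U(3)[of 1] Ck1[of 1] that by (auto simp: One_nat_def simp del: One_nat_def[symmetric])
  have cont: "continuous_on U g1" "continuous_on U g2"
    using Ck1[of 0] Ck2[of 0] by simp_all
  have der: "((\<lambda>s. q (s, x)) has_vector_derivative frechet_derivative q (at (t, x)) (1, 0)) (at t within {0..T})"
    if "q differentiable at (t, x)" for q :: "real \<times> 'a \<Rightarrow> 'b" and t x
  proof -
    have q: "(q has_derivative frechet_derivative q (at (t, x))) (at (t, x))"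
      using that frechet_derivative_works by blast
    have "((\<lambda>s. (s, x)) has_derivative (\<lambda>h. (h, 0))) (at t within {0..T})"
      by (intro derivative_eq_intros) auto
    from has_derivative_compose[OF this q]
    have "((\<lambda>s. q (s, x)) has_derivative (\<lambda>h. frechet_derivative q (at (t, x)) (h, 0))) (at t within {0..T})" .
    moreover have "(\<lambda>h. frechet_derivative q (at (t, x)) (h, 0)) = (\<lambda>h. h *\<^sub>R frechet_derivative q (at (t, x)) (1, 0))"
    proof
      fix h :: real
      interpret bounded_linear "frechet_derivative q (at (t, x))" using q by (rule has_derivative_bounded_linear)
      show "frechet_derivative q (at (t, x)) (h, 0) = h *\<^sub>R frechet_derivative q (at (t, x)) (1, 0)"
        using scaleR[of h "(1, 0)"] by simp
    qed
    ultimately show ?thesis by (simp only: has_vector_derivative_def)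
  qed
  show thesis
  proof (rule that[of "\<lambda>t x. g1 (t, x)" "\<lambda>t x. g2 (t, x)"])
    show "continuous_on ({0..T} \<times> M) (\<lambda>(t, x). g1 (t, x))" "continuous_on ({0..T} \<times> M) (\<lambda>(t, x). g2 (t, x))"
      using continuous_on_subset[OF cont(1) U(2)] continuous_on_subset[OF cont(2) U(2)] by simp_all
    fix t x assume tx: "t \<in> {0..T}" "x \<in> M"
    then have p: "(t, x) \<in> U" using U(2) by auto
    have "((\<lambda>s. g (s, x)) has_vector_derivative g1 (t, x)) (at t within {0..T})"
      using der[OF dg(1)[OF p]] by (simp add: g1_def)
    then show "((\<lambda>s. f s x) has_vector_derivative g1 (t, x)) (at t within {0..T})"
      by (rule has_vector_derivative_transform[rotated 2]) (use tx U(4) in auto)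
    show "((\<lambda>s. g1 (s, x)) has_vector_derivative g2 (t, x)) (at t within {0..T})"
      using der[OF dg(2)[OF p]] by (simp add: g2_def)
  qed
qed

text \<open>Only the existence of a gradient and of second derivatives within M is recorded here;
  that they are the ones chosen by \<open>gradient_within\<close> and \<open>hessian\<close> follows
  from uniqueness over a convex set.\<close>

lemma smooth_on_space_derivatives:
  fixes f :: "real \<Rightarrow> 'a::euclidean_space \<Rightarrow> real"
  assumes f: "smooth_on ({0..T} \<times> M) (\<lambda>(t, x). f t x)"
  obtains G H where
    "\<And>t x. t \<in> {0..T} \<Longrightarrow> x \<in> M \<Longrightarrow> (f t has_derivative (\<lambda>h. G t x \<bullet> h)) (at x within M)"
    "\<And>t x y. t \<in> {0..T} \<Longrightarrow> x \<in> M \<Longrightarrow> ((\<lambda>x. G t x \<bullet> y) has_derivative H t x y) (at x within M)"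
proof -
  obtain U g where U: "open U" "{0..T} \<times> M \<subseteq> U" "\<And>k. Ck_on k U g"
    "\<And>p. p \<in> {0..T} \<times> M \<Longrightarrow> g p = (\<lambda>(t, x). f t x) p"
    using f unfolding smooth_on_def by blast
  define D where "D p y = frechet_derivative g (at p) (0, y)" for p and y :: 'a
  have gd: "(g has_derivative frechet_derivative g (at p)) (at p)" if "p \<in> U" for p
    using U(3)[of "Suc 0"] that frechet_derivative_works by auto
  have Dd: "((\<lambda>p. D p y) has_derivative frechet_derivative (\<lambda>p. D p y) (at p)) (at p)" if "p \<in> U" for p y
  proof -
    have "(\<lambda>p. D p y) differentiable (at p)"
      unfolding D_def using U(3)[of "Suc (Suc 0)"] that by simp
    then show ?thesis by (simp only: frechet_derivative_works)
  qed
  define G where "G t x = (\<Sum>i\<in>Basis. D (t, x) i *\<^sub>R i)" for t x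
  have G: "G t x \<bullet> y = D (t, x) y" if "(t, x) \<in> U" for t x y
  proof -
    interpret bounded_linear "frechet_derivative g (at (t, x))"
      using gd[OF that] by (rule has_derivative_bounded_linear)
    have "linear (D (t, x))"
      unfolding D_def[abs_def]
    proof (rule linearI)
      show "frechet_derivative g (at (t, x)) (0, b1 + b2) = frechet_derivative g (at (t, x)) (0, b1) + frechet_derivative g (at (t, x)) (0, b2)" for b1 b2
        using add[of "(0, b1)" "(0, b2)"] by simp
      show "frechet_derivative g (at (t, x)) (0, r *\<^sub>R b) = r *\<^sub>R frechet_derivative g (at (t, x)) (0, b)" for r b
        using scaleR[of r "(0, b)"] by simp
    qed
    then have "D (t, x) y = D (t, x) (\<Sum>i\<in>Basis. (y \<bullet> i) *\<^sub>R i)" by (simp add: euclidean_representation)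
    also have "\<dots> = (\<Sum>i\<in>Basis. (y \<bullet> i) * D (t, x) i)"
      using \<open>linear (D (t, x))\<close> by (simp add: linear_sum linear_scale)
    also have "\<dots> = G t x \<bullet> y"
      unfolding G_def inner_sum_left by (simp add: inner_commute[of y] mult.commute)
    finally show ?thesis by simp
  qed
  have sl: "((\<lambda>x. (t, x)) has_derivative (\<lambda>h. (0, h))) (at x within M)" for t :: real and x :: 'a
    by (intro derivative_eq_intros) auto
  show thesis
  proof (rule that[of G "\<lambda>t x y h. frechet_derivative (\<lambda>p. D p y) (at (t, x)) (0, h)"])
    fix t x assume tx: "t \<in> {0..T}" "x \<in> M"
    then have p: "(t, x) \<in> U" using U(2) by auto
    have "((\<lambda>x. g (t, x)) has_derivative (\<lambda>h. frechet_derivative g (at (t, x)) (0, h))) (at x within M)"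
      by (rule has_derivative_compose[OF sl gd[OF p]])
    then have "((\<lambda>x. g (t, x)) has_derivative (\<lambda>h. G t x \<bullet> h)) (at x within M)"
      using G[OF p] by (simp add: D_def)
    then show "(f t has_derivative (\<lambda>h. G t x \<bullet> h)) (at x within M)"
      by (rule has_derivative_transform[rotated 2]) (use tx U(4) in auto)
    fix y
    have "((\<lambda>x. D (t, x) y) has_derivative (\<lambda>h. frechet_derivative (\<lambda>p. D p y) (at (t, x)) (0, h))) (at x within M)"
      by (rule has_derivative_compose[OF sl Dd[OF p]])
    then show "((\<lambda>x. G t x \<bullet> y) has_derivative (\<lambda>h. frechet_derivative (\<lambda>p. D p y) (at (t, x)) (0, h))) (at x within M)"
    proof (rule has_derivative_transform[rotated 2])
      show "G t x' \<bullet> y = D (t, x') y" if "x' \<in> M" for x'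
        using that tx(1) by (intro G subsetD[OF U(2)]) auto
    qed (use tx in auto)
  qed
qed

section \<open>Derivatives at boundary points of a convex set, and the Hessian on the cone\<close>

lemma has_derivative_unique_within_convex:
  fixes f :: "'a::real_normed_vector \<Rightarrow> 'b::real_normed_vector"
  assumes S: "convex S" "interior S \<noteq> {}" "x \<in> S"
    and D: "(f has_derivative D1) (at x within S)" "(f has_derivative D2) (at x within S)"
  shows "D1 = D2"
proof -
  interpret D1: bounded_linear D1 using D(1) by (rule has_derivative_bounded_linear)
  interpret D2: bounded_linear D2 using D(2) by (rule has_derivative_bounded_linear)
  \<comment> \<open>Differentiation along the segment from x to y determines a derivative at y - x.
    Since S contains a ball, differences of such vectors include every small vector, and linearity
    extends the equality to the whole space.\<close>
  have seg: "D1 (y - x) = D2 (y - x)" if y: "y \<in> S" for y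
  proof -
    have sub: "(\<lambda>s. x + s *\<^sub>R (y - x)) ` {0..1} \<subseteq> S"
    proof (rule image_subsetI)
      fix s :: real assume "s \<in> {0..1}"
      then have "(1 - s) *\<^sub>R x + s *\<^sub>R y \<in> S"
        using S(1,3) y by (simp add: convex_alt)
      then show "x + s *\<^sub>R (y - x) \<in> S" by (simp add: algebra_simps)
    qed
    have l: "((\<lambda>s. x + s *\<^sub>R (y - x)) has_derivative (\<lambda>h. h *\<^sub>R (y - x))) (at 0 within {0..1})"
      by (auto intro!: derivative_eq_intros)
    have *: "((\<lambda>s. f (x + s *\<^sub>R (y - x))) has_vector_derivative D' (y - x)) (at 0 within cbox 0 1)"
      if D': "(f has_derivative D') (at x within S)" for D'
    proof -
      interpret bounded_linear D' using D' by (rule has_derivative_bounded_linear)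
      have "(f has_derivative D') (at (x + 0 *\<^sub>R (y - x)) within (\<lambda>s. x + s *\<^sub>R (y - x)) ` {0..1})"
        using has_derivative_subset[OF D' sub] by simp
      from has_derivative_in_compose[OF l this]
      show ?thesis by (simp add: has_vector_derivative_def scaleR)
    qed
    show ?thesis
      using vector_derivative_unique_within_closed_interval[OF _ _ *[OF D(1)] *[OF D(2)]] by simp
  qed
  obtain p e where p: "e > 0" "ball p e \<subseteq> S"
    using S(2) open_interior[of S] interior_subset[of S] by (metis all_not_in_conv openE subset_trans)
  show ?thesis
  proof
    fix h
    show "D1 h = D2 h"
    proof (cases "h = 0")
      case True
      then show ?thesis by (simp add: D1.zero D2.zero)
    next
      case False
      define c where "c = e / (2 * norm h)"
      have c: "c > 0" using False p by (simp add: c_def)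
      have "norm (c *\<^sub>R h) = e / 2" using p(1) False by (simp add: c_def)
      then have "p + c *\<^sub>R h \<in> ball p e" "p \<in> ball p e" using p by (auto simp: dist_norm)
      then have "p + c *\<^sub>R h \<in> S" "p \<in> S" using p by auto
      then have "D1 ((p - x) + c *\<^sub>R h) = D2 ((p - x) + c *\<^sub>R h)" "D1 (p - x) = D2 (p - x)"
        using seg[of "p + c *\<^sub>R h"] seg[of p] by (simp_all add: algebra_simps)
      then have "c *\<^sub>R D1 h = c *\<^sub>R D2 h" by (simp add: D1.add D2.add D1.scaleR D2.scaleR)
      then show ?thesis using c by simp
    qed
  qed
qed

lemma frechet_derivative_within_convex:
  assumes "convex S" "interior S \<noteq> {}" "x \<in> S" "(f has_derivative D) (at x within S)"
  shows "frechet_derivative f (at x within S) = D"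
proof -
  have "(f has_derivative frechet_derivative f (at x within S)) (at x within S)"
    using assms(4) frechet_derivative_works differentiableI by blast
  then show ?thesis using has_derivative_unique_within_convex[OF assms(1-3)] assms(4) by blast
qed

lemma gradient_within_convex:
  assumes "convex M" "interior M \<noteq> {}" "x \<in> M" "(f has_derivative (\<lambda>h. G \<bullet> h)) (at x within M)"
  shows "gradient_within M f x = G"
  unfolding gradient_within_def
proof (rule the_equality)
  show "(f has_derivative (\<bullet>) G) (at x within M)" using assms(4) .
  fix D assume "(f has_derivative (\<bullet>) D) (at x within M)"
  then have "(\<lambda>h. D \<bullet> h) = (\<lambda>h. G \<bullet> h)"
    using has_derivative_unique_within_convex[OF assms(1-3) _ assms(4)] by blast
  then show "D = G" by (metis vector_eq_rdot)
qed

text \<open>The Christoffel term has two effects on the plain second derivative: it halves the mixed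
  term, which would be 4 r a (G \<bullet> \<xi>), and it creates the last summand, from the radial
  component of the covariant derivative.\<close>

lemma hessian_homogeneous_potential:
  fixes p :: "'a::euclidean_space \<Rightarrow> real"
  assumes M: "convex M" "interior M \<noteq> {}"
    and G: "\<And>x. x \<in> M \<Longrightarrow> (p has_derivative (\<lambda>h. G x \<bullet> h)) (at x within M)"
    and H: "\<And>x y. x \<in> M \<Longrightarrow> ((\<lambda>x. G x \<bullet> y) has_derivative H x y) (at x within M)"
    and x: "x \<in> M" "0 < r"
  shows "hessian (M \<times> {0<..}) cone_tensor (\<lambda>q. p (fst q) * (snd q)\<^sup>2) (x, r) (\<xi>, a)
    = r\<^sup>2 * H x \<xi> \<xi> + 2 * r * a * (G x \<bullet> \<xi>) + 2 * p x * a\<^sup>2 + 2 * p x * (r\<^sup>2 * (\<xi> \<bullet> \<xi>))"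
proof -
  define S where "S = M \<times> {0::real<..}"
  have S: "convex S" "interior S \<noteq> {}"
    using M by (auto simp: S_def convex_Times interior_Times interior_open)
  have xr: "(x, r) \<in> S" using x by (simp add: S_def)
  have cf: "((\<lambda>q. f (fst q)) has_derivative (\<lambda>h. f' (fst h))) (at q within S)"
    if "q \<in> S" "(f has_derivative f') (at (fst q) within M)" for f :: "'a \<Rightarrow> real" and f' and q :: "'a \<times> real"
  proof -
    have "(fst has_derivative fst) (at q within S)"
      by (intro bounded_linear_imp_has_derivative bounded_linear_fst)
    moreover have "(f has_derivative f') (at (fst q) within fst ` S)"
      using that(2) by (rule has_derivative_subset) (auto simp: S_def)
    ultimately show ?thesis by (rule has_derivative_in_compose)
  qed
  have sn: "(snd has_derivative snd) (at q within S)" for q :: "'a \<times> real"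
    by (intro bounded_linear_imp_has_derivative bounded_linear_snd)
  have d1: "frechet_derivative (\<lambda>q. p (fst q) * (snd q)\<^sup>2) (at q within S)
      = (\<lambda>h. (snd q)\<^sup>2 * (G (fst q) \<bullet> fst h) + 2 * snd q * p (fst q) * snd h)" if q: "q \<in> S" for q
  proof (rule frechet_derivative_within_convex[OF S q])
    have "fst q \<in> M" using q by (auto simp: S_def)
    then show "((\<lambda>q. p (fst q) * (snd q)\<^sup>2) has_derivative
      (\<lambda>h. (snd q)\<^sup>2 * (G (fst q) \<bullet> fst h) + 2 * snd q * p (fst q) * snd h)) (at q within S)"
      by (auto intro!: derivative_eq_intros cf[OF q G] sn simp: algebra_simps)
  qed
  have "frechet_derivative (\<lambda>q. frechet_derivative (\<lambda>q. p (fst q) * (snd q)\<^sup>2) (at q within S) (\<xi>, a)) (at (x, r) within S)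
    = (\<lambda>h. 2 * r * snd h * (G x \<bullet> \<xi>) + r\<^sup>2 * H x \<xi> (fst h) + 2 * a * (snd h * p x + r * (G x \<bullet> fst h)))"
  proof (rule frechet_derivative_within_convex[OF S xr])
    define \<gamma> where "\<gamma> q = G (fst q) \<bullet> \<xi>" for q :: "'a \<times> real"
    have g0: "\<gamma> (x, r) = G x \<bullet> \<xi>" by (simp add: \<gamma>_def)
    have g: "(\<gamma> has_derivative (\<lambda>h. H x \<xi> (fst h))) (at (x, r) within S)"
      unfolding \<gamma>_def by (rule cf[OF xr]) (simp add: H x)
    have "((\<lambda>q. (snd q)\<^sup>2 * \<gamma> q + 2 * snd q * p (fst q) * a) has_derivative
      (\<lambda>h. 2 * r * snd h * (G x \<bullet> \<xi>) + r\<^sup>2 * H x \<xi> (fst h) + 2 * a * (snd h * p x + r * (G x \<bullet> fst h))))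
      (at (x, r) within S)"
      by (auto intro!: derivative_eq_intros cf[OF xr, of p, OF G] g sn x simp: algebra_simps g0)
    then have "((\<lambda>q. (snd q)\<^sup>2 * (G (fst q) \<bullet> \<xi>) + 2 * snd q * p (fst q) * a) has_derivative
      (\<lambda>h. 2 * r * snd h * (G x \<bullet> \<xi>) + r\<^sup>2 * H x \<xi> (fst h) + 2 * a * (snd h * p x + r * (G x \<bullet> fst h))))
      (at (x, r) within S)"
      unfolding \<gamma>_def .
    then show "((\<lambda>q. frechet_derivative (\<lambda>q. p (fst q) * (snd q)\<^sup>2) (at q within S) (\<xi>, a)) has_derivative
      (\<lambda>h. 2 * r * snd h * (G x \<bullet> \<xi>) + r\<^sup>2 * H x \<xi> (fst h) + 2 * a * (snd h * p x + r * (G x \<bullet> fst h))))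
      (at (x, r) within S)"
      by (rule has_derivative_transform[rotated 2]) (use xr d1 in auto)
  qed
  then show ?thesis
    unfolding hessian_def S_def[symmetric] christoffel_cone_tensor[OF x(2)] d1[OF xr]
    using x(2) by (simp add: power2_eq_square inner_add_right field_simps)
qed

text \<open>Three test vectors separate the parts of the Hessian: (0, 1) isolates p; the difference
  between (y, r |y|) and (y, - r |y|) isolates the mixed term, with a radial component chosen as
  long as the angular one; and (y, 0) isolates H once p is known. The radius cancels, so a bound at
  a single radius above x yields bounds on P at x.\<close>

lemma hessian_bound_imp:
  fixes p :: "'a::euclidean_space \<Rightarrow> real"
  assumes M: "convex M" "interior M \<noteq> {}"
    and G: "\<And>x. x \<in> M \<Longrightarrow> (p has_derivative (\<lambda>h. G x \<bullet> h)) (at x within M)"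
    and H: "\<And>x y. x \<in> M \<Longrightarrow> ((\<lambda>x. G x \<bullet> y) has_derivative H x y) (at x within M)"
    and x: "x \<in> M" "0 < r"
    and b: "\<And>w. \<bar>hessian (M \<times> {0<..}) cone_tensor (\<lambda>q. p (fst q) * (snd q)\<^sup>2) (x, r) w\<bar> \<le> K * cone_tensor (x, r) w w"
  shows "\<bar>p x\<bar> \<le> K / 2" "\<bar>G x \<bullet> y\<bar> \<le> K * norm y" "\<bar>H x y y\<bar> \<le> 2 * K * (y \<bullet> y)"
proof -
  have b': "\<bar>r\<^sup>2 * H x \<xi> \<xi> + 2 * r * a * (G x \<bullet> \<xi>) + 2 * p x * a\<^sup>2 + 2 * p x * (r\<^sup>2 * (\<xi> \<bullet> \<xi>))\<bar>
      \<le> K * (r\<^sup>2 * (\<xi> \<bullet> \<xi>) + a\<^sup>2)" for \<xi> a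
  proof -
    have "hessian (M \<times> {0<..}) cone_tensor (\<lambda>q. p (fst q) * (snd q)\<^sup>2) (x, r) (\<xi>, a)
      = r\<^sup>2 * H x \<xi> \<xi> + 2 * r * a * (G x \<bullet> \<xi>) + 2 * p x * a\<^sup>2 + 2 * p x * (r\<^sup>2 * (\<xi> \<bullet> \<xi>))"
      by (rule hessian_homogeneous_potential[OF M G H x])
    then show ?thesis
      using b[of "(\<xi>, a)"] by (simp add: cone_tensor_def power2_eq_square[of a])
  qed
  have H0: "H x 0 0 = 0"
    using H[OF x(1), of 0] by (metis has_derivative_bounded_linear linear_0 bounded_linear.linear)
  show p: "\<bar>p x\<bar> \<le> K / 2" using b'[of 0 1] H0 by (simp add: abs_mult)
  show "\<bar>G x \<bullet> y\<bar> \<le> K * norm y"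
  proof (cases "y = 0")
    case False
    define c where "c = 4 * r\<^sup>2 * norm y"
    have c: "0 < c" using False x(2) by (simp add: c_def)
    define X Z B where "X = 2 * r * (r * norm y) * (G x \<bullet> y)"
      and "Z = r\<^sup>2 * H x y y + 2 * p x * (r * norm y)\<^sup>2 + 2 * p x * (r\<^sup>2 * (y \<bullet> y))"
      and "B = K * (r\<^sup>2 * (y \<bullet> y) + (r * norm y)\<^sup>2)"
    have "\<bar>Z + X\<bar> \<le> B" "\<bar>Z - X\<bar> \<le> B"
      using b'[of y "r * norm y"] b'[of y "- (r * norm y)"]
      by (simp_all add: X_def Z_def B_def algebra_simps)
    then have "\<bar>2 * X\<bar> \<le> 2 * B" by linarith
    moreover have "2 * X = c * (G x \<bullet> y)" by (simp add: X_def c_def power2_eq_square)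
    moreover have "2 * B = c * (K * norm y)"
      unfolding B_def c_def power_mult_distrib power2_norm_eq_inner[symmetric] by (simp add: power2_eq_square)
    ultimately have "\<bar>c * (G x \<bullet> y)\<bar> \<le> c * (K * norm y)" by simp
    then show ?thesis using c by (simp add: abs_mult)
  qed simp
  have "r\<^sup>2 * \<bar>H x y y + 2 * p x * (y \<bullet> y)\<bar> = \<bar>r\<^sup>2 * H x y y + 2 * p x * (r\<^sup>2 * (y \<bullet> y))\<bar>"
  proof -
    have "r\<^sup>2 * H x y y + 2 * p x * (r\<^sup>2 * (y \<bullet> y)) = r\<^sup>2 * (H x y y + 2 * p x * (y \<bullet> y))"
      by (simp add: algebra_simps)
    then show ?thesis by (simp add: abs_mult)
  qed
  also have "\<dots> \<le> r\<^sup>2 * (K * (y \<bullet> y))" using b'[of y 0] by (simp add: mult_ac)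
  finally have "\<bar>H x y y + 2 * p x * (y \<bullet> y)\<bar> \<le> K * (y \<bullet> y)" using x(2) by simp
  moreover have "\<bar>2 * p x * (y \<bullet> y)\<bar> \<le> K * (y \<bullet> y)"
    using p by (simp add: abs_mult mult_right_mono)
  ultimately show "\<bar>H x y y\<bar> \<le> 2 * K * (y \<bullet> y)" by linarith
qed

text \<open>Two applications of the mean value theorem along the segment. The first bounds the
  growth of the slope by 2 K L s, the second applies to the signed error minus K L s^2, whose
  derivative is then nonpositive; both signs \<sigma> are treated at once.\<close>

lemma taylor2_convex:
  fixes p :: "'a::euclidean_space \<Rightarrow> real"
  assumes M: "convex M" and x: "x \<in> M" "y \<in> M"
    and G: "\<And>x. x \<in> M \<Longrightarrow> (p has_derivative (\<lambda>h. G x \<bullet> h)) (at x within M)"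
    and H: "\<And>x y. x \<in> M \<Longrightarrow> ((\<lambda>x. G x \<bullet> y) has_derivative H x y) (at x within M)"
    and b: "\<And>x y. x \<in> M \<Longrightarrow> \<bar>H x y y\<bar> \<le> 2 * K * (y \<bullet> y)"
  shows "\<bar>p y - p x - G x \<bullet> (y - x)\<bar> \<le> K * (norm (y - x))\<^sup>2"
proof -
  define v where "v = y - x"
  define \<gamma> where "\<gamma> s = x + s *\<^sub>R v" for s
  have gM: "\<gamma> s \<in> M" if "s \<in> {0..1}" for s
  proof -
    have "(1 - s) *\<^sub>R x + s *\<^sub>R y \<in> M" using M x that by (simp add: convex_alt)
    then show ?thesis by (simp add: \<gamma>_def v_def algebra_simps)
  qed
  have dg: "(\<gamma> has_derivative (\<lambda>h. h *\<^sub>R v)) (at s within A)" for s A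
    unfolding \<gamma>_def by (auto intro!: derivative_eq_intros)
  have comp: "((\<lambda>s. f (\<gamma> s)) has_derivative (\<lambda>h. h * f' v)) (at s within A)"
    if "(f has_derivative f') (at (\<gamma> s) within M)" "A \<subseteq> {0..1}" for f :: "'a \<Rightarrow> real" and f' s A
  proof -
    interpret bounded_linear f' using that(1) by (rule has_derivative_bounded_linear)
    have "(f has_derivative f') (at (\<gamma> s) within \<gamma> ` A)"
      using that(1) by (rule has_derivative_subset) (use gM that(2) in auto)
    from has_derivative_in_compose[OF dg this] show ?thesis by (simp add: scaleR)
  qed
  define L where "L = v \<bullet> v"
  have inc: "\<bar>G (\<gamma> s) \<bullet> v - G x \<bullet> v\<bar> \<le> 2 * K * L * s" if s: "s \<in> {0..1}" for s
  proof -
    have "\<exists>u\<in>{0..s}. G (\<gamma> s) \<bullet> v - G (\<gamma> 0) \<bullet> v = (s - 0) * H (\<gamma> u) v v"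
      using s by (intro mvt_very_simple comp H gM) auto
    then obtain u where u: "u \<in> {0..s}" "G (\<gamma> s) \<bullet> v - G (\<gamma> 0) \<bullet> v = s * H (\<gamma> u) v v" by auto
    have "\<bar>s * H (\<gamma> u) v v\<bar> \<le> s * (2 * K * L)"
      using b[OF gM, of u v] u(1) s by (auto simp: abs_mult L_def intro!: mult_left_mono)
    then show ?thesis using u(2) by (simp add: \<gamma>_def mult_ac)
  qed
  have *: "\<sigma> * (p y - p x - G x \<bullet> v) \<le> K * L" if \<sigma>: "\<bar>\<sigma>\<bar> = 1" for \<sigma>
  proof -
    define f where "f s = \<sigma> * (p (\<gamma> s) - s * (G x \<bullet> v)) - K * L * s\<^sup>2" for s
    have "\<exists>u\<in>{0..1}. f 1 - f 0 = (1 - 0) * (\<sigma> * (G (\<gamma> u) \<bullet> v - G x \<bullet> v) - 2 * K * L * u)"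
    proof (rule mvt_very_simple)
      fix s :: real assume "0 \<le> s" "s \<le> 1"
      then have "\<gamma> s \<in> M" by (intro gM) auto
      note d = comp[OF G[OF this] order_refl]
      show "(f has_derivative (\<lambda>h. h * (\<sigma> * (G (\<gamma> s) \<bullet> v - G x \<bullet> v) - 2 * K * L * s))) (at s within {0..1})"
        unfolding f_def by (auto intro!: derivative_eq_intros d simp: algebra_simps)
    qed simp
    then obtain u where u: "u \<in> {0..1}" "f 1 - f 0 = \<sigma> * (G (\<gamma> u) \<bullet> v - G x \<bullet> v) - 2 * K * L * u" by auto
    have "\<sigma> * (G (\<gamma> u) \<bullet> v - G x \<bullet> v) \<le> \<bar>G (\<gamma> u) \<bullet> v - G x \<bullet> v\<bar>"
      using \<sigma> by (metis abs_ge_self abs_mult mult_1)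
    then have "f 1 - f 0 \<le> 0" using inc[OF u(1)] u(2) by linarith
    then show ?thesis by (simp add: f_def \<gamma>_def v_def algebra_simps)
  qed
  show ?thesis
    using *[of 1] *[of "-1"] by (simp add: v_def L_def power2_norm_eq_inner abs_le_iff)
qed

section \<open>Borel structure of the path space\<close>

abbreviation path_top :: "real \<Rightarrow> 'a::metric_space \<Rightarrow> 'a set \<Rightarrow> (real \<Rightarrow> 'a \<times> real) topology" where
  "path_top T x\<^sub>0 M \<equiv> mtopology_of (path_space T x\<^sub>0 M)"

lemma space_borel_of [simp]: "space (borel_of X) = topspace X"
  by (auto simp: borel_of_def openin_subset space_measure_of_conv)

lemma sets_borel_of: "sets (borel_of X) = sigma_sets (topspace X) {U. openin X U}"
  unfolding borel_of_def by (rule sets_measure_of) (auto dest: openin_subset)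

lemma openin_borel_of: "openin X U \<Longrightarrow> U \<in> sets (borel_of X)"
  by (auto simp: sets_borel_of)

lemma closedin_borel_of: "closedin X C \<Longrightarrow> C \<in> sets (borel_of X)"
proof -
  assume C: "closedin X C"
  then have "topspace X - C \<in> sets (borel_of X)" by (intro openin_borel_of) auto
  from sets.compl_sets[OF this] show ?thesis
    using closedin_subset[OF C] by (simp add: double_diff)
qed

lemma measurable_borel_ofI:
  assumes "f \<in> space M \<rightarrow> topspace X" "\<And>U. openin X U \<Longrightarrow> f -` U \<inter> space M \<in> sets M"
  shows "f \<in> measurable M (borel_of X)"
  unfolding borel_of_def using assms by (intro measurable_measure_of) (auto dest: openin_subset)

lemma continuous_map_borel_of:
  assumes "continuous_map X Y f"
  shows "f \<in> measurable (borel_of X) (borel_of Y)"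
proof (rule measurable_borel_ofI)
  show "f \<in> space (borel_of X) \<rightarrow> topspace Y" using continuous_map_funspace[OF assms] by simp
  fix U assume "openin Y U"
  then have "openin X {x \<in> topspace X. f x \<in> U}" using assms by (rule openin_continuous_map_preimage[rotated])
  moreover have "{x \<in> topspace X. f x \<in> U} = f -` U \<inter> space (borel_of X)" by auto
  ultimately show "f -` U \<inter> space (borel_of X) \<in> sets (borel_of X)" using openin_borel_of by metis
qed

lemma borel_of_euclidean: "borel_of euclidean = borel"
  by (simp add: borel_of_def borel_def)

lemma continuous_map_borel_measurable:
  assumes "continuous_map X euclidean f"
  shows "f \<in> borel_measurable (borel_of X)"
  using continuous_map_borel_of[OF assms] by (simp add: borel_of_euclidean)

lemma continuous_map_measurable_restrict:
  assumes "continuous_map (top_of_set S) X f"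
  shows "f \<in> measurable (restrict_space borel S) (borel_of X)"
proof (rule measurable_borel_ofI)
  show "f \<in> space (restrict_space borel S) \<rightarrow> topspace X"
    using continuous_map_funspace[OF assms] by (simp add: space_restrict_space)
  fix U assume "openin X U"
  then have "openin (top_of_set S) {x \<in> S. f x \<in> U}"
    using openin_continuous_map_preimage[OF assms] by simp
  then obtain V where "open V" "{x \<in> S. f x \<in> U} = S \<inter> V" by (auto simp: openin_open)
  moreover have "f -` U \<inter> space (restrict_space borel S) = {x \<in> S. f x \<in> U}"
    by (auto simp: space_restrict_space)
  ultimately show "f -` U \<inter> space (restrict_space borel S) \<in> sets (restrict_space borel S)"
    by (auto simp: sets_restrict_space)
qed

lemma continuous_map_mtopologyI:
  assumes "\<And>x. x \<in> mspace m1 \<Longrightarrow> f x \<in> mspace m2"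
    and "\<And>a e. a \<in> mspace m1 \<Longrightarrow> 0 < e \<Longrightarrow>
      \<exists>d>0. \<forall>x\<in>mspace m1. mdist m1 a x < d \<longrightarrow> mdist m2 (f a) (f x) < e"
  shows "continuous_map (mtopology_of m1) (mtopology_of m2) f"
proof -
  interpret m1: Metric_space "mspace m1" "mdist m1" by (rule Metric_space_mspace_mdist)
  show ?thesis
    unfolding mtopology_of_def m1.metric_continuous_map[OF Metric_space_mspace_mdist]
  proof (intro conjI ballI allI impI)
    show "f ` mspace m1 \<subseteq> mspace m2" using assms(1) by auto
    fix a and e :: real assume "a \<in> mspace m1" "0 < e"
    from assms(2)[OF this]
    show "\<exists>d>0. \<forall>x. x \<in> mspace m1 \<and> mdist m1 a x < d \<longrightarrow> mdist m2 (f a) (f x) < e"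
      by (elim exE conjE) (rule exI, rule conjI, assumption, simp)
  qed
qed

lemma continuous_map_mtopology_euclideanI:
  fixes f :: "'a \<Rightarrow> 'b::metric_space"
  assumes "\<And>a e. a \<in> mspace m \<Longrightarrow> 0 < e \<Longrightarrow> \<exists>d>0. \<forall>x\<in>mspace m. mdist m a x < d \<longrightarrow> dist (f a) (f x) < e"
  shows "continuous_map (mtopology_of m) euclidean f"
  using continuous_map_mtopologyI[of m f euclidean_metric] assms by simp

text \<open>k alone has no continuous extension to the apex, but the factor r absorbs it. Away from
  the apex a small distance keeps the radius above r/2, and \<open>cone_dist_ge_angular\<close>
  turns it into closeness of positions.\<close>

lemma continuous_map_cone_radial:
  fixes k :: "'a::metric_space \<Rightarrow> 'b::real_normed_vector"
  assumes M: "compact M" "x\<^sub>0 \<in> M" and k: "continuous_on M k"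
  shows "continuous_map (cone_top x\<^sub>0 M) euclidean (\<lambda>z. snd z *\<^sub>R k (fst z))"
proof (rule continuous_map_mtopology_euclideanI, simp only: mspace_cone_metric mdist_cone_metric)
  fix a and e :: real
  assume a: "a \<in> cone x\<^sub>0 M" and e: "0 < e"
  obtain B where B: "0 < B" "\<And>x. x \<in> M \<Longrightarrow> norm (k x) \<le> B"
    using compact_imp_bounded[OF compact_continuous_image[OF k M(1)]] unfolding bounded_pos by auto
  note cD = cone_memD[OF _ M(2)]
  define r where "r = snd a"
  have r: "0 \<le> r" using cD(1)[OF a] by (simp add: r_def)
  obtain \<eta> where \<eta>: "0 < \<eta>" "\<And>y. y \<in> M \<Longrightarrow> dist y (fst a) < \<eta> \<Longrightarrow> dist (k y) (k (fst a)) < e / (2 * (r + 1))"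
    using k cD(2)[OF a] e r unfolding continuous_on_iff by (metis divide_pos_pos mult_pos_pos zero_less_numeral add_nonneg_pos zero_less_one)
  define d where "d = (if r = 0 then e / (2 * B) else min (e / (2 * B)) (min (r / 2) (min \<eta> pi * r / 4)))"
  have d: "0 < d" using r B e \<eta> by (auto simp: d_def)
  show "\<exists>d>0. \<forall>x\<in>cone x\<^sub>0 M. cone_dist a x < d \<longrightarrow> dist (snd a *\<^sub>R k (fst a)) (snd x *\<^sub>R k (fst x)) < e"
  proof (intro exI conjI ballI impI)
    show "0 < d" by (rule d)
    fix x assume x: "x \<in> cone x\<^sub>0 M" and xd: "cone_dist a x < d"
    have rs: "\<bar>r - snd x\<bar> \<le> cone_dist a x"
      unfolding r_def by (rule cone_dist_ge_radial) (use cD a x in auto)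
    have "d \<le> e / (2 * B)" by (simp add: d_def)
    then have "\<bar>r - snd x\<bar> < e / (2 * B)" using rs xd by linarith
    then have rB: "\<bar>r - snd x\<bar> * B < e / 2" using B(1) by (simp add: pos_less_divide_eq mult_ac)
    have "r *\<^sub>R k (fst a) - snd x *\<^sub>R k (fst x) = r *\<^sub>R (k (fst a) - k (fst x)) + (r - snd x) *\<^sub>R k (fst x)"
      by (simp add: algebra_simps)
    then have "dist (r *\<^sub>R k (fst a)) (snd x *\<^sub>R k (fst x)) \<le> r * norm (k (fst a) - k (fst x)) + \<bar>r - snd x\<bar> * norm (k (fst x))"
      unfolding dist_norm using r by (metis abs_of_nonneg norm_scaleR norm_triangle_ineq)
    also have "\<bar>r - snd x\<bar> * norm (k (fst x)) \<le> \<bar>r - snd x\<bar> * B"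
      using B cD(2)[OF x] by (intro mult_left_mono) auto
    finally have 1: "dist (r *\<^sub>R k (fst a)) (snd x *\<^sub>R k (fst x)) < r * norm (k (fst a) - k (fst x)) + e / 2"
      using rB by linarith
    have "r * norm (k (fst a) - k (fst x)) \<le> e / 2"
    proof (cases "r = 0")
      case False
      then have r': "0 < r" and "d \<le> r / 2" "d \<le> min \<eta> pi * r / 4" using r by (auto simp: d_def)
      then have s: "r / 2 < snd x" using rs xd by linarith
      have "r / 2 * min (dist (fst a) (fst x)) pi \<le> min r (snd x) * min (dist (fst a) (fst x)) pi"
        using s r' by (intro mult_right_mono) auto
      also have "\<dots> \<le> 2 * cone_dist a x"
        unfolding r_def by (rule cone_dist_ge_angular) (use cD a x in auto)
      also have "\<dots> < 2 * (min \<eta> pi * r / 4)" using xd \<open>d \<le> min \<eta> pi * r / 4\<close> by linarith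
      finally have "r / 2 * min (dist (fst a) (fst x)) pi < r / 2 * min \<eta> pi" by (simp add: mult.commute)
      then have "min (dist (fst a) (fst x)) pi < min \<eta> pi" using r' by simp
      then have "dist (fst x) (fst a) < \<eta>" by (auto simp: min_def dist_commute split: if_splits)
      from \<eta>(2)[OF cD(2)[OF x] this] have "norm (k (fst a) - k (fst x)) \<le> e / (2 * (r + 1))"
        by (simp add: dist_norm norm_minus_commute)
      then have "r * norm (k (fst a) - k (fst x)) \<le> r * (e / (2 * (r + 1)))" using r by (intro mult_left_mono)
      also have "\<dots> \<le> e / 2" using r e by (simp add: field_simps)
      finally show ?thesis .
    qed (use e in simp)
    then show "dist (snd a *\<^sub>R k (fst a)) (snd x *\<^sub>R k (fst x)) < e"
      using 1 by (simp add: r_def)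
  qed
qed

section \<open>The space of continuous paths with the uniform distance\<close>

lemma pathsI:
  assumes "z \<in> extensional {0..T}" "continuous_map (top_of_set {0..T}) (cone_top x\<^sub>0 M) z"
  shows "z \<in> paths T x\<^sub>0 M"
proof -
  have "z t \<in> cone x\<^sub>0 M" if "t \<in> {0..T}" for t
    using continuous_map_funspace[OF assms(2)] that by auto
  then show ?thesis
    unfolding path_space_def
    by (subst compactin_mspace_cfunspace) (use assms in \<open>auto simp: compactin_subtopology\<close>)
qed

lemma pathsD_continuous:
  assumes "z \<in> paths T x\<^sub>0 M"
  shows "z \<in> extensional {0..T}" "continuous_map (top_of_set {0..T}) (cone_top x\<^sub>0 M) z"
  using assms by (auto simp: path_space_def)

lemma path_dist_ge:
  assumes "z \<in> paths T x\<^sub>0 M" "w \<in> paths T x\<^sub>0 M" "t \<in> {0..T}"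
  shows "cone_dist (z t) (w t) \<le> mdist (path_space T x\<^sub>0 M) z w"
  using mdist_cfunspace_imp_mdist_le[of z "top_of_set {0..T}" "cone_metric x\<^sub>0 M" w _ t] assms
  unfolding path_space_def by simp

lemma path_dist_le:
  assumes "0 \<le> B" "\<And>t. t \<in> {0..T} \<Longrightarrow> cone_dist (z t) (w t) \<le> B"
  shows "mdist (path_space T x\<^sub>0 M) z w \<le> B"
  unfolding path_space_def by (rule mdist_cfunspace_le) (use assms in auto)

lemma continuous_map_eval:
  assumes "t \<in> {0..T}"
  shows "continuous_map (path_top T x\<^sub>0 M) (cone_top x\<^sub>0 M) (\<lambda>z. z t)"
proof (rule continuous_map_mtopologyI)
  show "z t \<in> mspace (cone_metric x\<^sub>0 M)" if "z \<in> paths T x\<^sub>0 M" for z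
    using that assms by (auto simp: path_space_def)
  show "\<exists>d>0. \<forall>w\<in>paths T x\<^sub>0 M. mdist (path_space T x\<^sub>0 M) z w < d \<longrightarrow> mdist (cone_metric x\<^sub>0 M) (z t) (w t) < e"
    if "z \<in> paths T x\<^sub>0 M" "0 < e" for z e
    using path_dist_ge[OF that(1) _ assms] that(2) by (intro exI[of _ e]) (auto intro: le_less_trans)
qed

lemma cone_dist_le:
  assumes "0 \<le> snd z" "0 \<le> snd w"
  shows "cone_dist z w \<le> \<bar>snd z - snd w\<bar> + (snd z + snd w) * dist (fst z) (fst w)"
proof (rule power2_le_imp_le)
  define m where "m = min (dist (fst z) (fst w)) pi"
  have m: "0 \<le> m" "m \<le> dist (fst z) (fst w)" by (auto simp: m_def)
  have "1 - cos m = 2 * (sin (m / 2))\<^sup>2" using cos_double_sin[of "m / 2"] by simp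
  also have "\<dots> \<le> 2 * (m / 2)\<^sup>2"
    using abs_le_square_iff[THEN iffD1, OF abs_sin_x_le_abs_x[of "m / 2"]] by simp
  also have "\<dots> \<le> m\<^sup>2" by (simp add: power_divide)
  finally have c: "1 - cos m \<le> m\<^sup>2" .
  have "(cone_dist z w)\<^sup>2 = (snd z - snd w)\<^sup>2 + 2 * snd z * snd w * (1 - cos m)"
    unfolding m_def by (rule cone_dist_sq[OF assms])
  also have "2 * snd z * snd w * (1 - cos m) \<le> (snd z + snd w)\<^sup>2 * m\<^sup>2"
    using assms c by (intro mult_mono) (auto simp: power2_sum)
  also have "\<dots> \<le> ((snd z + snd w) * dist (fst z) (fst w))\<^sup>2"
    using m by (simp add: power_mult_distrib mult_left_mono power_mono)
  finally have "(cone_dist z w)\<^sup>2 \<le> (snd z - snd w)\<^sup>2 + ((snd z + snd w) * dist (fst z) (fst w))\<^sup>2" by simp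
  moreover have "0 \<le> \<bar>snd z - snd w\<bar> * ((snd z + snd w) * dist (fst z) (fst w))"
    using assms by simp
  ultimately show "(cone_dist z w)\<^sup>2 \<le> (\<bar>snd z - snd w\<bar> + (snd z + snd w) * dist (fst z) (fst w))\<^sup>2"
    by (simp add: power2_sum)
qed (use assms in simp)

lemma solution_path_apply:
  "t \<in> {0..T} \<Longrightarrow> lam t x > 0 \<Longrightarrow> solution_path T x\<^sub>0 \<phi> lam x t = (\<phi> t x, lam t x)"
  by (simp add: solution_path_def cone_pt_def)

text \<open>One uniform estimate on the compact set of pairs (t, x) serves twice: with x fixed it is
  continuity in time, with t fixed it is continuity in x for the uniform distance, as its modulus
  does not depend on t.\<close>

lemma continuous_map_solution_path:
  fixes \<phi> :: "real \<Rightarrow> 'a::metric_space \<Rightarrow> 'a"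
  assumes M: "compact M"
    and ph: "continuous_on ({0..T} \<times> M) (\<lambda>(t, x). \<phi> t x)" "\<And>t x. t \<in> {0..T} \<Longrightarrow> x \<in> M \<Longrightarrow> \<phi> t x \<in> M"
    and la: "continuous_on ({0..T} \<times> M) (\<lambda>(t, x). lam t x)" "\<And>t x. t \<in> {0..T} \<Longrightarrow> x \<in> M \<Longrightarrow> 0 < lam t x"
  shows "\<And>x. x \<in> M \<Longrightarrow> solution_path T x\<^sub>0 \<phi> lam x \<in> paths T x\<^sub>0 M"
    and "continuous_map (top_of_set M) (path_top T x\<^sub>0 M) (solution_path T x\<^sub>0 \<phi> lam)"
proof -
  have cp: "compact ({0..T} \<times> M)" by (intro compact_Times M) simp
  obtain R where R: "0 < R" "\<And>t x. t \<in> {0..T} \<Longrightarrow> x \<in> M \<Longrightarrow> lam t x \<le> R"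
  proof -
    obtain R where R: "0 < R" "\<forall>y\<in>(\<lambda>(t, x). lam t x) ` ({0..T} \<times> M). norm y \<le> R"
      using compact_imp_bounded[OF compact_continuous_image[OF la(1) cp]] unfolding bounded_pos by auto
    have "lam t x \<le> R" if "t \<in> {0..T}" "x \<in> M" for t x
      using R(2)[rule_format, of "lam t x"] that by (force simp: image_iff)
    then show thesis using that R(1) by blast
  qed
  have uc: "uniformly_continuous_on ({0..T} \<times> M) (\<lambda>(t, x). \<phi> t x)" "uniformly_continuous_on ({0..T} \<times> M) (\<lambda>(t, x). lam t x)"
    using compact_uniformly_continuous[OF _ cp] ph(1) la(1) by blast+
  define s where "s = solution_path T x\<^sub>0 \<phi> lam"
  have sx: "s x t = (\<phi> t x, lam t x)" if "t \<in> {0..T}" "x \<in> M" for x t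
    unfolding s_def using that la(2) by (intro solution_path_apply)
  have sc: "s x t \<in> cone x\<^sub>0 M" if "t \<in> {0..T}" "x \<in> M" for x t
    unfolding s_def solution_path_def using that ph(2)[OF that] la(2)[OF that]
    by (simp add: cone_pt_in_cone)
  have est: "\<exists>d>0. \<forall>t\<in>{0..T}. \<forall>t'\<in>{0..T}. \<forall>x\<in>M. \<forall>x'\<in>M. dist (t, x) (t', x') < d \<longrightarrow> cone_dist (s x t) (s x' t') < e"
    if e: "0 < e" for e
  proof -
    obtain d1 where d1: "0 < d1" "\<And>p p'. p \<in> {0..T} \<times> M \<Longrightarrow> p' \<in> {0..T} \<times> M \<Longrightarrow> dist p' p < d1 \<Longrightarrow>
        dist ((\<lambda>(t, x). \<phi> t x) p') ((\<lambda>(t, x). \<phi> t x) p) < e / (4 * R)"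
      using uc(1) e R unfolding uniformly_continuous_on_def by (metis divide_pos_pos mult_pos_pos zero_less_numeral)
    obtain d2 where d2: "0 < d2" "\<And>p p'. p \<in> {0..T} \<times> M \<Longrightarrow> p' \<in> {0..T} \<times> M \<Longrightarrow> dist p' p < d2 \<Longrightarrow>
        dist ((\<lambda>(t, x). lam t x) p') ((\<lambda>(t, x). lam t x) p) < e / 2"
      using uc(2) e unfolding uniformly_continuous_on_def by (metis half_gt_zero)
    show ?thesis
    proof (intro exI[of _ "min d1 d2"] conjI ballI impI)
      show "0 < min d1 d2" using d1 d2 by simp
      fix t t' x x' assume tx: "t \<in> {0..T}" "t' \<in> {0..T}" "x \<in> M" "x' \<in> M" and d: "dist (t, x) (t', x') < min d1 d2"
      have 1: "dist (\<phi> t x) (\<phi> t' x') < e / (4 * R)" using d1(2)[of "(t', x')" "(t, x)"] tx d by auto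
      have 2: "\<bar>lam t x - lam t' x'\<bar> < e / 2" using d2(2)[of "(t', x')" "(t, x)"] tx d by (auto simp: dist_real_def)
      have "cone_dist (s x t) (s x' t') \<le> \<bar>lam t x - lam t' x'\<bar> + (lam t x + lam t' x') * dist (\<phi> t x) (\<phi> t' x')"
        using cone_dist_le[of "s x t" "s x' t'"] tx la(2) by (simp add: sx less_imp_le)
      also have "(lam t x + lam t' x') * dist (\<phi> t x) (\<phi> t' x') \<le> (2 * R) * (e / (4 * R))"
        using 1 R tx la(2) by (intro mult_mono) (auto simp: less_imp_le intro: order_trans[OF add_mono[OF R(2) R(2)]])
      also have "\<dots> = e / 2" using R by simp
      finally show "cone_dist (s x t) (s x' t') < e" using 2 by linarith
    qed
  qed
  show path: "s x \<in> paths T x\<^sub>0 M" if x: "x \<in> M" for x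
  proof (rule pathsI)
    show "s x \<in> extensional {0..T}" by (simp add: s_def solution_path_def)
    have "continuous_map (mtopology_of (submetric euclidean_metric {0..T})) (cone_top x\<^sub>0 M) (s x)"
    proof (rule continuous_map_mtopologyI)
      fix a :: real and e :: real assume a: "a \<in> mspace (submetric euclidean_metric {0..T})" and e: "0 < e"
      obtain d where "0 < d" "\<forall>t\<in>{0..T}. \<forall>t'\<in>{0..T}. \<forall>x\<in>M. \<forall>x'\<in>M. dist (t, x) (t', x') < d \<longrightarrow> cone_dist (s x t) (s x' t') < e"
        using est[OF e] by blast
      then show "\<exists>d>0. \<forall>t\<in>mspace (submetric euclidean_metric {0..T}). mdist (submetric euclidean_metric {0..T}) a t < d \<longrightarrow>
          mdist (cone_metric x\<^sub>0 M) (s x a) (s x t) < e"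
        using a x by (intro exI[of _ d]) (auto simp: dist_Pair_Pair)
    qed (use sc x in auto)
    then show "continuous_map (top_of_set {0..T}) (cone_top x\<^sub>0 M) (s x)"
      by (simp add: mtopology_of_submetric)
  qed
  have "continuous_map (mtopology_of (submetric euclidean_metric M)) (path_top T x\<^sub>0 M) s"
  proof (rule continuous_map_mtopologyI)
    fix a and e :: real assume a: "a \<in> mspace (submetric euclidean_metric M)" and e: "0 < e"
    obtain d where d: "0 < d" "\<forall>t\<in>{0..T}. \<forall>t'\<in>{0..T}. \<forall>x\<in>M. \<forall>x'\<in>M. dist (t, x) (t', x') < d \<longrightarrow> cone_dist (s x t) (s x' t') < e / 2"
      using est[of "e / 2"] e by auto
    show "\<exists>d>0. \<forall>x\<in>mspace (submetric euclidean_metric M). mdist (submetric euclidean_metric M) a x < d \<longrightarrow>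
        mdist (path_space T x\<^sub>0 M) (s a) (s x) < e"
    proof (intro exI[of _ d] conjI ballI impI)
      fix x assume x: "x \<in> mspace (submetric euclidean_metric M)" and "mdist (submetric euclidean_metric M) a x < d"
      then have "cone_dist (s a t) (s x t) \<le> e / 2" if "t \<in> {0..T}" for t
        using d(2) that a by (force simp: dist_Pair_Pair)
      then have "mdist (path_space T x\<^sub>0 M) (s a) (s x) \<le> e / 2" using e by (intro path_dist_le) auto
      then show "mdist (path_space T x\<^sub>0 M) (s a) (s x) < e" using e by simp
    qed (rule d)
  qed (use path in auto)
  then show "continuous_map (top_of_set M) (path_top T x\<^sub>0 M) s"
    by (simp add: mtopology_of_submetric)
qed

lemma cone_scale_in_cone:
  assumes "z \<in> cone x\<^sub>0 M" "0 < c"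
  shows "cone_scale c z \<in> cone x\<^sub>0 M"
proof -
  obtain x r where "z = cone_pt x\<^sub>0 x r" "x \<in> M" "0 \<le> r" using assms(1) by (auto simp: cone_def)
  then have "cone_scale c z = cone_pt x\<^sub>0 x (c * r)" "0 \<le> c * r" using assms(2) by (auto simp: cone_pt_def cone_scale_def)
  then show ?thesis using \<open>x \<in> M\<close> by (auto simp: cone_def)
qed

lemma cone_dist_scale_le:
  assumes z: "z \<in> cone x\<^sub>0 M" "w \<in> cone x\<^sub>0 M" and c: "0 < c" "0 < c'"
  shows "cone_dist (cone_scale c z) (cone_scale c' w) \<le> \<bar>c - c'\<bar> * snd z + c' * cone_dist z w"
proof -
  interpret Metric_space "cone x\<^sub>0 M" cone_dist by (rule Metric_space_cone)
  have "cone_dist (cone_scale c z) (cone_scale c' w)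
    \<le> cone_dist (cone_scale c z) (cone_scale c' z) + cone_dist (cone_scale c' z) (cone_scale c' w)"
    using z c by (intro triangle cone_scale_in_cone)
  also have "cone_dist (cone_scale c' z) (cone_scale c' w) = c' * cone_dist z w"
    using c by (intro cone_dist_self_scale) simp
  also have "cone_dist (cone_scale c z) (cone_scale c' z) = \<bar>c - c'\<bar> * snd z"
  proof -
    have z0: "0 \<le> snd z" using z(1) by (auto simp: cone_def cone_pt_def)
    have "cone_dist (cone_scale c z) (cone_scale c' z) = sqrt ((c * snd z - c' * snd z)\<^sup>2)"
      by (simp add: cone_dist_def cone_scale_def power2_diff mult_ac)
    then show ?thesis using z0 by (simp add: left_diff_distrib[symmetric] abs_mult)
  qed
  finally show ?thesis .
qed

lemma path_radius_bounded:
  assumes z: "z \<in> paths T x\<^sub>0 M" and M: "x\<^sub>0 \<in> M" "compact M"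
  obtains R where "0 < R" "\<And>t. t \<in> {0..T} \<Longrightarrow> snd (z t) \<le> R"
proof -
  have "continuous_map (top_of_set {0..T}) euclidean (\<lambda>t. snd (z t) *\<^sub>R (1::real))"
    using continuous_map_compose[OF pathsD_continuous(2)[OF z] continuous_map_cone_radial[OF M(2,1) continuous_on_const[of M "1::real"]]]
    by (simp add: comp_def)
  then have "continuous_on {0..T} (\<lambda>t. snd (z t))" by simp
  then have "bounded ((\<lambda>t. snd (z t)) ` {0..T})" by (intro compact_imp_bounded compact_continuous_image) auto
  then obtain R where R: "0 < R" "\<forall>y\<in>(\<lambda>t. snd (z t)) ` {0..T}. norm y \<le> R"
    unfolding bounded_pos by auto
  show thesis
  proof (rule that[OF R(1)])
    show "snd (z t) \<le> R" if "t \<in> {0..T}" for t using R(2) that by (auto simp: abs_le_iff)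
  qed
qed

lemma scale_path_in_paths:
  assumes z: "z \<in> paths T x\<^sub>0 M" and c: "0 < c"
  shows "scale_path T c z \<in> paths T x\<^sub>0 M"
proof (rule pathsI)
  show "scale_path T c z \<in> extensional {0..T}" by (simp add: scale_path_def)
  have "continuous_map (cone_top x\<^sub>0 M) (cone_top x\<^sub>0 M) (cone_scale c)"
  proof (rule continuous_map_mtopologyI)
    show "\<exists>d>0. \<forall>x\<in>mspace (cone_metric x\<^sub>0 M). mdist (cone_metric x\<^sub>0 M) a x < d \<longrightarrow> mdist (cone_metric x\<^sub>0 M) (cone_scale c a) (cone_scale c x) < e"
      if "0 < e" for a and e :: real
      using c that by (intro exI[of _ "e / c"]) (auto simp: cone_dist_self_scale field_simps)
  qed (use c cone_scale_in_cone in auto)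
  from continuous_map_compose[OF pathsD_continuous(2)[OF z] this]
  show "continuous_map (top_of_set {0..T}) (cone_top x\<^sub>0 M) (scale_path T c z)"
    by (rule continuous_map_eq) (simp add: scale_path_def)
qed

text \<open>The map is continuous on the open set \<open>U\<close> where \<theta> > 0 and the
  identity elsewhere. So the preimage of an open V consists of a part that is open in
  \<open>U\<close> and of the Borel set V - U, although continuity can fail where \<theta> tends to
  0.\<close>

lemma prod_path_measurable:
  assumes M: "compact M" "x\<^sub>0 \<in> M" and th: "continuous_map (path_top T x\<^sub>0 M) euclideanreal \<theta>"
  shows "prod_path T \<theta> \<in> measurable (path_borel T x\<^sub>0 M) (path_borel T x\<^sub>0 M)"
proof (rule measurable_borel_ofI)
  show "prod_path T \<theta> \<in> space (path_borel T x\<^sub>0 M) \<rightarrow> topspace (path_top T x\<^sub>0 M)"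
    by (auto simp: prod_path_def intro!: scale_path_in_paths)
  define U where "U = {z \<in> paths T x\<^sub>0 M. 0 < \<theta> z}"
  have U: "openin (path_top T x\<^sub>0 M) U"
    using openin_continuous_map_preimage[OF th, of "{0<..}"] by (simp add: U_def)
  interpret Metric_space "paths T x\<^sub>0 M" "mdist (path_space T x\<^sub>0 M)" by (rule Metric_space_mspace_mdist)
  have "continuous_map (mtopology_of (submetric (path_space T x\<^sub>0 M) U)) (path_top T x\<^sub>0 M) (\<lambda>z. scale_path T (1 / \<theta> z) z)"
  proof (rule continuous_map_mtopologyI)
    fix a and e :: real assume a: "a \<in> mspace (submetric (path_space T x\<^sub>0 M) U)" and e: "0 < e"
    then have aU: "a \<in> U" "a \<in> paths T x\<^sub>0 M" "0 < \<theta> a" by (auto simp: U_def)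
    obtain R where R: "0 < R" "\<And>t. t \<in> {0..T} \<Longrightarrow> snd (a t) \<le> R" using path_radius_bounded[OF aU(2) M(2,1)] by blast
    define \<iota> where "\<iota> = 1 / \<theta> a"
    have i: "0 < \<iota>" using aU by (simp add: \<iota>_def)
    \<comment> \<open>The second entry makes the change of factor cost at most e/4 on a path with
      radii up to R. The first keeps the perturbed factor below \<iota> + 1, the constant that
      enters the choice of \<open>d\<close>.\<close>
    define q where "q = min 1 (e / (4 * R))"
    have q: "0 < q" using e R by (simp add: q_def)
    have "continuous_map (subtopology (path_top T x\<^sub>0 M) U) euclideanreal (\<lambda>z. 1 / \<theta> z)"
      by (intro continuous_map_real_divide continuous_map_from_subtopology th) (auto simp: U_def)
    then have "openin (subtopology (path_top T x\<^sub>0 M) U) {z \<in> topspace (subtopology (path_top T x\<^sub>0 M) U). 1 / \<theta> z \<in> ball \<iota> q}"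
      by (rule openin_continuous_map_preimage) simp
    then have "openin (path_top T x\<^sub>0 M) {z \<in> topspace (subtopology (path_top T x\<^sub>0 M) U). 1 / \<theta> z \<in> ball \<iota> q}"
      using U openin_trans_full by blast
    moreover have "a \<in> {z \<in> topspace (subtopology (path_top T x\<^sub>0 M) U). 1 / \<theta> z \<in> ball \<iota> q}"
      using aU q by (simp add: \<iota>_def)
    ultimately obtain d1 where d1: "0 < d1" "mball a d1 \<subseteq> {z \<in> topspace (subtopology (path_top T x\<^sub>0 M) U). 1 / \<theta> z \<in> ball \<iota> q}"
      unfolding mtopology_of_def openin_mtopology by blast
    define d where "d = min d1 (e / (4 * (\<iota> + 1)))"
    show "\<exists>d>0. \<forall>z\<in>mspace (submetric (path_space T x\<^sub>0 M) U). mdist (submetric (path_space T x\<^sub>0 M) U) a z < d \<longrightarrow>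
        mdist (path_space T x\<^sub>0 M) (scale_path T (1 / \<theta> a) a) (scale_path T (1 / \<theta> z) z) < e"
    proof (intro exI[of _ d] conjI ballI impI)
      show "0 < d" using d1 e i by (simp add: d_def)
      fix z assume "z \<in> mspace (submetric (path_space T x\<^sub>0 M) U)" and zd: "mdist (submetric (path_space T x\<^sub>0 M) U) a z < d"
      then have z: "z \<in> paths T x\<^sub>0 M" "0 < \<theta> z" "mdist (path_space T x\<^sub>0 M) a z < d" by (auto simp: U_def)
      then have "z \<in> mball a d1" using aU by (simp add: d_def)
      then have iq: "\<bar>\<iota> - 1 / \<theta> z\<bar> < q" using d1 by (auto simp: dist_real_def)
      have "cone_dist (scale_path T (1 / \<theta> a) a t) (scale_path T (1 / \<theta> z) z t) \<le> e / 2" if t: "t \<in> {0..T}" for t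
      proof -
        have at: "a t \<in> cone x\<^sub>0 M" "z t \<in> cone x\<^sub>0 M" using pathsD[OF _ M(2) t] aU z by auto
        have "cone_dist (scale_path T (1 / \<theta> a) a t) (scale_path T (1 / \<theta> z) z t)
            \<le> \<bar>\<iota> - 1 / \<theta> z\<bar> * snd (a t) + 1 / \<theta> z * cone_dist (a t) (z t)"
          using t cone_dist_scale_le[OF at, of \<iota> "1 / \<theta> z"] i z by (simp add: scale_path_def \<iota>_def)
        also have "\<bar>\<iota> - 1 / \<theta> z\<bar> * snd (a t) \<le> q * R"
          using iq R(2)[OF t] q pathsD(2)[OF aU(2) M(2) t] by (intro mult_mono) auto
        also have "q * R \<le> e / (4 * R) * R" using R by (intro mult_right_mono) (auto simp: q_def)
        also have "\<dots> = e / 4" using R by simp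
        also have "1 / \<theta> z * cone_dist (a t) (z t) \<le> (\<iota> + 1) * (e / (4 * (\<iota> + 1)))"
        proof (intro mult_mono)
          show "1 / \<theta> z \<le> \<iota> + 1" using iq by (auto simp: q_def)
          show "cone_dist (a t) (z t) \<le> e / (4 * (\<iota> + 1))"
            using path_dist_ge[OF aU(2) z(1) t] z(3) by (simp add: d_def)
          show "0 \<le> cone_dist (a t) (z t)"
            using pathsD(2)[OF aU(2) M(2) t] pathsD(2)[OF z(1) M(2) t] by (rule cone_dist_nonneg)
        qed (use i in auto)
        also have "\<dots> = e / 4"
        proof -
          have "j * (e / (4 * j)) = e / 4" if "0 < j" for j using that by simp
          then show ?thesis using i by (simp del: distrib_left_numeral)
        qed
        finally show ?thesis by simp
      qed
      then have "mdist (path_space T x\<^sub>0 M) (scale_path T (1 / \<theta> a) a) (scale_path T (1 / \<theta> z) z) \<le> e / 2"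
        using e by (intro path_dist_le) auto
      then show "mdist (path_space T x\<^sub>0 M) (scale_path T (1 / \<theta> a) a) (scale_path T (1 / \<theta> z) z) < e" using e by simp
    qed
  qed (auto simp: U_def intro!: scale_path_in_paths)
  then have c: "continuous_map (subtopology (path_top T x\<^sub>0 M) U) (path_top T x\<^sub>0 M) (\<lambda>z. scale_path T (1 / \<theta> z) z)"
    by (simp add: mtopology_of_submetric)
  fix V assume V: "openin (path_top T x\<^sub>0 M) V"
  define W where "W = {z \<in> topspace (subtopology (path_top T x\<^sub>0 M) U). scale_path T (1 / \<theta> z) z \<in> V}"
  have "openin (subtopology (path_top T x\<^sub>0 M) U) W"
    unfolding W_def using c V by (rule openin_continuous_map_preimage)
  then have "openin (path_top T x\<^sub>0 M) W" using U openin_trans_full by blast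
  then have "W \<union> (V - U) \<in> sets (path_borel T x\<^sub>0 M)"
    using U V by (intro sets.Un sets.Diff openin_borel_of)
  moreover have "prod_path T \<theta> -` V \<inter> space (path_borel T x\<^sub>0 M) = W \<union> (V - U)"
    using openin_subset[OF V] by (auto simp: prod_path_def W_def U_def split: if_splits)
  ultimately show "prod_path T \<theta> -` V \<inter> space (path_borel T x\<^sub>0 M) \<in> sets (path_borel T x\<^sub>0 M)" by simp
qed

text \<open>A converse to \<open>continuous_map_cone_radial\<close>: over a bounded M the functions
  r and r x determine the topology of the cone. If the limit radius is 0, the distance to the limit
  is just the radius; otherwise closeness of positions is recovered from r x by dividing by the
  limit radius.\<close>

lemma continuous_map_into_cone:
  fixes F :: "'p \<Rightarrow> 'a::real_normed_vector \<times> real"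
  assumes M: "bounded M" "x\<^sub>0 \<in> M" and F: "\<And>p. p \<in> topspace X \<Longrightarrow> F p \<in> cone x\<^sub>0 M"
    and c1: "continuous_map X euclidean (\<lambda>p. snd (F p))"
    and c2: "continuous_map X euclidean (\<lambda>p. snd (F p) *\<^sub>R fst (F p))"
  shows "continuous_map X (cone_top x\<^sub>0 M) F"
  unfolding continuous_map_atin
proof
  fix p assume p: "p \<in> topspace X"
  interpret Metric_space "cone x\<^sub>0 M" cone_dist by (rule Metric_space_cone)
  obtain B where B: "0 < B" "\<And>x. x \<in> M \<Longrightarrow> norm x \<le> B" using M(1) unfolding bounded_pos by blast
  note cD = cone_memD[OF F M(2)]
  let ?A = "atin X p"
  define r where "r = snd (F p)"
  have t1: "((\<lambda>q. snd (F q)) \<longlongrightarrow> r) ?A" and t2: "((\<lambda>q. snd (F q) *\<^sub>R fst (F q)) \<longlongrightarrow> r *\<^sub>R fst (F p)) ?A"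
    using c1 c2 p by (auto simp: continuous_map_atin r_def)
  have evX: "\<forall>\<^sub>F q in ?A. q \<in> topspace X"
    by (metis (no_types, lifting) eventually_atin openin_topspace Diff_iff)
  have r0: "0 \<le> r" using cD(1)[OF p] by (simp add: r_def)
  define b where "b q = \<bar>snd (F q) - r\<bar> + (if r = 0 then 0 else (snd (F q) + r) * ((norm (snd (F q) *\<^sub>R fst (F q) - r *\<^sub>R fst (F p)) + B * \<bar>snd (F q) - r\<bar>) / r))" for q
  define c where "c q = (norm (snd (F q) *\<^sub>R fst (F q) - r *\<^sub>R fst (F p)) + B * \<bar>snd (F q) - r\<bar>)" for q
  have cl: "(c \<longlongrightarrow> norm (r *\<^sub>R fst (F p) - r *\<^sub>R fst (F p)) + B * \<bar>r - r\<bar>) ?A"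
    unfolding c_def by (intro tendsto_intros t1 t2)
  have rl: "((\<lambda>q. \<bar>snd (F q) - r\<bar>) \<longlongrightarrow> \<bar>r - r\<bar>) ?A" by (intro tendsto_intros t1)
  have "((\<lambda>q. \<bar>snd (F q) - r\<bar> + (snd (F q) + r) * (c q / r)) \<longlongrightarrow> \<bar>r - r\<bar> + (r + r) * ((norm (r *\<^sub>R fst (F p) - r *\<^sub>R fst (F p)) + B * \<bar>r - r\<bar>) / r)) ?A" if "r \<noteq> 0"
    using that by (intro tendsto_add tendsto_mult tendsto_divide rl cl t1 tendsto_const)
  then have bl: "(b \<longlongrightarrow> 0) ?A"
    using rl by (cases "r = 0") (simp_all add: b_def[abs_def] c_def)
  have le: "\<forall>\<^sub>F q in ?A. cone_dist (F q) (F p) \<le> b q"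
    using evX
  proof eventually_elim
    case (elim q)
    have s0: "0 \<le> snd (F q)" using cD(1)[OF elim] .
    show ?case
    proof (cases "r = 0")
      case True
      then show ?thesis
        using s0 by (simp add: cone_dist_def b_def r_def[symmetric])
    next
      case False
      have "cone_dist (F q) (F p) \<le> \<bar>snd (F q) - r\<bar> + (snd (F q) + r) * dist (fst (F q)) (fst (F p))"
        using cone_dist_le[of "F q" "F p"] s0 r0 by (simp add: r_def)
      also have "dist (fst (F q)) (fst (F p)) \<le> (norm (snd (F q) *\<^sub>R fst (F q) - r *\<^sub>R fst (F p)) + B * \<bar>snd (F q) - r\<bar>) / r"
      proof -
        have "r *\<^sub>R (fst (F q) - fst (F p)) = (snd (F q) *\<^sub>R fst (F q) - r *\<^sub>R fst (F p)) - (snd (F q) - r) *\<^sub>R fst (F q)"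
          by (simp add: algebra_simps)
        then have "r * norm (fst (F q) - fst (F p)) \<le> norm (snd (F q) *\<^sub>R fst (F q) - r *\<^sub>R fst (F p)) + \<bar>snd (F q) - r\<bar> * norm (fst (F q))"
          using r0 by (metis abs_of_nonneg norm_scaleR norm_triangle_ineq4)
        also have "\<bar>snd (F q) - r\<bar> * norm (fst (F q)) \<le> \<bar>snd (F q) - r\<bar> * B"
          using B(2)[OF cD(2)[OF elim]] by (intro mult_left_mono) auto
        finally show ?thesis using False r0 by (simp add: dist_norm field_simps)
      qed
      finally show ?thesis using False s0 r0 by (simp add: b_def mult_left_mono)
    qed
  qed
  show "limitin (cone_top x\<^sub>0 M) F (F p) ?A"
    unfolding mtopology_of_def mspace_cone_metric mdist_cone_metric limitin_metric
  proof (intro conjI allI impI)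
    show "F p \<in> cone x\<^sub>0 M" by (rule F[OF p])
    fix e :: real assume "0 < e"
    then have "\<forall>\<^sub>F q in ?A. b q < e" using bl by (intro order_tendstoD)
    then show "\<forall>\<^sub>F q in ?A. F q \<in> cone x\<^sub>0 M \<and> cone_dist (F q) (F p) < e"
      using le evX by eventually_elim (auto intro: F)
  qed
qed

lemma has_vector_derivative_tendsto:
  fixes f :: "real \<Rightarrow> 'b::real_normed_vector"
  assumes "(f has_vector_derivative d) (at t within S)"
  shows "((\<lambda>s. (f s - f t) /\<^sub>R (s - t)) \<longlongrightarrow> d) (at t within S)"
proof -
  have "((\<lambda>s. norm (f s - f t - (s - t) *\<^sub>R d) / norm (s - t)) \<longlongrightarrow> 0) (at t within S)"
    using assms unfolding has_vector_derivative_def has_derivative_iff_norm by simp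
  moreover have "\<forall>\<^sub>F s in at t within S. norm (f s - f t - (s - t) *\<^sub>R d) / norm (s - t) = norm ((f s - f t) /\<^sub>R (s - t) - d)"
  proof -
    have "norm (f s - f t - (s - t) *\<^sub>R d) / norm (s - t) = norm ((f s - f t) /\<^sub>R (s - t) - d)" if "s \<noteq> t" for s
    proof -
      have "(f s - f t) /\<^sub>R (s - t) - d = (f s - f t - (s - t) *\<^sub>R d) /\<^sub>R (s - t)"
        using that by (simp add: scaleR_right_diff_distrib)
      then show ?thesis by (simp add: divide_inverse mult.commute)
    qed
    then show ?thesis by (simp add: eventually_at_filter)
  qed
  ultimately have "((\<lambda>s. norm ((f s - f t) /\<^sub>R (s - t) - d)) \<longlongrightarrow> 0) (at t within S)"
    by (rule Lim_transform_eventually)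
  then show ?thesis by (rule LIM_zero_cancel[OF tendsto_norm_zero_cancel])
qed

text \<open>With 1 - cos n = 2 sin^2 (n/2) and the function \<open>sinc\<close>, which is continuous
  at 0, the squared quotient becomes a product of convergent terms, also at times where the position
  returns to x t.\<close>

lemma cone_dist_quotient_tendsto:
  fixes x :: "real \<Rightarrow> 'a::real_normed_vector"
  assumes x: "(x has_vector_derivative u) (at t within S)" and r: "(r has_vector_derivative r') (at t within S)"
    and pos: "\<And>s. s \<in> S \<Longrightarrow> 0 \<le> r s" "t \<in> S"
  shows "((\<lambda>s. cone_dist (x s, r s) (x t, r t) / \<bar>s - t\<bar>) \<longlongrightarrow> sqrt (r'\<^sup>2 + (r t)\<^sup>2 * (norm u)\<^sup>2)) (at t within S)"
proof -
  define sc :: "real \<Rightarrow> real" where "sc = sinc"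
  have sc: "isCont sc 0" "sc 0 = 1" "\<And>y. sin y = y * sc y"
    unfolding sc_def using isCont_sinc by auto
  define q where "q s = ((r s - r t) /\<^sub>R (s - t))\<^sup>2 + r s * r t * (norm ((x s - x t) /\<^sub>R (s - t)))\<^sup>2 * (sc (norm (x s - x t) / 2))\<^sup>2" for s
  have xc: "(x \<longlongrightarrow> x t) (at t within S)" and rc: "(r \<longlongrightarrow> r t) (at t within S)"
    using has_vector_derivative_continuous[OF x] has_vector_derivative_continuous[OF r] by (auto simp: continuous_within)
  have n0: "((\<lambda>s. norm (x s - x t) / 2) \<longlongrightarrow> norm (x t - x t) / 2) (at t within S)" by (intro tendsto_intros xc) simp
  then have "((\<lambda>s. sc (norm (x s - x t) / 2)) \<longlongrightarrow> sc 0) (at t within S)"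
    using isCont_tendsto_compose[OF sc(1)] by simp
  then have "(q \<longlongrightarrow> r'\<^sup>2 + r t * r t * (norm u)\<^sup>2 * (sc 0)\<^sup>2) (at t within S)"
    unfolding q_def
    by (intro tendsto_add tendsto_mult tendsto_power tendsto_norm tendsto_const
        has_vector_derivative_tendsto[OF x] has_vector_derivative_tendsto[OF r] rc)
  then have lim: "((\<lambda>s. sqrt (q s)) \<longlongrightarrow> sqrt (r'\<^sup>2 + (r t)\<^sup>2 * (norm u)\<^sup>2)) (at t within S)"
    using tendsto_real_sqrt by (fastforce simp: power2_eq_square sc(2))
  have "\<forall>\<^sub>F s in at t within S. norm (x s - x t) / 2 < pi / 2"
    using n0 by (intro order_tendstoD) auto
  moreover have "\<forall>\<^sub>F s in at t within S. s \<in> S \<and> s \<noteq> t" by (simp add: eventually_at_filter)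
  ultimately have "\<forall>\<^sub>F s in at t within S. sqrt (q s) = cone_dist (x s, r s) (x t, r t) / \<bar>s - t\<bar>"
  proof eventually_elim
    case (elim s)
    define n where "n = norm (x s - x t)"
    have sn: "sin (n / 2) = n / 2 * sc (n / 2)" by (rule sc(3))
    have "(cone_dist (x s, r s) (x t, r t))\<^sup>2 = (r s - r t)\<^sup>2 + 2 * r s * r t * (1 - cos n)"
      using cone_dist_sq[of "(x s, r s)" "(x t, r t)"] pos elim by (simp add: n_def dist_norm min_absorb1)
    also have "1 - cos n = 2 * (sin (n / 2))\<^sup>2" using cos_double_sin[of "n / 2"] by simp
    also have "2 * r s * r t * (2 * (sin (n / 2))\<^sup>2) = r s * r t * n\<^sup>2 * (sc (n / 2))\<^sup>2"
      unfolding sn by (simp only: power_mult_distrib) (simp add: power_divide)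
    finally have d: "(cone_dist (x s, r s) (x t, r t))\<^sup>2 = (r s - r t)\<^sup>2 + r s * r t * n\<^sup>2 * (sc (n / 2))\<^sup>2" .
    have "(r s - r t) /\<^sub>R (s - t) = (r s - r t) / (s - t)" by (simp add: divide_inverse)
    then have q1: "((r s - r t) /\<^sub>R (s - t))\<^sup>2 = (r s - r t)\<^sup>2 / (s - t)\<^sup>2" by (simp only: power_divide)
    have "norm ((x s - x t) /\<^sub>R (s - t)) = n / \<bar>s - t\<bar>" by (simp add: n_def divide_inverse)
    then have q2: "(norm ((x s - x t) /\<^sub>R (s - t)))\<^sup>2 = n\<^sup>2 / (s - t)\<^sup>2" by (simp only: power_divide power2_abs)
    have "(cone_dist (x s, r s) (x t, r t))\<^sup>2 / (s - t)\<^sup>2 = q s"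
      unfolding d q_def q1 q2 n_def[symmetric] by (simp add: add_divide_distrib)
    then have "sqrt (q s) = sqrt ((cone_dist (x s, r s) (x t, r t))\<^sup>2) / sqrt ((s - t)\<^sup>2)"
      by (metis real_sqrt_divide)
    moreover have "0 \<le> cone_dist (x s, r s) (x t, r t)" using pos elim by (intro cone_dist_nonneg) auto
    ultimately show ?case by simp
  qed
  with lim show ?thesis by (rule Lim_transform_eventually)
qed

section \<open>Regularity and exact action of the critical path\<close>

context comparison
begin

definition sol :: "real \<Rightarrow> 'a \<times> real" where
  "sol = (\<lambda>t\<in>{0..T}. (xs t, rs t))"

lemma sol_AC2:
  assumes pos: "\<And>t. t \<in> {0..T} \<Longrightarrow> 0 < rs t" and path: "sol \<in> paths T x\<^sub>0 M"
  shows "sol \<in> AC2 T x\<^sub>0 M"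
proof -
  obtain Lx where Lx: "Lx-lipschitz_on {0..T} xs"
    using lipschitz_on_continuous_deriv[OF xs(1) continuous_derivs(1)] by blast
  obtain Lr where Lr: "Lr-lipschitz_on {0..T} rs"
    using lipschitz_on_continuous_deriv[OF rs(1) continuous_derivs(2)] by blast
  have L0: "0 \<le> Lx" "0 \<le> Lr" using Lx Lr lipschitz_on_nonneg by blast+
  obtain R where R: "0 < R" "\<And>t. t \<in> {0..T} \<Longrightarrow> norm (rs t) \<le> R"
    using ac_bounded[OF ac_lipschitz[OF Lr]] by blast
  define C where "C = Lr + (R + R) * Lx"
  have "abs_cont T sol"
    unfolding abs_cont_def
  proof (intro exI conjI allI impI)
    show "set_integrable lebesgue {0..T} (\<lambda>_. C)"
      using absolutely_integrable_on_const[of "{0..T}" C] by simp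
    fix s t :: real assume st: "0 \<le> s" "s \<le> t" "t \<le> T"
    then have T': "s \<in> {0..T}" "t \<in> {0..T}" by auto
    have "cone_dist (sol s) (sol t) \<le> \<bar>rs s - rs t\<bar> + (rs s + rs t) * dist (xs s) (xs t)"
      using cone_dist_le[of "(xs s, rs s)" "(xs t, rs t)"] rs(4)[OF T'(1)] rs(4)[OF T'(2)] T' by (simp add: sol_def)
    also have "\<dots> \<le> Lr * (t - s) + (R + R) * (Lx * (t - s))"
      using lipschitz_onD[OF Lx T'] lipschitz_onD[OF Lr T'] R(2)[OF T'(1)] R(2)[OF T'(2)] st R(1)
      by (intro add_mono mult_mono) (auto simp: dist_real_def)
    also have "\<dots> = (LINT u:{s..t}|lebesgue. C)"
      using st by (simp add: C_def algebra_simps set_lebesgue_integral_def)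
    finally show "cone_dist (sol s) (sol t) \<le> (LINT u:{s..t}|lebesgue. C)" .
  qed
  moreover have "set_integrable lebesgue {0..T} (\<lambda>t. (metric_speed T sol t)\<^sup>2)"
  proof -
    have ms: "metric_speed T sol t = sqrt ((r1 t)\<^sup>2 + (rs t)\<^sup>2 * (norm (x1 t))\<^sup>2)" if t: "t \<in> {0..T}" for t
      unfolding metric_speed_def
    proof (rule tendsto_Lim)
      show "\<not> trivial_limit (at t within {0..T})"
        using T t by (simp add: trivial_limit_within islimpt_Icc)
      have "((\<lambda>s. cone_dist (xs s, rs s) (xs t, rs t) / \<bar>s - t\<bar>) \<longlongrightarrow> sqrt ((r1 t)\<^sup>2 + (rs t)\<^sup>2 * (norm (x1 t))\<^sup>2)) (at t within {0..T})"
        by (rule cone_dist_quotient_tendsto[OF xs(1)[OF t] rs(1)[OF t] rs(4) t])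
      then show "((\<lambda>s. cone_dist (sol s) (sol t) / \<bar>s - t\<bar>) \<longlongrightarrow> sqrt ((r1 t)\<^sup>2 + (rs t)\<^sup>2 * (norm (x1 t))\<^sup>2)) (at t within {0..T})"
        by (rule Lim_transform_eventually) (auto simp: eventually_at_filter sol_def t[simplified])
    qed
    have "continuous_on {0..T} (\<lambda>t. (r1 t)\<^sup>2 + (rs t)\<^sup>2 * (norm (x1 t))\<^sup>2)"
      by (intro continuous_intros continuous_derivs)
    then have "(\<lambda>t. (r1 t)\<^sup>2 + (rs t)\<^sup>2 * (norm (x1 t))\<^sup>2) absolutely_integrable_on {0..T}"
      using absolutely_integrable_continuous[of 0 T] by simp
    then show ?thesis
      by (rule set_integrable_cong[THEN iffD1, rotated 3]) (auto simp: ms)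
  qed
  ultimately show ?thesis using path by (simp add: AC2_def)
qed

text \<open>By the second equation of motion the squared speed minus P r^2 is the derivative of
  \<open>rs * r1\<close>. This is the equality case of \<open>action_ge\<close>, and the action
  turns into boundary terms plus the potential.\<close>

lemma sol_action:
  assumes pos: "\<And>t. t \<in> {0..T} \<Longrightarrow> 0 < rs t" and path: "sol \<in> paths T x\<^sub>0 M"
  shows "path_action T x\<^sub>0 M sol = ennreal (rs T * r1 T - rs 0 * r1 0 + integral {0..T} (\<lambda>t. P t (xs t) * (rs t)\<^sup>2))"
    "0 \<le> rs T * r1 T - rs 0 * r1 0 + integral {0..T} (\<lambda>t. P t (xs t) * (rs t)\<^sup>2)"
proof -
  define v where "v t = (rs t)\<^sup>2 * (x1 t \<bullet> x1 t) + (r1 t)\<^sup>2" for t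
  have vc: "continuous_on {0..T} v" unfolding v_def[abs_def] by (intro continuous_intros continuous_derivs)
  have v0: "0 \<le> v t" for t by (simp add: v_def)
  have sp: "path_speed_sq T sol t = v t" if t: "t \<in> {0..T}" for t
  proof -
    have d: "((\<lambda>s. fst (sol s)) has_vector_derivative x1 t) (at t within {0..T})"
      by (rule has_vector_derivative_transform[OF t _ xs(1)[OF t]]) (simp add: sol_def)
    have d': "((\<lambda>s. snd (sol s)) has_vector_derivative r1 t) (at t within {0..T})"
      by (rule has_vector_derivative_transform[OF t _ rs(1)[OF t]]) (simp add: sol_def)
    have "vector_derivative (\<lambda>s. fst (sol s)) (at t within {0..T}) = x1 t"
      "vector_derivative (\<lambda>s. snd (sol s)) (at t within {0..T}) = r1 t"
      using vector_derivative_within_cbox[of 0 T t] d d' t T by auto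
    then show ?thesis
      using t pos[OF t] differentiableI_vector[OF d] differentiableI_vector[OF d']
      by (simp add: path_speed_sq_def Let_def cone_tensor_def v_def sol_def power2_eq_square)
  qed
  have Pc: "continuous_on {0..T} (\<lambda>t. P t (xs t))"
  proof -
    have "continuous_on {0..T} (\<lambda>t. (\<lambda>(t, x). P t x) (t, xs t))"
      by (rule continuous_on_compose2[OF P(1)]) (auto intro!: continuous_intros continuous_derivs xs(4))
    then show ?thesis by simp
  qed
  have iv: "integral {0..T} v = rs T * r1 T - rs 0 * r1 0 + integral {0..T} (\<lambda>t. P t (xs t) * (rs t)\<^sup>2)"
  proof -
    have "((\<lambda>t. v t - P t (xs t) * (rs t)\<^sup>2) has_integral (rs T * r1 T - rs 0 * r1 0)) {0..T}"
    proof (rule fundamental_theorem_of_calculus)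
      fix t assume t: "t \<in> {0..T}"
      have "((\<lambda>t. rs t * r1 t) has_vector_derivative (rs t * r2 t + r1 t * r1 t)) (at t within {0..T})"
        by (intro bounded_bilinear.has_vector_derivative[OF bounded_bilinear_mult] rs t)
      moreover have "rs t * r2 t + r1 t * r1 t = v t - P t (xs t) * (rs t)\<^sup>2"
      proof -
        have "r2 t = rs t * (x1 t \<bullet> x1 t) - rs t * P t (xs t)"
          using el_r[OF t] by (simp add: power2_norm_eq_inner)
        then show ?thesis unfolding v_def by (simp only:) (simp add: power2_eq_square algebra_simps)
      qed
      ultimately show "((\<lambda>t. rs t * r1 t) has_vector_derivative v t - P t (xs t) * (rs t)\<^sup>2) (at t within {0..T})" by simp
    qed (use T in simp)
    moreover have "((\<lambda>t. P t (xs t) * (rs t)\<^sup>2) has_integral integral {0..T} (\<lambda>t. P t (xs t) * (rs t)\<^sup>2)) {0..T}"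
      using Pc continuous_derivs(4)
      by (intro integrable_integral integrable_continuous_real continuous_intros)
    ultimately have "((\<lambda>t. (v t - P t (xs t) * (rs t)\<^sup>2) + P t (xs t) * (rs t)\<^sup>2) has_integral
        (rs T * r1 T - rs 0 * r1 0 + integral {0..T} (\<lambda>t. P t (xs t) * (rs t)\<^sup>2))) {0..T}"
      by (rule has_integral_add)
    then have "(v has_integral (rs T * r1 T - rs 0 * r1 0 + integral {0..T} (\<lambda>t. P t (xs t) * (rs t)\<^sup>2))) {0..T}"
      by simp
    then show ?thesis by (rule integral_unique)
  qed
  have "path_action T x\<^sub>0 M sol = (\<integral>\<^sup>+t\<in>{0..T}. ennreal (v t) \<partial>lebesgue)"
    unfolding path_action_def using sol_AC2[OF pos path]
    by (auto intro!: nn_integral_cong simp: sp indicator_def)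
  also have "\<dots> = (\<integral>\<^sup>+t. ennreal (indicator {0..T} t * v t) \<partial>lebesgue)"
    by (intro nn_integral_cong) (auto simp: indicator_def)
  also have "\<dots> = ennreal (LINT t|lebesgue. indicator {0..T} t * v t)"
    using absolutely_integrable_continuous[of 0 T v] vc v0
    by (intro nn_integral_eq_integral) (auto simp: set_integrable_def)
  also have "(LINT t|lebesgue. indicator {0..T} t * v t) = integral {0..T} v"
    using set_lebesgue_integral_eq_integral(2)[of "{0..T}" v] absolutely_integrable_continuous[of 0 T v] vc
    by (simp add: set_lebesgue_integral_def)
  finally show "path_action T x\<^sub>0 M sol = ennreal (rs T * r1 T - rs 0 * r1 0 + integral {0..T} (\<lambda>t. P t (xs t) * (rs t)\<^sup>2))"
    unfolding iv .
  show "0 \<le> rs T * r1 T - rs 0 * r1 0 + integral {0..T} (\<lambda>t. P t (xs t) * (rs t)\<^sup>2)"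
    unfolding iv[symmetric] by (intro integral_nonneg integrable_continuous_real vc v0)
qed

end

section \<open>Smooth solutions\<close>

lemma smooth_on_continuous_on: "smooth_on S f \<Longrightarrow> continuous_on S f"
proof -
  assume "smooth_on S f"
  then obtain U g where U: "S \<subseteq> U" "\<forall>k. Ck_on k U g" "\<forall>x\<in>S. g x = f x"
    unfolding smooth_on_def by blast
  have "continuous_on U g" using U(2)[rule_format, of 0] by simp
  then show ?thesis using continuous_on_subset[OF _ U(1)] U(3) by (metis continuous_on_eq)
qed

lemma smooth_on_time_vector_derivatives:
  fixes f :: "real \<Rightarrow> 'a::real_normed_vector \<Rightarrow> 'b::real_normed_vector"
  assumes f: "smooth_on ({0..T} \<times> M) (\<lambda>(t, x). f t x)" and T: "0 < T"
  defines "f1 \<equiv> \<lambda>t x. vector_derivative (\<lambda>s. f s x) (at t within {0..T})"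
  defines "f2 \<equiv> \<lambda>t x. vector_derivative (\<lambda>s. f1 s x) (at t within {0..T})"
  shows "continuous_on ({0..T} \<times> M) (\<lambda>(t, x). f1 t x)" "continuous_on ({0..T} \<times> M) (\<lambda>(t, x). f2 t x)"
    "\<And>t x. t \<in> {0..T} \<Longrightarrow> x \<in> M \<Longrightarrow> ((\<lambda>s. f s x) has_vector_derivative f1 t x) (at t within {0..T})"
    "\<And>t x. t \<in> {0..T} \<Longrightarrow> x \<in> M \<Longrightarrow> ((\<lambda>s. f1 s x) has_vector_derivative f2 t x) (at t within {0..T})"
proof -
  obtain g1 g2 where g: "continuous_on ({0..T} \<times> M) (\<lambda>(t, x). g1 t x)" "continuous_on ({0..T} \<times> M) (\<lambda>(t, x). g2 t x)"
    "\<And>t x. t \<in> {0..T} \<Longrightarrow> x \<in> M \<Longrightarrow> ((\<lambda>s. f s x) has_vector_derivative g1 t x) (at t within {0..T})"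
    "\<And>t x. t \<in> {0..T} \<Longrightarrow> x \<in> M \<Longrightarrow> ((\<lambda>s. g1 s x) has_vector_derivative g2 t x) (at t within {0..T})"
    using smooth_on_time_derivatives[OF f] by metis
  have v: "vector_derivative F (at t within {0..T}) = F'" if "(F has_vector_derivative F') (at t within {0..T})" "t \<in> {0..T}" for F :: "real \<Rightarrow> 'b" and F' t
    using vector_derivative_within_cbox[of 0 T t F F'] that T by simp
  have e1: "f1 t x = g1 t x" if "t \<in> {0..T}" "x \<in> M" for t x
    unfolding f1_def using v[OF g(3)] that by blast
  have d1: "((\<lambda>s. f1 s x) has_vector_derivative g2 t x) (at t within {0..T})" if "t \<in> {0..T}" "x \<in> M" for t x
    by (rule has_vector_derivative_transform[OF that(1) _ g(4)[OF that]]) (use e1 that in auto)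
  have e2: "f2 t x = g2 t x" if "t \<in> {0..T}" "x \<in> M" for t x
    unfolding f2_def using v[OF d1] that by blast
  show "continuous_on ({0..T} \<times> M) (\<lambda>(t, x). f1 t x)" using g(1) by (rule continuous_on_eq) (auto simp: e1)
  show "continuous_on ({0..T} \<times> M) (\<lambda>(t, x). f2 t x)" using g(2) by (rule continuous_on_eq) (auto simp: e2)
  show "((\<lambda>s. f s x) has_vector_derivative f1 t x) (at t within {0..T})" if "t \<in> {0..T}" "x \<in> M" for t x
    using g(3)[OF that] e1[OF that] by simp
  show "((\<lambda>s. f1 s x) has_vector_derivative f2 t x) (at t within {0..T})" if "t \<in> {0..T}" "x \<in> M" for t x
    using d1[OF that] e2[OF that] by simp
qed

lemma continuous_on_slices:
  assumes "continuous_on (A \<times> B) (\<lambda>(t, x). f t x)"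
  shows "t \<in> A \<Longrightarrow> continuous_on B (f t)" "x \<in> B \<Longrightarrow> continuous_on A (\<lambda>t. f t x)"
proof -
  assume t: "t \<in> A"
  have "continuous_on B (\<lambda>x. (\<lambda>(t, x). f t x) (t, x))"
    by (rule continuous_on_compose2[OF assms]) (use t in \<open>auto intro!: continuous_intros\<close>)
  then show "continuous_on B (f t)" by simp
next
  assume x: "x \<in> B"
  have "continuous_on A (\<lambda>t. (\<lambda>(t, x). f t x) (t, x))"
    by (rule continuous_on_compose2[OF assms]) (use x in \<open>auto intro!: continuous_intros\<close>)
  then show "continuous_on A (\<lambda>t. f t x)" by simp
qed

lemma path_components_continuous:
  fixes z :: "real \<Rightarrow> 'a::real_normed_vector \<times> real"
  assumes "z \<in> paths T x\<^sub>0 M" "compact M" "x\<^sub>0 \<in> M"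
  shows "continuous_on {0..T} (\<lambda>t. snd (z t))" "continuous_on {0..T} (\<lambda>t. snd (z t) *\<^sub>R fst (z t))"
proof -
  note c = continuous_map_compose[OF pathsD_continuous(2)[OF assms(1)] continuous_map_cone_radial[OF assms(2,3)]]
  show "continuous_on {0..T} (\<lambda>t. snd (z t))"
    using c[OF continuous_on_const[of M "1::real"]] by (simp add: comp_def)
  show "continuous_on {0..T} (\<lambda>t. snd (z t) *\<^sub>R fst (z t))"
    using continuous_map_compose[OF pathsD_continuous(2)[OF assms(1)] continuous_map_cone_radial[OF assms(2,3), of "\<lambda>x. x"]]
    by (simp add: comp_def)
qed

lemma cone_dist_cone_pt: "cone_dist z (cone_pt x\<^sub>0 x r) = cone_dist z (x, r)"
  by (simp add: cone_pt_def cone_dist_def)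

text \<open>The Hessian bound is condition (i) with the constant 1/(128 pi^2) inserted, that is K =
  1/(128 T^2), for which 64 K is exactly the 1/(2 T^2) allowed in \<open>comparison\<close>.\<close>

locale hdiv =
  fixes T :: real and M :: "'a::euclidean_space set" and x\<^sub>0 :: 'a
    and \<phi> :: "real \<Rightarrow> 'a \<Rightarrow> 'a" and lam P :: "real \<Rightarrow> 'a \<Rightarrow> real"
  assumes body: "lipschitz_body M" and conv: "convex M" and x0: "x\<^sub>0 \<in> M" and T: "0 < T"
    and sol: "smooth_Hdiv_solution T M \<phi> lam P"
    and hess: "\<And>x t w. x \<in> M \<Longrightarrow> t \<in> {0..T} \<Longrightarrow>
      \<bar>hessian (M \<times> {0<..}) cone_tensor (\<lambda>p. P t (fst p) * (snd p)\<^sup>2) (solution_path T x\<^sub>0 \<phi> lam x t) w\<bar>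
        \<le> 1 / (128 * T\<^sup>2) * cone_tensor (solution_path T x\<^sub>0 \<phi> lam x t) w w"
begin

definition phi1 :: "real \<Rightarrow> 'a \<Rightarrow> 'a" where
  "phi1 t x = vector_derivative (\<lambda>s. \<phi> s x) (at t within {0..T})"
definition phi2 :: "real \<Rightarrow> 'a \<Rightarrow> 'a" where
  "phi2 t x = vector_derivative (\<lambda>s. phi1 s x) (at t within {0..T})"
definition lam1 :: "real \<Rightarrow> 'a \<Rightarrow> real" where
  "lam1 t x = vector_derivative (\<lambda>s. lam s x) (at t within {0..T})"
definition lam2 :: "real \<Rightarrow> 'a \<Rightarrow> real" where
  "lam2 t x = vector_derivative (\<lambda>s. lam1 s x) (at t within {0..T})"
definition psi :: "'a \<Rightarrow> 'a" where "psi = the_inv_into M (\<phi> 0)"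

lemma M: "compact M" "interior M \<noteq> {}" "M \<noteq> {}"
proof -
  obtain U where U: "open U" "bounded U" "U \<noteq> {}" "M = closure U"
    using body unfolding lipschitz_body_def by blast
  show "compact M" using U by (simp add: compact_closure)
  have "U \<subseteq> interior M" using U by (simp add: closure_subset interior_maximal)
  then show "interior M \<noteq> {}" "M \<noteq> {}" using U x0 by auto
qed

lemma T0: "0 \<in> {0..T}" "T \<in> {0..T}" using T by auto

lemma smooth: "smooth_on ({0..T} \<times> M) (\<lambda>(t, x). \<phi> t x)" "smooth_on ({0..T} \<times> M) (\<lambda>(t, x). lam t x)"
    "smooth_on ({0..T} \<times> M) (\<lambda>(t, x). P t x)"
  using sol unfolding smooth_Hdiv_solution_def by auto

lemmas cont = smooth_on_continuous_on[OF smooth(1)] smooth_on_continuous_on[OF smooth(2)] smooth_on_continuous_on[OF smooth(3)]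

lemmas phi_deriv = smooth_on_time_vector_derivatives[OF smooth(1) T, folded phi1_def, folded phi2_def]
lemmas lam_deriv = smooth_on_time_vector_derivatives[OF smooth(2) T, folded lam1_def, folded lam2_def]

lemma diffeo:
  assumes "t \<in> {0..T}"
  shows "bij_betw (\<phi> t) M M" "smooth_on M (the_inv_into M (\<phi> t))"
    and "\<And>x. x \<in> M \<Longrightarrow> 0 < lam t x"
    and "distr (density (normalized_lebesgue M) (\<lambda>x. ennreal ((lam t x)\<^sup>2))) (normalized_lebesgue M) (\<phi> t) = normalized_lebesgue M"
  using sol assms unfolding smooth_Hdiv_solution_def smooth_diffeo_def by auto

lemma phiM: "t \<in> {0..T} \<Longrightarrow> x \<in> M \<Longrightarrow> \<phi> t x \<in> M"
  using diffeo(1) bij_betwE by metis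

lemma psi: "x \<in> M \<Longrightarrow> psi x \<in> M" "x \<in> M \<Longrightarrow> \<phi> 0 (psi x) = x" "x \<in> M \<Longrightarrow> psi (\<phi> 0 x) = x"
  using diffeo(1)[OF T0(1)] unfolding psi_def bij_betw_def
  by (auto intro: the_inv_into_into f_the_inv_into_f the_inv_into_f_f)

lemma psi_cont: "continuous_on M psi"
  unfolding psi_def using diffeo(2)[OF T0(1)] by (rule smooth_on_continuous_on)

text \<open>The equations are linear in \<open>lam\<close> and its time derivatives, so every
  multiple c of the radius satisfies them. The Hessian is controlled only along the solution paths,
  but \<phi> t maps M onto M and the derived bounds are free of the radius, so they hold for P on
  all of M.\<close>

lemma comparison:
  assumes \<xi>: "\<xi> \<in> M" and c: "0 \<le> c"
  shows "comparison T M x\<^sub>0 P (1 / (128 * T\<^sup>2)) (\<lambda>t. gradient_within M (P t) (\<phi> t \<xi>))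
    (\<lambda>t. \<phi> t \<xi>) (\<lambda>t. phi1 t \<xi>) (\<lambda>t. phi2 t \<xi>) (\<lambda>t. c * lam t \<xi>) (\<lambda>t. c * lam1 t \<xi>) (\<lambda>t. c * lam2 t \<xi>)"
proof -
  let ?K = "1 / (128 * T\<^sup>2)"
  obtain G H where GH: "\<And>t x. t \<in> {0..T} \<Longrightarrow> x \<in> M \<Longrightarrow> (P t has_derivative (\<lambda>h. G t x \<bullet> h)) (at x within M)"
    "\<And>t x y. t \<in> {0..T} \<Longrightarrow> x \<in> M \<Longrightarrow> ((\<lambda>x. G t x \<bullet> y) has_derivative H t x y) (at x within M)"
    using smooth_on_space_derivatives[OF smooth(3)] by metis
  have grad: "gradient_within M (P t) x = G t x" if "t \<in> {0..T}" "x \<in> M" for t x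
    by (rule gradient_within_convex[OF conv M(2) that(2) GH(1)[OF that]])
  have hb: "\<bar>P t x\<bar> \<le> ?K / 2 \<and> (\<forall>y. \<bar>G t x \<bullet> y\<bar> \<le> ?K * norm y) \<and> (\<forall>y. \<bar>H t x y y\<bar> \<le> 2 * ?K * (y \<bullet> y))"
    if t: "t \<in> {0..T}" and x: "x \<in> M" for t x
  proof -
    obtain u where u: "u \<in> M" "\<phi> t u = x"
      using diffeo(1)[OF t] x unfolding bij_betw_def by (metis imageE)
    have l: "0 < lam t u" using diffeo(3)[OF t u(1)] .
    have sp: "solution_path T x\<^sub>0 \<phi> lam u t = (x, lam t u)"
      using solution_path_apply[where T=T and t=t and lam=lam and x=u and \<phi>=\<phi>] t l u by simp
    have b: "\<bar>hessian (M \<times> {0<..}) cone_tensor (\<lambda>q. P t (fst q) * (snd q)\<^sup>2) (x, lam t u) w\<bar> \<le> ?K * cone_tensor (x, lam t u) w w" for w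
      using hess[OF u(1) t, of w] unfolding sp .
    show ?thesis
      using hessian_bound_imp[OF conv M(2) GH(1)[OF t] GH(2)[OF t] x l b] by blast
  qed
  have el: "lam t \<xi> *\<^sub>R phi2 t \<xi> + (2 * lam1 t \<xi>) *\<^sub>R phi1 t \<xi> + (lam t \<xi> / 2) *\<^sub>R gradient_within M (P t) (\<phi> t \<xi>) = 0"
      "lam2 t \<xi> - lam t \<xi> * (norm (phi1 t \<xi>))\<^sup>2 + lam t \<xi> * P t (\<phi> t \<xi>) = 0" if "t \<in> {0..T}" for t
    using sol that \<xi> unfolding smooth_Hdiv_solution_def Let_def phi2_def lam2_def phi1_def lam1_def by blast+
  show ?thesis
  proof
    show "0 < T" "compact M" "x\<^sub>0 \<in> M" using T M x0 by auto
    show "continuous_on {0..T} (\<lambda>t. phi2 t \<xi>)" "continuous_on {0..T} (\<lambda>t. c * lam2 t \<xi>)"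
      using continuous_on_slices(2)[OF phi_deriv(2) \<xi>] continuous_on_slices(2)[OF lam_deriv(2) \<xi>]
      by (auto intro!: continuous_intros)
    show "continuous_on ({0..T} \<times> M) (\<lambda>(t, x). P t x)" by (rule cont)
    show "64 * ?K \<le> 1 / (2 * T\<^sup>2)" by simp
    fix t assume t: "t \<in> {0..T}"
    show "((\<lambda>t. \<phi> t \<xi>) has_vector_derivative phi1 t \<xi>) (at t within {0..T})"
      "((\<lambda>t. phi1 t \<xi>) has_vector_derivative phi2 t \<xi>) (at t within {0..T})"
      using phi_deriv(3,4)[OF t \<xi>] .
    show "((\<lambda>t. c * lam t \<xi>) has_vector_derivative c * lam1 t \<xi>) (at t within {0..T})"
      "((\<lambda>t. c * lam1 t \<xi>) has_vector_derivative c * lam2 t \<xi>) (at t within {0..T})"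
      using has_vector_derivative_mult_right[OF lam_deriv(3)[OF t \<xi>], of c] has_vector_derivative_mult_right[OF lam_deriv(4)[OF t \<xi>], of c] .
    show pM: "\<phi> t \<xi> \<in> M" using phiM[OF t \<xi>] .
    show "0 \<le> c * lam t \<xi>" using c diffeo(3)[OF t \<xi>] by simp
    have "(c * lam t \<xi>) *\<^sub>R phi2 t \<xi> + (2 * (c * lam1 t \<xi>)) *\<^sub>R phi1 t \<xi> + (c * lam t \<xi> / 2) *\<^sub>R gradient_within M (P t) (\<phi> t \<xi>)
      = c *\<^sub>R (lam t \<xi> *\<^sub>R phi2 t \<xi> + (2 * lam1 t \<xi>) *\<^sub>R phi1 t \<xi> + (lam t \<xi> / 2) *\<^sub>R gradient_within M (P t) (\<phi> t \<xi>))"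
      by (simp add: scaleR_right_distrib mult_ac)
    then show "(c * lam t \<xi>) *\<^sub>R phi2 t \<xi> + (2 * (c * lam1 t \<xi>)) *\<^sub>R phi1 t \<xi> + (c * lam t \<xi> / 2) *\<^sub>R gradient_within M (P t) (\<phi> t \<xi>) = 0"
      unfolding el(1)[OF t] by simp
    have "c * lam2 t \<xi> - c * lam t \<xi> * (norm (phi1 t \<xi>))\<^sup>2 + c * lam t \<xi> * P t (\<phi> t \<xi>)
      = c * (lam2 t \<xi> - lam t \<xi> * (norm (phi1 t \<xi>))\<^sup>2 + lam t \<xi> * P t (\<phi> t \<xi>))"
      by (simp add: algebra_simps)
    then show "c * lam2 t \<xi> - c * lam t \<xi> * (norm (phi1 t \<xi>))\<^sup>2 + c * lam t \<xi> * P t (\<phi> t \<xi>) = 0"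
      unfolding el(2)[OF t] by simp
    show "\<bar>gradient_within M (P t) (\<phi> t \<xi>) \<bullet> y\<bar> \<le> ?K * norm y" for y
      using hb[OF t pM] grad[OF t pM] by simp
    fix x assume x: "x \<in> M"
    show "\<bar>P t x\<bar> \<le> ?K / 2" using hb[OF t x] by blast
    show "\<bar>P t x - P t (\<phi> t \<xi>) - gradient_within M (P t) (\<phi> t \<xi>) \<bullet> (x - \<phi> t \<xi>)\<bar> \<le> ?K * (norm (x - \<phi> t \<xi>))\<^sup>2"
      unfolding grad[OF t pM]
      by (rule taylor2_convex[OF conv pM x GH(1)[OF t] GH(2)[OF t]]) (use hb[OF t] in auto)
  qed
qed

text \<open>\<open>xi z\<close> labels the solution path that starts at the position of z, and
  \<open>sig z\<close> is the factor by which that path must be scaled to start at z itself. On a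
  path that starts at the apex the factor is 0, and the label is an arbitrary one coming from the
  base point.\<close>

definition xi :: "(real \<Rightarrow> 'a \<times> real) \<Rightarrow> 'a" where "xi z = psi (fst (z 0))"
definition sig :: "(real \<Rightarrow> 'a \<times> real) \<Rightarrow> real" where "sig z = snd (z 0) / lam 0 (xi z)"
definition gapf :: "(real \<Rightarrow> 'a \<times> real) \<Rightarrow> real \<Rightarrow> real" where
  "gapf z t = (cone_dist (z t) (\<phi> t (xi z), sig z * lam t (xi z)))\<^sup>2"
text \<open>The boundary term of \<open>lam * lam1\<close> between the times 0 and T, divided by the
  squared initial radius: multiplied by r^2 it is the boundary term for the scaled path and a
  2-homogeneous function of the initial point alone, hence a legitimate test function for the
  coupling.\<close>

definition kin :: "'a \<Rightarrow> real" where
  "kin x = (lam T (psi x) * lam1 T (psi x) - lam 0 (psi x) * lam1 0 (psi x)) / (lam 0 (psi x))\<^sup>2"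
definition ratio :: "'a \<Rightarrow> real" where "ratio x = lam T (psi x) / lam 0 (psi x)"
definition pot :: "(real \<Rightarrow> 'a \<times> real) \<Rightarrow> real" where
  "pot z = integral {0..T} (\<lambda>t. P t (fst (z t)) * (snd (z t))\<^sup>2)"
text \<open>The second equation is multiplied by the radius in order to be meaningful at the apex.\<close>

definition supported :: "(real \<Rightarrow> 'a \<times> real) \<Rightarrow> bool" where
  "supported z \<longleftrightarrow> snd (z T) = snd (z 0) * ratio (fst (z 0)) \<and>
     snd (z T) *\<^sub>R fst (z T) = snd (z 0) *\<^sub>R (ratio (fst (z 0)) *\<^sub>R \<phi> T (psi (fst (z 0))))"

abbreviation "zs \<equiv> solution_path T x\<^sub>0 \<phi> lam"

lemma zs_apply: "x \<in> M \<Longrightarrow> t \<in> {0..T} \<Longrightarrow> zs x t = (\<phi> t x, lam t x)"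
  using diffeo(3) by (simp add: solution_path_apply)

lemma zs_paths: "x \<in> M \<Longrightarrow> zs x \<in> paths T x\<^sub>0 M"
  and zs_continuous: "continuous_map (top_of_set M) (path_top T x\<^sub>0 M) zs"
  using continuous_map_solution_path[OF M(1) cont(1) phiM cont(2) diffeo(3)] by blast+

lemma path0:
  assumes "z \<in> paths T x\<^sub>0 M"
  shows "fst (z 0) \<in> M" "xi z \<in> M" "0 \<le> snd (z 0)" "0 < lam 0 (xi z)" "0 \<le> sig z"
proof -
  show 1: "fst (z 0) \<in> M" "0 \<le> snd (z 0)" using pathsD[OF assms x0 T0(1)] by auto
  then show 2: "xi z \<in> M" by (simp add: xi_def psi)
  then show "0 < lam 0 (xi z)" using diffeo(3)[OF T0(1)] by blast
  then show "0 \<le> sig z" using 1 by (simp add: sig_def)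
qed

lemma pot_continuous:
  assumes "z \<in> paths T x\<^sub>0 M"
  shows "continuous_on {0..T} (\<lambda>t. P t (fst (z t)) * (snd (z t))\<^sup>2)"
  using cont(3) M(1) path_components_continuous[OF assms M(1) x0] pathsD[OF assms x0]
  by (intro continuous_on_potential[of _ M]) auto

lemma gapf_continuous:
  assumes z: "z \<in> paths T x\<^sub>0 M"
  shows "continuous_on {0..T} (gapf z)"
proof -
  \<comment> \<open>For factor 0 the bare pair is not the normal form of the apex.
    \<open>cone_pt\<close> supplies a genuine point of the cone, and \<open>cone_dist\<close> does
    not see the difference.\<close>
  define F where "F t = cone_pt x\<^sub>0 (\<phi> t (xi z)) (sig z * lam t (xi z))" for t
  have s: "snd (F t) = sig z * lam t (xi z)" "snd (F t) *\<^sub>R fst (F t) = (sig z * lam t (xi z)) *\<^sub>R \<phi> t (xi z)" for t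
    by (auto simp: F_def cone_pt_def)
  have c: "continuous_on {0..T} (\<lambda>t. sig z * lam t (xi z))" "continuous_on {0..T} (\<lambda>t. (sig z * lam t (xi z)) *\<^sub>R \<phi> t (xi z))"
    using continuous_on_slices(2)[OF cont(1) path0(2)[OF z]] continuous_on_slices(2)[OF cont(2) path0(2)[OF z]]
    by (auto intro!: continuous_intros)
  have "continuous_map (top_of_set {0..T}) (cone_top x\<^sub>0 M) F"
  proof (rule continuous_map_into_cone[OF compact_imp_bounded[OF M(1)] x0])
    show "F t \<in> cone x\<^sub>0 M" if "t \<in> topspace (top_of_set {0..T})" for t
    proof -
      have t: "t \<in> {0..T}" using that by simp
      show ?thesis
        unfolding F_def using path0[OF z] diffeo(3)[OF t path0(2)[OF z]] phiM[OF t path0(2)[OF z]]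
        by (intro cone_pt_in_cone) auto
    qed
    show "continuous_map (top_of_set {0..T}) euclidean (\<lambda>t. snd (F t))"
      unfolding s(1) using c(1) by simp
    show "continuous_map (top_of_set {0..T}) euclidean (\<lambda>t. snd (F t) *\<^sub>R fst (F t))"
      unfolding s(2) using c(2) by simp
  qed
  from continuous_map_mdist[OF pathsD_continuous(2)[OF z] this]
  have "continuous_on {0..T} (\<lambda>t. (cone_dist (z t) (F t))\<^sup>2)" by (auto intro: continuous_intros)
  moreover have "cone_dist (z t) (F t) = cone_dist (z t) (\<phi> t (xi z), sig z * lam t (xi z))" for t
    by (simp add: F_def cone_dist_cone_pt)
  ultimately show ?thesis by (simp add: gapf_def[abs_def])
qed

text \<open>The comparison is made with the solution path labelled \<open>xi z\<close>, scaled by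
  \<open>sig z\<close>. \<open>supported\<close> says that the final points agree, its second
  equation being divided by the final radius when that is positive. Outside \<open>AC2\<close> the
  action is infinite.\<close>

lemma action_lower_bound:
  assumes z: "z \<in> paths T x\<^sub>0 M" and s: "supported z"
  shows "ennreal ((snd (z 0))\<^sup>2 * kin (fst (z 0)) + pot z + integral {0..T} (gapf z) / (2 * T\<^sup>2)) \<le> path_action T x\<^sub>0 M z"
proof (cases "z \<in> AC2 T x\<^sub>0 M")
  case True
  note p0 = path0[OF z]
  interpret comparison T M x\<^sub>0 P "1 / (128 * T\<^sup>2)" "\<lambda>t. gradient_within M (P t) (\<phi> t (xi z))"
    "\<lambda>t. \<phi> t (xi z)" "\<lambda>t. phi1 t (xi z)" "\<lambda>t. phi2 t (xi z)"
    "\<lambda>t. sig z * lam t (xi z)" "\<lambda>t. sig z * lam1 t (xi z)" "\<lambda>t. sig z * lam2 t (xi z)"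
    by (rule comparison[OF p0(2,5)])
  have s0: "snd (z 0) = sig z * lam 0 (xi z)" using p0 by (simp add: sig_def)
  have sT: "snd (z T) = sig z * lam T (xi z)"
    using s p0 by (simp add: supported_def ratio_def xi_def sig_def)
  have "ennreal (sig z * lam T (xi z) * (sig z * lam1 T (xi z)) - sig z * lam 0 (xi z) * (sig z * lam1 0 (xi z))
      + integral {0..T} (\<lambda>t. P t (fst (z t)) * (snd (z t))\<^sup>2 + gap z t / (2 * T\<^sup>2))) \<le> path_action T x\<^sub>0 M z"
  proof (rule action_ge[OF True s0 _ sT])
    show "fst (z 0) = \<phi> 0 (xi z)" using p0 by (simp add: xi_def psi)
    assume "0 < sig z * lam T (xi z)"
    then have "0 < snd (z T)" using sT by simp
    moreover have "snd (z T) *\<^sub>R fst (z T) = snd (z T) *\<^sub>R \<phi> T (xi z)"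
      using s unfolding supported_def xi_def by (metis scaleR_scaleR)
    ultimately show "fst (z T) = \<phi> T (xi z)" by simp
  qed
  moreover have "gap z = gapf z" by (simp add: fun_eq_iff gap_def gapf_def)
  moreover have "integral {0..T} (\<lambda>t. P t (fst (z t)) * (snd (z t))\<^sup>2 + gapf z t / (2 * T\<^sup>2))
    = pot z + integral {0..T} (gapf z) / (2 * T\<^sup>2)"
    unfolding pot_def
    by (subst Henstock_Kurzweil_Integration.integral_add)
       (auto intro!: integrable_continuous_real pot_continuous[OF z] gapf_continuous[OF z] continuous_on_divide continuous_on_const simp: T less_imp_neq[symmetric])
  moreover have "sig z * lam T (xi z) * (sig z * lam1 T (xi z)) - sig z * lam 0 (xi z) * (sig z * lam1 0 (xi z))
    = (snd (z 0))\<^sup>2 * kin (fst (z 0))"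
    using p0 by (simp add: kin_def xi_def[symmetric] sig_def power2_eq_square field_simps)
  ultimately show ?thesis by (simp add: add.assoc)
qed (simp add: path_action_def)

text \<open>A solution path is its own comparison path with factor 1, so the lower bound becomes an
  equality without distance term.\<close>

lemma solution_path_facts:
  assumes x: "x \<in> M"
  shows "xi (zs x) = x" "sig (zs x) = 1" "supported (zs x)"
    "path_action T x\<^sub>0 M (zs x) = ennreal ((snd (zs x 0))\<^sup>2 * kin (fst (zs x 0)) + pot (zs x))"
    "0 \<le> (snd (zs x 0))\<^sup>2 * kin (fst (zs x 0)) + pot (zs x)"
proof -
  note z0 = zs_apply[OF x T0(1)] and zT = zs_apply[OF x T0(2)]
  have l0: "0 < lam 0 x" using diffeo(3)[OF T0(1) x] .
  show xi: "xi (zs x) = x" by (simp add: xi_def z0 psi x)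
  show "sig (zs x) = 1" using l0 by (simp add: sig_def xi z0)
  show "supported (zs x)" using l0 by (simp add: supported_def z0 zT ratio_def psi x)
  interpret comparison T M x\<^sub>0 P "1 / (128 * T\<^sup>2)" "\<lambda>t. gradient_within M (P t) (\<phi> t x)"
    "\<lambda>t. \<phi> t x" "\<lambda>t. phi1 t x" "\<lambda>t. phi2 t x" "\<lambda>t. 1 * lam t x" "\<lambda>t. 1 * lam1 t x" "\<lambda>t. 1 * lam2 t x"
    by (rule comparison[OF x]) simp
  have "zs x t = sol t" for t
  proof (cases "t \<in> {0..T}")
    case True
    then show ?thesis unfolding sol_def zs_apply[OF x True] by simp
  next
    case False
    then show ?thesis unfolding sol_def solution_path_def by auto
  qed
  then have eq: "zs x = sol" by (rule ext)
  have "path_action T x\<^sub>0 M sol = ennreal (1 * lam T x * (1 * lam1 T x) - 1 * lam 0 x * (1 * lam1 0 x)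
      + integral {0..T} (\<lambda>t. P t (\<phi> t x) * (1 * lam t x)\<^sup>2))"
    "0 \<le> 1 * lam T x * (1 * lam1 T x) - 1 * lam 0 x * (1 * lam1 0 x)
      + integral {0..T} (\<lambda>t. P t (\<phi> t x) * (1 * lam t x)\<^sup>2)"
    using diffeo(3)[OF _ x] zs_paths[OF x] unfolding eq by (intro sol_action; simp)+
  moreover have "integral {0..T} (\<lambda>t. P t (\<phi> t x) * (1 * lam t x)\<^sup>2) = pot (zs x)"
    unfolding pot_def by (intro integral_cong) (simp add: zs_apply[OF x])
  moreover have "1 * lam T x * (1 * lam1 T x) - 1 * lam 0 x * (1 * lam1 0 x) = (snd (zs x 0))\<^sup>2 * kin (fst (zs x 0))"
    using l0 by (simp add: z0 kin_def psi x)
  ultimately show "path_action T x\<^sub>0 M (zs x) = ennreal ((snd (zs x 0))\<^sup>2 * kin (fst (zs x 0)) + pot (zs x))"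
      "0 \<le> (snd (zs x 0))\<^sup>2 * kin (fst (zs x 0)) + pot (zs x)"
    unfolding eq by simp_all
qed

text \<open>A continuous nonnegative function with zero integral vanishes at every time, so z agrees
  everywhere with the scaled solution path; factor 0 gives the constant path at the apex.\<close>

lemma gapf_zero_imp:
  assumes z: "z \<in> paths T x\<^sub>0 M" and g: "integral {0..T} (gapf z) = 0"
  shows "z = apex_path T x\<^sub>0 \<or> (0 < sig z \<and> z = scale_path T (sig z) (zs (xi z)))"
proof -
  note p0 = path0[OF z]
  have g0: "gapf z t = 0" if t: "t \<in> {0..T}" for t
  proof -
    have "integral {0..T} (gapf z) = 0 \<longleftrightarrow> (\<forall>t\<in>{0..T}. gapf z t = 0)"
      using gapf_continuous[OF z] T by (intro integral_eq_0_iff) (auto simp: gapf_def)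
    then show ?thesis using g t by auto
  qed
  interpret Metric_space "cone x\<^sub>0 M" cone_dist by (rule Metric_space_cone)
  have zt: "z t = cone_pt x\<^sub>0 (\<phi> t (xi z)) (sig z * lam t (xi z))" if t: "t \<in> {0..T}" for t
  proof -
    have "cone_dist (z t) (cone_pt x\<^sub>0 (\<phi> t (xi z)) (sig z * lam t (xi z))) = 0"
      using g0[OF t] by (simp add: gapf_def cone_dist_cone_pt)
    moreover have "cone_pt x\<^sub>0 (\<phi> t (xi z)) (sig z * lam t (xi z)) \<in> cone x\<^sub>0 M"
      using p0 diffeo(3)[OF t p0(2)] phiM[OF t p0(2)] by (intro cone_pt_in_cone) auto
    ultimately show ?thesis using zero pathsD(1)[OF z x0 t] by blast
  qed
  have ext: "z t = undefined" if "t \<notin> {0..T}" for t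
    using pathsD_continuous(1)[OF z] that by (simp add: extensional_def)
  show ?thesis
  proof (cases "sig z = 0")
    case True
    have "z t = apex_path T x\<^sub>0 t" for t
      using zt[of t] ext[of t] by (cases "t \<in> {0..T}") (auto simp: apex_path_def cone_pt_def True)
    then show ?thesis by (auto simp: fun_eq_iff)
  next
    case False
    then have pos: "0 < sig z" using p0 by simp
    have "z t = scale_path T (sig z) (zs (xi z)) t" for t
    proof (cases "t \<in> {0..T}")
      case True
      then show ?thesis using zt[OF True] pos diffeo(3)[OF True p0(2)] zs_apply[OF p0(2) True]
        by (simp add: scale_path_def cone_scale_def cone_pt_def)
    qed (auto simp: ext scale_path_def)
    then show ?thesis using pos by (auto simp: fun_eq_iff)
  qed
qed

end

section \<open>Plans\<close>

lemma grid_tendsto: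
  fixes t :: real
  shows "(\<lambda>n. of_int \<lfloor>real (Suc n) * t\<rfloor> / real (Suc n)) \<longlonglongrightarrow> t"
proof (rule Lim_null_comparison[THEN LIM_zero_cancel])
  show "(\<lambda>n. inverse (real (Suc n))) \<longlonglongrightarrow> 0" by (rule LIMSEQ_inverse_real_of_nat)
  show "\<forall>\<^sub>F n in sequentially. norm (of_int \<lfloor>real (Suc n) * t\<rfloor> / real (Suc n) - t) \<le> inverse (real (Suc n))"
  proof (rule always_eventually, rule allI)
    fix n
    define m where "m = real (Suc n)"
    have m: "0 < m" by (simp add: m_def)
    have "\<bar>of_int \<lfloor>m * t\<rfloor> - m * t\<bar> \<le> 1" by linarith
    then have "\<bar>of_int \<lfloor>m * t\<rfloor> - m * t\<bar> / m \<le> 1 / m" using m by (simp add: divide_right_mono)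
    moreover have "of_int \<lfloor>m * t\<rfloor> / m - t = (of_int \<lfloor>m * t\<rfloor> - m * t) / m" using m by (simp add: field_simps)
    ultimately have "norm (of_int \<lfloor>m * t\<rfloor> / m - t) \<le> inverse m"
      using m by (simp only: real_norm_def abs_divide inverse_eq_divide abs_of_pos)
    then show "norm (of_int \<lfloor>real (Suc n) * t\<rfloor> / real (Suc n) - t) \<le> inverse (real (Suc n))" by (simp only: m_def)
  qed
qed

text \<open>A Caratheodory argument: measurability in z and continuity in t give joint
  measurability, by evaluating h on a grid of mesh 1/(n + 1) and passing to the limit. Grid times
  are clamped to [0, T], since h is controlled only there. Integration in t then preserves
  measurability.\<close>

lemma borel_measurable_path_integral:
  fixes h :: "'p \<Rightarrow> real \<Rightarrow> real"
  assumes T: "0 < T" and m: "\<And>t. t \<in> {0..T} \<Longrightarrow> (\<lambda>z. h z t) \<in> borel_measurable N"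
    and c: "\<And>z. z \<in> space N \<Longrightarrow> continuous_on {0..T} (h z)"
  shows "(\<lambda>z. LINT t:{0..T}|lborel. h z t) \<in> borel_measurable N"
proof -
  define cl where "cl t = max 0 (min T t)" for t :: real
  have clT: "cl t \<in> {0..T}" for t using T by (auto simp: cl_def)
  define f where "f n p = indicator {0..T} (snd p) * h (fst p) (cl (of_int \<lfloor>real (Suc n) * snd p\<rfloor> / real (Suc n)))" for n p
  have "(\<lambda>p. indicator {0..T} (snd p) * h (fst p) (snd p)) \<in> borel_measurable (N \<Otimes>\<^sub>M lborel)"
  proof (rule borel_measurable_LIMSEQ_real)
    show "f n \<in> borel_measurable (N \<Otimes>\<^sub>M lborel)" for n
    proof -
      have "(\<lambda>p. h (fst p) (cl (of_int \<lfloor>real (Suc n) * snd p\<rfloor> / real (Suc n)))) \<in> borel_measurable (N \<Otimes>\<^sub>M lborel)"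
      proof (rule measurable_compose_countable[of "\<lambda>i p. h (fst p) (cl (of_int i / real (Suc n)))" _ _ "\<lambda>p. \<lfloor>real (Suc n) * snd p\<rfloor>"])
        show "(\<lambda>p. h (fst p) (cl (of_int i / real (Suc n)))) \<in> borel_measurable (N \<Otimes>\<^sub>M lborel)" for i :: int
          by (rule measurable_compose[OF measurable_fst m[OF clT]])
        show "(\<lambda>p. \<lfloor>real (Suc n) * snd p\<rfloor>) \<in> (N \<Otimes>\<^sub>M lborel) \<rightarrow>\<^sub>M count_space UNIV"
          by measurable
      qed
      moreover have "(\<lambda>p. indicator {0..T} (snd p) :: real) \<in> borel_measurable (N \<Otimes>\<^sub>M lborel)" by measurable
      ultimately show ?thesis unfolding f_def by (rule borel_measurable_times[rotated])
    qed
    fix p :: "'p \<times> real" assume p: "p \<in> space (N \<Otimes>\<^sub>M lborel)"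
    show "(\<lambda>n. f n p) \<longlonglongrightarrow> indicator {0..T} (snd p) * h (fst p) (snd p)"
    proof (cases "snd p \<in> {0..T}")
      case True
      have "(\<lambda>n. cl (of_int \<lfloor>real (Suc n) * snd p\<rfloor> / real (Suc n))) \<longlonglongrightarrow> cl (snd p)"
        unfolding cl_def by (intro tendsto_intros grid_tendsto)
      moreover have "cl (snd p) = snd p" using True by (auto simp: cl_def)
      ultimately have "(\<lambda>n. h (fst p) (cl (of_int \<lfloor>real (Suc n) * snd p\<rfloor> / real (Suc n)))) \<longlonglongrightarrow> h (fst p) (snd p)"
        using c[of "fst p"] p True clT
        by (intro continuous_on_tendsto_compose[of "{0..T}" "h (fst p)"]) (auto simp: space_pair_measure simp del: of_nat_Suc)
      then show ?thesis unfolding f_def using True by (simp del: of_nat_Suc)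
    qed (simp add: f_def)
  qed
  then have "(\<lambda>z. LINT t|lborel. indicator {0..T} t * h z t) \<in> borel_measurable N"
    by (intro lborel.borel_measurable_lebesgue_integral) (simp add: case_prod_unfold)
  then show ?thesis by (simp add: set_lebesgue_integral_def)
qed

lemma set_lborel_integral_continuous:
  fixes h :: "real \<Rightarrow> real"
  assumes "continuous_on {0..T} h"
  shows "(LINT t:{0..T}|lborel. h t) = integral {0..T} h"
  using borel_integrable_atLeastAtMost'[OF assms] by (rule set_borel_integral_eq_integral(2))

lemma borel_of_eq_closed: "sets (borel_of X) = sigma_sets (topspace X) {C. closedin X C}"
proof (rule antisym)
  show "sets (borel_of X) \<subseteq> sigma_sets (topspace X) {C. closedin X C}"
    unfolding sets_borel_of
  proof (rule sigma_sets_mono, rule subsetI)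
    fix U assume "U \<in> {U. openin X U}"
    then have U: "openin X U" by simp
    then have "topspace X - (topspace X - U) \<in> sigma_sets (topspace X) {C. closedin X C}"
      by (intro sigma_sets.Compl sigma_sets.Basic) auto
    then show "U \<in> sigma_sets (topspace X) {C. closedin X C}"
      using openin_subset[OF U] by (simp add: double_diff)
  qed
  show "sigma_sets (topspace X) {C. closedin X C} \<subseteq> sets (borel_of X)"
    using sets.sigma_sets_subset[of "{C. closedin X C}" "borel_of X"] closedin_borel_of by auto
qed

lemma measure_eqI_closed:
  assumes s: "sets \<mu> = sets (borel_of X)" "sets \<nu> = sets (borel_of X)"
    and fin: "emeasure \<mu> (topspace X) \<noteq> \<infinity>"
    and eq: "\<And>C. closedin X C \<Longrightarrow> emeasure \<mu> C = emeasure \<nu> C"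
  shows "\<mu> = \<nu>"
proof (rule measure_eqI_generator_eq[where E="{C. closedin X C}" and \<Omega>="topspace X" and A="\<lambda>_. topspace X"])
  show "Int_stable {C. closedin X C}" by (auto simp: Int_stable_def)
  show "{C. closedin X C} \<subseteq> Pow (topspace X)" using closedin_subset by blast
qed (use s eq fin closedin_subset in \<open>auto simp: borel_of_eq_closed\<close>)

section \<open>The plan and the coupling of the smooth solution\<close>

context hdiv
begin

abbreviation "\<rho>\<^sub>0 \<equiv> normalized_lebesgue M"
abbreviation "\<Omega> \<equiv> path_borel T x\<^sub>0 M"
abbreviation "\<gamma> \<equiv> solution_coupling T x\<^sub>0 M \<phi> lam"
abbreviation "\<mu>s \<equiv> solution_plan T x\<^sub>0 M \<phi> lam"

lemma rho_basic: "prob_space \<rho>\<^sub>0" "space \<rho>\<^sub>0 = M" "sets \<rho>\<^sub>0 = sets (restrict_space borel M)"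
proof -
  have Ms: "M \<in> sets lborel" using M(1) by (simp add: compact_imp_closed)
  have e: "emeasure (restrict_space lborel M) M = emeasure lborel M"
    using Ms by (intro emeasure_restrict_space) auto
  have "emeasure lborel M \<noteq> \<infinity>" using emeasure_compact_finite[OF M(1)] by simp
  moreover have "emeasure lborel M \<noteq> 0"
  proof
    assume "emeasure lborel M = 0"
    then have "M \<in> null_sets lborel" using Ms by auto
    then have "negligible M" by (simp add: negligible_iff_null_sets null_sets_completionI)
    moreover have "\<not> negligible M"
      using M(2) open_interior[of M] interior_subset[of M] negligible_subset open_not_negligible by metis
    ultimately show False by simp
  qed
  ultimately show "prob_space \<rho>\<^sub>0"
    unfolding normalized_lebesgue_def using e by (intro prob_space_uniform_measure) auto
  show "space \<rho>\<^sub>0 = M" by (simp add: normalized_lebesgue_def uniform_measure_def space_restrict_space)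
  show "sets \<rho>\<^sub>0 = sets (restrict_space borel M)"
    by (simp add: normalized_lebesgue_def uniform_measure_def sets_restrict_space)
qed

sublocale rho: prob_space \<rho>\<^sub>0 by (rule rho_basic)

lemma rho_measurableI: "continuous_map (top_of_set M) X f \<Longrightarrow> f \<in> \<rho>\<^sub>0 \<rightarrow>\<^sub>M borel_of X"
  using continuous_map_measurable_restrict measurable_cong_sets[OF rho_basic(3) refl] by blast

lemma rho_integrable:
  fixes g :: "'a \<Rightarrow> real"
  assumes "continuous_on M g"
  shows "g \<in> borel_measurable \<rho>\<^sub>0" "integrable \<rho>\<^sub>0 g"
proof -
  show g: "g \<in> borel_measurable \<rho>\<^sub>0"
    using rho_measurableI[of euclidean g] assms by (simp add: borel_of_euclidean)
  obtain B where "\<And>y. y \<in> g ` M \<Longrightarrow> norm y \<le> B"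
    using compact_imp_bounded[OF compact_continuous_image[OF assms M(1)]] unfolding bounded_iff by blast
  then show "integrable \<rho>\<^sub>0 g"
    using g by (intro rho.integrable_const_bound[of _ B]) (auto simp: rho_basic(2) intro!: AE_I2)
qed

lemma zs_measurable: "zs \<in> \<rho>\<^sub>0 \<rightarrow>\<^sub>M \<Omega>"
  by (rule rho_measurableI[OF zs_continuous])

definition ends :: "'a \<Rightarrow> ('a \<times> real) \<times> ('a \<times> real)" where
  "ends x = (cone_pt x\<^sub>0 (\<phi> 0 x) (lam 0 x), cone_pt x\<^sub>0 (\<phi> T x) (lam T x))"

lemma ends_eq: "x \<in> M \<Longrightarrow> ends x = (zs x 0, zs x T)"
  using T0 by (simp add: ends_def solution_path_def)

lemma ends_apply: "x \<in> M \<Longrightarrow> ends x = ((\<phi> 0 x, lam 0 x), (\<phi> T x, lam T x))"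
  using T0 by (simp add: ends_eq zs_apply)

lemma eval_pair_continuous: "continuous_map (path_top T x\<^sub>0 M) (cone2_top x\<^sub>0 M) (\<lambda>z. (z 0, z T))"
  using T0 by (intro continuous_map_pairedI continuous_map_eval)

lemma ends_continuous: "continuous_map (top_of_set M) (cone2_top x\<^sub>0 M) ends"
  using continuous_map_compose[OF zs_continuous eval_pair_continuous]
  by (rule continuous_map_eq) (simp add: ends_eq)

lemma ends_measurable: "ends \<in> \<rho>\<^sub>0 \<rightarrow>\<^sub>M borel_of (cone2_top x\<^sub>0 M)"
  by (rule rho_measurableI[OF ends_continuous])

lemma gamma_eq: "\<gamma> = distr \<rho>\<^sub>0 (borel_of (cone2_top x\<^sub>0 M)) ends"
  by (simp add: solution_coupling_def ends_def[abs_def])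

lemma mus_prob: "prob_space \<mu>s" "sets \<mu>s = sets \<Omega>" "space \<mu>s = paths T x\<^sub>0 M"
  unfolding solution_plan_def by (auto intro!: rho.prob_space_distr zs_measurable)

lemma gamma_integral:
  assumes "continuous_map (cone2_top x\<^sub>0 M) euclideanreal f"
  shows "integrable \<gamma> f" "(\<integral>p. f p \<partial>\<gamma>) = (\<integral>x. f (ends x) \<partial>\<rho>\<^sub>0)"
    "integrable \<rho>\<^sub>0 (\<lambda>x. f (ends x))"
proof -
  have fm: "f \<in> borel_measurable (borel_of (cone2_top x\<^sub>0 M))"
    by (rule continuous_map_borel_measurable[OF assms])
  have "continuous_map (top_of_set M) euclideanreal (f \<circ> ends)"
    by (rule continuous_map_compose[OF ends_continuous assms])
  then show i: "integrable \<rho>\<^sub>0 (\<lambda>x. f (ends x))" by (intro rho_integrable) (simp add: comp_def)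
  show "integrable \<gamma> f" unfolding gamma_eq using i by (simp add: integrable_distr_eq[OF ends_measurable fm])
  show "(\<integral>p. f p \<partial>\<gamma>) = (\<integral>x. f (ends x) \<partial>\<rho>\<^sub>0)"
    unfolding gamma_eq by (rule integral_distr[OF ends_measurable fm])
qed

lemma gamma_P2: "\<gamma> \<in> P2_cone2 x\<^sub>0 M"
proof -
  have c: "continuous_map (cone_top x\<^sub>0 M) euclideanreal (\<lambda>z. snd z)"
    using continuous_map_cone_radial[OF M(1) x0 continuous_on_const[of M "1::real"]] by simp
  have "continuous_map (cone2_top x\<^sub>0 M) euclideanreal (\<lambda>p. (snd (fst p))\<^sup>2 + (snd (snd p))\<^sup>2)"
    using continuous_map_compose[OF continuous_map_fst c] continuous_map_compose[OF continuous_map_snd c]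
    by (intro continuous_map_add continuous_map_real_pow) (simp_all add: comp_def)
  then have "integrable \<gamma> (\<lambda>(z, w). (snd z)\<^sup>2 + (snd w)\<^sup>2)"
    using gamma_integral(1) by (simp add: case_prod_unfold)
  then show ?thesis
    unfolding P2_cone2_def borel_probs_def gamma_eq
    by (auto intro!: rho.prob_space_distr ends_measurable)
qed

lemma mus_coupling: "homogeneous_coupling T x\<^sub>0 M \<gamma> \<mu>s"
  unfolding homogeneous_coupling_def
proof (intro allI impI)
  fix f assume "continuous_map (cone2_top x\<^sub>0 M) euclideanreal f \<and> two_homogeneous x\<^sub>0 M f"
  then have f: "continuous_map (cone2_top x\<^sub>0 M) euclideanreal f" by simp
  have fm: "(\<lambda>z. f (z 0, z T)) \<in> borel_measurable \<Omega>"
    using continuous_map_compose[OF eval_pair_continuous f] by (intro continuous_map_borel_measurable) (simp add: comp_def)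
  have e: "AE x in \<rho>\<^sub>0. f (ends x) = f (zs x 0, zs x T)" by (rule AE_I2) (simp add: rho_basic(2) ends_eq)
  have m1: "(\<lambda>x. f (zs x 0, zs x T)) \<in> borel_measurable \<rho>\<^sub>0" by (rule measurable_compose[OF zs_measurable fm])
  have "integrable \<rho>\<^sub>0 (\<lambda>x. f (zs x 0, zs x T))"
    by (rule integrable_cong_AE_imp[OF gamma_integral(3)[OF f] m1]) (use e in auto)
  moreover have "(\<integral>x. f (zs x 0, zs x T) \<partial>\<rho>\<^sub>0) = (\<integral>x. f (ends x) \<partial>\<rho>\<^sub>0)"
    by (rule integral_cong_AE[OF m1]) (use e gamma_integral(3)[OF f] in auto)
  ultimately show "integrable \<mu>s (\<lambda>z. f (z 0, z T)) \<and> (\<integral>z. f (z 0, z T) \<partial>\<mu>s) = (\<integral>p. f p \<partial>\<gamma>)"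
    unfolding solution_plan_def integrable_distr_eq[OF zs_measurable fm] integral_distr[OF zs_measurable fm]
    by (simp add: gamma_integral(2)[OF f])
qed

lemma path_integrand_measurable:
  fixes f :: "real \<times> 'a \<Rightarrow> real"
  assumes f: "continuous_on ({0..T} \<times> M) f"
  shows "(\<lambda>z. LINT t:{0..T}|lborel. f (t, fst (z t)) * (snd (z t))\<^sup>2) \<in> borel_measurable \<Omega>"
proof (rule borel_measurable_path_integral[OF T])
  fix t assume t: "t \<in> {0..T}"
  have "continuous_on M (\<lambda>x. f (t, x))"
    by (rule continuous_on_compose2[OF f]) (use t in \<open>auto intro!: continuous_intros\<close>)
  from continuous_map_cone_radial[OF M(1) x0 this]
  have "continuous_map (cone_top x\<^sub>0 M) euclideanreal (\<lambda>z. snd z * (snd z *\<^sub>R f (t, fst z)))"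
    using continuous_map_cone_radial[OF M(1) x0 continuous_on_const[of M "1::real"]]
    by (intro continuous_map_real_mult) auto
  from continuous_map_compose[OF continuous_map_eval[OF t] this]
  show "(\<lambda>z. f (t, fst (z t)) * (snd (z t))\<^sup>2) \<in> borel_measurable \<Omega>"
    by (intro continuous_map_borel_measurable) (simp add: comp_def power2_eq_square mult_ac)
next
  fix z assume "z \<in> space \<Omega>"
  then have z: "z \<in> paths T x\<^sub>0 M" by simp
  have "continuous_on ({0..T} \<times> M) (\<lambda>(t, x). f (t, x))" using f by simp
  then show "continuous_on {0..T} (\<lambda>t. f (t, fst (z t)) * (snd (z t))\<^sup>2)"
    using M(1) path_components_continuous[OF z M(1) x0] pathsD[OF z x0]
    by (intro continuous_on_potential[of _ M "\<lambda>t x. f (t, x)"]) auto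
qed

lemma rho_Fubini:
  fixes g :: "real \<times> 'a \<Rightarrow> real"
  assumes g: "continuous_on ({0..T} \<times> M) g"
  shows "(\<integral>x. (LINT t:{0..T}|lborel. g (t, x)) \<partial>\<rho>\<^sub>0) = (LINT t:{0..T}|lborel. (\<integral>x. g (t, x) \<partial>\<rho>\<^sub>0))"
    and "integrable \<rho>\<^sub>0 (\<lambda>x. LINT t:{0..T}|lborel. g (t, x))"
proof -
  interpret pair_sigma_finite \<rho>\<^sub>0 lborel ..
  define G where "G p = indicator ({0..T} \<times> M) p *\<^sub>R g p" for p
  have cp: "compact ({0..T} \<times> M)" by (intro compact_Times M) simp
  have G: "G \<in> borel_measurable borel"
    unfolding G_def by (rule borel_measurable_continuous_on_indicator[OF _ g]) (simp add: compact_imp_closed[OF cp])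
  have id: "(\<lambda>x. x) \<in> \<rho>\<^sub>0 \<rightarrow>\<^sub>M borel"
    using measurable_cong_sets[OF rho_basic(3) refl] measurable_restrict_space1[OF measurable_ident] by (metis id_def measurable_ident_sets sets_restrict_space measurable_restrict_space1 measurable_ident)
  have "(\<lambda>p. (snd p, fst p)) \<in> \<rho>\<^sub>0 \<Otimes>\<^sub>M lborel \<rightarrow>\<^sub>M borel \<Otimes>\<^sub>M borel"
    by (intro measurable_Pair) (auto intro: measurable_compose[OF measurable_fst id] measurable_compose[OF measurable_snd])
  then have "(\<lambda>p. (snd p, fst p)) \<in> \<rho>\<^sub>0 \<Otimes>\<^sub>M lborel \<rightarrow>\<^sub>M borel" by (simp add: borel_prod)
  then have Gm: "(\<lambda>p. G (snd p, fst p)) \<in> borel_measurable (\<rho>\<^sub>0 \<Otimes>\<^sub>M lborel)" using G by (rule measurable_compose)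
  obtain B where B: "\<And>p. p \<in> {0..T} \<times> M \<Longrightarrow> norm (g p) \<le> B"
    using compact_imp_bounded[OF compact_continuous_image[OF g cp]] unfolding bounded_iff by blast
  have i: "integrable (\<rho>\<^sub>0 \<Otimes>\<^sub>M lborel) (\<lambda>p. G (snd p, fst p))"
  proof (rule integrableI_bounded_set[of "space \<rho>\<^sub>0 \<times> {0..T}" _ _ B])
    show "space \<rho>\<^sub>0 \<times> {0..T} \<in> sets (\<rho>\<^sub>0 \<Otimes>\<^sub>M lborel)" by auto
    have "emeasure (\<rho>\<^sub>0 \<Otimes>\<^sub>M lborel) (space \<rho>\<^sub>0 \<times> {0..T}) = emeasure \<rho>\<^sub>0 (space \<rho>\<^sub>0) * emeasure lborel {0..T}"
      by (rule lborel.emeasure_pair_measure_Times) auto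
    then show "emeasure (\<rho>\<^sub>0 \<Otimes>\<^sub>M lborel) (space \<rho>\<^sub>0 \<times> {0..T}) < \<infinity>"
      using T by (simp add: rho.emeasure_space_1)
    show "AE p in \<rho>\<^sub>0 \<Otimes>\<^sub>M lborel. p \<in> space \<rho>\<^sub>0 \<times> {0..T} \<longrightarrow> norm (G (snd p, fst p)) \<le> B"
      using B by (intro AE_I2) (auto simp: G_def rho_basic(2))
    show "AE p in \<rho>\<^sub>0 \<Otimes>\<^sub>M lborel. p \<notin> space \<rho>\<^sub>0 \<times> {0..T} \<longrightarrow> G (snd p, fst p) = 0"
      by (intro AE_I2) (auto simp: G_def rho_basic(2) indicator_def)
  qed (rule Gm)
  have eq: "(LINT t:{0..T}|lborel. g (t, x)) = (\<integral>t. G (t, x) \<partial>lborel)" if "x \<in> M" for x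
    unfolding set_lebesgue_integral_def using that by (intro Bochner_Integration.integral_cong) (auto simp: G_def indicator_def)
  have eq2: "(\<integral>x. G (t, x) \<partial>\<rho>\<^sub>0) = indicator {0..T} t *\<^sub>R (\<integral>x. g (t, x) \<partial>\<rho>\<^sub>0)" for t
  proof -
    have "(\<integral>x. G (t, x) \<partial>\<rho>\<^sub>0) = (\<integral>x. indicator {0..T} t *\<^sub>R g (t, x) \<partial>\<rho>\<^sub>0)"
      by (intro Bochner_Integration.integral_cong) (auto simp: G_def indicator_def rho_basic(2))
    then show ?thesis by simp
  qed
  have i': "integrable (\<rho>\<^sub>0 \<Otimes>\<^sub>M lborel) (case_prod (\<lambda>x t. G (t, x)))"
    using i by (simp add: case_prod_unfold)
  have "(\<integral>x. (LINT t:{0..T}|lborel. g (t, x)) \<partial>\<rho>\<^sub>0) = (\<integral>x. (\<integral>t. G (t, x) \<partial>lborel) \<partial>\<rho>\<^sub>0)"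
    by (intro Bochner_Integration.integral_cong) (auto simp: eq rho_basic(2))
  also have "\<dots> = (\<integral>t. (\<integral>x. G (t, x) \<partial>\<rho>\<^sub>0) \<partial>lborel)"
    using Fubini_integral[OF i'] by simp
  also have "\<dots> = (LINT t:{0..T}|lborel. (\<integral>x. g (t, x) \<partial>\<rho>\<^sub>0))"
    unfolding set_lebesgue_integral_def by (simp add: eq2)
  finally show "(\<integral>x. (LINT t:{0..T}|lborel. g (t, x)) \<partial>\<rho>\<^sub>0) = (LINT t:{0..T}|lborel. (\<integral>x. g (t, x) \<partial>\<rho>\<^sub>0))" .
  have "integrable \<rho>\<^sub>0 (\<lambda>x. \<integral>t. G (t, x) \<partial>lborel)"
    by (rule integrable_fst[OF i'])
  then show "integrable \<rho>\<^sub>0 (\<lambda>x. LINT t:{0..T}|lborel. g (t, x))"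
    by (rule Bochner_Integration.integrable_cong[THEN iffD1, rotated 2]) (auto simp: eq rho_basic(2))
qed

text \<open>Fubini brings the time integral outside. At each single time the identity is the
  assumption that \<phi> t pushes the measure with density lam^2 forward to the normalized Lebesgue
  measure.\<close>

lemma mus_marginal: "homogeneous_marginal T M \<mu>s"
  unfolding homogeneous_marginal_def
proof (intro allI impI)
  fix f :: "real \<times> 'a \<Rightarrow> real" assume f: "continuous_on ({0..T} \<times> M) f"
  define F where "F z = (LINT t:{0..T}|lborel. f (t, fst (z t)) * (snd (z t))\<^sup>2)" for z :: "real \<Rightarrow> 'a \<times> real"
  have Fm: "F \<in> borel_measurable \<Omega>" unfolding F_def by (rule path_integrand_measurable[OF f])
  define g where "g p = f (fst p, \<phi> (fst p) (snd p)) * (lam (fst p) (snd p))\<^sup>2" for p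
  have pc: "continuous_on ({0..T} \<times> M) (\<lambda>p. \<phi> (fst p) (snd p))" "continuous_on ({0..T} \<times> M) (\<lambda>p. lam (fst p) (snd p))"
    using cont(1,2) by (simp_all add: case_prod_unfold)
  have g: "continuous_on ({0..T} \<times> M) g"
    unfolding g_def
    by (intro continuous_on_mult continuous_on_power pc continuous_on_compose2[OF f] continuous_on_Pair continuous_on_fst continuous_on_id)
       (auto intro: phiM)
  have Fz: "F (zs x) = (LINT t:{0..T}|lborel. g (t, x))" if "x \<in> M" for x
    unfolding F_def using that by (intro set_lebesgue_integral_cong) (auto simp: zs_apply g_def)
  have slice: "(\<integral>x. g (t, x) \<partial>\<rho>\<^sub>0) = (\<integral>x. f (t, x) \<partial>\<rho>\<^sub>0)" if t: "t \<in> {0..T}" for t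
  proof -
    have pm: "\<phi> t \<in> \<rho>\<^sub>0 \<rightarrow>\<^sub>M \<rho>\<^sub>0"
    proof -
      have "\<phi> t \<in> \<rho>\<^sub>0 \<rightarrow>\<^sub>M borel"
        using rho_measurableI[of euclidean "\<phi> t"] continuous_on_slices(1)[OF cont(1) t] by (simp add: borel_of_euclidean)
      then have "\<phi> t \<in> \<rho>\<^sub>0 \<rightarrow>\<^sub>M restrict_space borel M"
        using phiM[OF t] by (intro measurable_restrict_space2) (auto simp: rho_basic(2))
      then show ?thesis using measurable_cong_sets[OF refl rho_basic(3)] by blast
    qed
    have lm: "(\<lambda>x. (lam t x)\<^sup>2) \<in> borel_measurable \<rho>\<^sub>0"
      using continuous_on_slices(1)[OF cont(2) t] by (intro rho_integrable continuous_intros)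
    have fm: "(\<lambda>x. f (t, x)) \<in> borel_measurable \<rho>\<^sub>0"
      by (rule rho_integrable, rule continuous_on_compose2[OF f]) (use t in \<open>auto intro!: continuous_intros\<close>)
    have "(\<integral>x. f (t, x) \<partial>\<rho>\<^sub>0) = (\<integral>x. f (t, x) \<partial>(distr (density \<rho>\<^sub>0 (\<lambda>x. ennreal ((lam t x)\<^sup>2))) \<rho>\<^sub>0 (\<phi> t)))"
      by (simp add: diffeo(4)[OF t])
    also have "\<dots> = (\<integral>x. f (t, \<phi> t x) \<partial>(density \<rho>\<^sub>0 (\<lambda>x. ennreal ((lam t x)\<^sup>2))))"
      using pm fm by (intro integral_distr) (auto simp: measurable_cong_sets[OF sets_density refl])
    also have "\<dots> = (\<integral>x. (lam t x)\<^sup>2 *\<^sub>R f (t, \<phi> t x) \<partial>\<rho>\<^sub>0)"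
      using measurable_compose[OF pm fm] lm by (intro integral_density) auto
    also have "\<dots> = (\<integral>x. g (t, x) \<partial>\<rho>\<^sub>0)" by (simp add: g_def mult.commute)
    finally show ?thesis by simp
  qed
  have "integrable \<rho>\<^sub>0 (\<lambda>x. F (zs x))"
    using rho_Fubini(2)[OF g] by (rule Bochner_Integration.integrable_cong[THEN iffD1, rotated 2]) (auto simp: Fz rho_basic(2))
  moreover have "(\<integral>x. F (zs x) \<partial>\<rho>\<^sub>0) = (\<integral>x. (LINT t:{0..T}|lborel. f (t, x)) \<partial>\<rho>\<^sub>0)"
  proof -
    have "(\<integral>x. F (zs x) \<partial>\<rho>\<^sub>0) = (\<integral>x. (LINT t:{0..T}|lborel. g (t, x)) \<partial>\<rho>\<^sub>0)"
      by (intro Bochner_Integration.integral_cong) (auto simp: Fz rho_basic(2))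
    also have "\<dots> = (LINT t:{0..T}|lborel. (\<integral>x. g (t, x) \<partial>\<rho>\<^sub>0))" by (rule rho_Fubini(1)[OF g])
    also have "\<dots> = (LINT t:{0..T}|lborel. (\<integral>x. f (t, x) \<partial>\<rho>\<^sub>0))"
      by (intro set_lebesgue_integral_cong) (auto simp: slice)
    also have "\<dots> = (\<integral>x. (LINT t:{0..T}|lborel. f (t, x)) \<partial>\<rho>\<^sub>0)" by (rule rho_Fubini(1)[OF f, symmetric])
    finally show ?thesis .
  qed
  ultimately have "integrable \<mu>s F \<and> (\<integral>z. F z \<partial>\<mu>s) = (\<integral>x. (LINT t:{0..T}|lborel. f (t, x)) \<partial>\<rho>\<^sub>0)"
    unfolding solution_plan_def integrable_distr_eq[OF zs_measurable Fm] integral_distr[OF zs_measurable Fm] by simp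
  then show "integrable \<mu>s (\<lambda>z. LINT t:{0..T}|lborel. f (t, fst (z t)) * (snd (z t))\<^sup>2) \<and>
     (\<integral>z. (LINT t:{0..T}|lborel. f (t, fst (z t)) * (snd (z t))\<^sup>2) \<partial>\<mu>s) = (\<integral>x. (LINT t:{0..T}|lborel. f (t, x)) \<partial>\<rho>\<^sub>0)"
    unfolding F_def .
qed

lemma mus_feasible: "feasible_plan T x\<^sub>0 M \<gamma> \<mu>s"
  unfolding feasible_plan_def borel_probs_def using mus_prob mus_coupling mus_marginal by auto

section \<open>Test functions for the homogeneous coupling\<close>

lemma radial0_continuous:
  fixes k :: "'a \<Rightarrow> 'b::real_normed_vector"
  assumes "continuous_on M k"
  shows "continuous_map (cone2_top x\<^sub>0 M) euclidean (\<lambda>p. snd (fst p) *\<^sub>R k (fst (fst p)))"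
    "continuous_map (cone2_top x\<^sub>0 M) euclidean (\<lambda>p. snd (snd p) *\<^sub>R k (fst (snd p)))"
  using continuous_map_compose[OF continuous_map_fst continuous_map_cone_radial[OF M(1) x0 assms]]
    continuous_map_compose[OF continuous_map_snd continuous_map_cone_radial[OF M(1) x0 assms]]
  by (simp_all add: comp_def)

lemma quadratic_continuous:
  fixes k :: "'a \<Rightarrow> real"
  assumes "continuous_on M k"
  shows "continuous_map (cone2_top x\<^sub>0 M) euclideanreal (\<lambda>p. (snd (fst p))\<^sup>2 * k (fst (fst p)))"
proof -
  have "continuous_map (cone2_top x\<^sub>0 M) euclideanreal (\<lambda>p. snd (fst p) * (snd (fst p) *\<^sub>R k (fst (fst p))))"
    using radial0_continuous(1)[OF continuous_on_const[of M "1::real"]] radial0_continuous(1)[OF assms]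
    by (intro continuous_map_real_mult) auto
  then show ?thesis by (simp add: power2_eq_square mult.assoc)
qed

text \<open>The factor r^2 makes the test function 2-homogeneous and at the same time continuous at
  the apex, whatever continuous k is. Through this lemma the law of the initial point, weighted by
  its squared radius, is the same for all admissible plans.\<close>

lemma coupling_quadratic:
  fixes k :: "'a \<Rightarrow> real"
  assumes \<nu>: "homogeneous_coupling T x\<^sub>0 M \<gamma> \<nu>" and k: "continuous_on M k"
  shows "integrable \<nu> (\<lambda>z. (snd (z 0))\<^sup>2 * k (fst (z 0)))"
    "(\<integral>z. (snd (z 0))\<^sup>2 * k (fst (z 0)) \<partial>\<nu>) = (\<integral>x. (lam 0 x)\<^sup>2 * k (\<phi> 0 x) \<partial>\<rho>\<^sub>0)"
proof -
  define f :: "('a \<times> real) \<times> ('a \<times> real) \<Rightarrow> real" where "f p = (snd (fst p))\<^sup>2 * k (fst (fst p))" for p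
  have f: "continuous_map (cone2_top x\<^sub>0 M) euclideanreal f"
    unfolding f_def by (rule quadratic_continuous[OF k])
  have h: "two_homogeneous x\<^sub>0 M f"
    by (simp add: two_homogeneous_def f_def cone_scale_def power_mult_distrib)
  have 1: "integrable \<nu> (\<lambda>z. f (z 0, z T))" "(\<integral>z. f (z 0, z T) \<partial>\<nu>) = (\<integral>p. f p \<partial>\<gamma>)"
    using \<nu> f h unfolding homogeneous_coupling_def by blast+
  show "integrable \<nu> (\<lambda>z. (snd (z 0))\<^sup>2 * k (fst (z 0)))" using 1(1) by (simp add: f_def)
  have "(\<integral>z. (snd (z 0))\<^sup>2 * k (fst (z 0)) \<partial>\<nu>) = (\<integral>x. f (ends x) \<partial>\<rho>\<^sub>0)"
    using 1(2) gamma_integral(2)[OF f] by (simp add: f_def)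
  also have "\<dots> = (\<integral>x. (lam 0 x)\<^sup>2 * k (\<phi> 0 x) \<partial>\<rho>\<^sub>0)"
    by (intro Bochner_Integration.integral_cong) (auto simp: rho_basic(2) ends_apply f_def)
  finally show "(\<integral>z. (snd (z 0))\<^sup>2 * k (fst (z 0)) \<partial>\<nu>) = (\<integral>x. (lam 0 x)\<^sup>2 * k (\<phi> 0 x) \<partial>\<rho>\<^sub>0)" .
qed

lemma lam_psi_continuous:
  assumes "t \<in> {0..T}"
  shows "continuous_on M (\<lambda>x. lam t (psi x))" "continuous_on M (\<lambda>x. lam1 t (psi x))" "continuous_on M (\<lambda>x. \<phi> t (psi x))"
  using continuous_on_slices(1)[OF cont(2) assms] continuous_on_slices(1)[OF lam_deriv(1) assms] continuous_on_slices(1)[OF cont(1) assms]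
  by (auto intro!: continuous_on_compose2[OF _ psi_cont] psi)

lemma lam_psi_nonzero: "t \<in> {0..T} \<Longrightarrow> x \<in> M \<Longrightarrow> lam t (psi x) \<noteq> 0"
  using diffeo(3)[of t "psi x"] psi(1) by fastforce

lemma kin_continuous: "continuous_on M kin" and ratio_continuous: "continuous_on M ratio"
  unfolding kin_def[abs_def] ratio_def[abs_def] using T0 lam_psi_nonzero
  by (auto intro!: continuous_intros lam_psi_continuous)

lemma sig_continuous: "continuous_map (path_top T x\<^sub>0 M) euclideanreal sig"
proof -
  have "continuous_on M (\<lambda>x. 1 / lam 0 (psi x))"
    using T0 lam_psi_nonzero by (intro continuous_intros lam_psi_continuous) auto
  from continuous_map_compose[OF continuous_map_eval[OF T0(1)] continuous_map_cone_radial[OF M(1) x0 this]]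
  show ?thesis by (simp add: comp_def sig_def[abs_def] xi_def)
qed

lemma gapf_measurable:
  assumes t: "t \<in> {0..T}"
  shows "(\<lambda>z. gapf z t) \<in> borel_measurable \<Omega>"
proof -
  define F where "F z = cone_pt x\<^sub>0 (\<phi> t (xi z)) (sig z * lam t (xi z))" for z
  have s: "snd (F z) = snd (z 0) *\<^sub>R (lam t (psi (fst (z 0))) / lam 0 (psi (fst (z 0))))"
    "snd (F z) *\<^sub>R fst (F z) = snd (z 0) *\<^sub>R ((lam t (psi (fst (z 0))) / lam 0 (psi (fst (z 0)))) *\<^sub>R \<phi> t (psi (fst (z 0))))" for z
    by (auto simp: F_def cone_pt_def sig_def xi_def)
  have k: "continuous_on M (\<lambda>x. lam t (psi x) / lam 0 (psi x))"
    using t T0 lam_psi_nonzero by (intro continuous_intros lam_psi_continuous) auto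
  note cr = continuous_map_compose[OF continuous_map_eval[OF T0(1)] continuous_map_cone_radial[OF M(1) x0]]
  have "continuous_map (path_top T x\<^sub>0 M) (cone_top x\<^sub>0 M) F"
  proof (rule continuous_map_into_cone[OF compact_imp_bounded[OF M(1)] x0])
    show "F z \<in> cone x\<^sub>0 M" if "z \<in> topspace (path_top T x\<^sub>0 M)" for z
    proof -
      have z: "z \<in> paths T x\<^sub>0 M" using that by simp
      show ?thesis
        unfolding F_def using path0[OF z] diffeo(3)[OF t path0(2)[OF z]] phiM[OF t path0(2)[OF z]]
        by (intro cone_pt_in_cone) auto
    qed
    show "continuous_map (path_top T x\<^sub>0 M) euclidean (\<lambda>z. snd (F z))"
      unfolding s(1) using continuous_map_compose[OF continuous_map_eval[OF T0(1)] continuous_map_cone_radial[OF M(1) x0 k]]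
      by (simp add: comp_def)
    show "continuous_map (path_top T x\<^sub>0 M) euclidean (\<lambda>z. snd (F z) *\<^sub>R fst (F z))"
      unfolding s(2)
      using continuous_map_compose[OF continuous_map_eval[OF T0(1)]
          continuous_map_cone_radial[OF M(1) x0 continuous_on_scaleR[OF k lam_psi_continuous(3)[OF t]]]]
      by (simp add: comp_def)
  qed
  from continuous_map_mdist[OF continuous_map_eval[OF t] this]
  have "continuous_map (path_top T x\<^sub>0 M) euclideanreal (\<lambda>z. (cone_dist (z t) (F z))\<^sup>2)"
    by (intro continuous_map_real_pow) simp
  then show ?thesis
    by (intro continuous_map_borel_measurable) (simp add: gapf_def F_def cone_dist_cone_pt)
qed

text \<open>Truncation at 1 makes the gap integrable for every probability measure and keeps its
  zero set, which is all that the equality case asks for.\<close>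

definition gap_total :: "(real \<Rightarrow> 'a \<times> real) \<Rightarrow> real" where
  "gap_total z = min 1 (integral {0..T} (gapf z) / (2 * T\<^sup>2))"

lemma gap_total_measurable: "gap_total \<in> borel_measurable \<Omega>"
proof -
  have "(\<lambda>z. LINT t:{0..T}|lborel. gapf z t) \<in> borel_measurable \<Omega>"
    by (rule borel_measurable_path_integral[OF T gapf_measurable gapf_continuous]) auto
  then have "(\<lambda>z. min 1 ((LINT t:{0..T}|lborel. gapf z t) / (2 * T\<^sup>2))) \<in> borel_measurable \<Omega>" by measurable
  then show ?thesis
    by (rule measurable_cong[THEN iffD1, rotated]) (simp add: gap_total_def set_lborel_integral_continuous gapf_continuous)
qed

lemma gap_total_nonneg: "z \<in> paths T x\<^sub>0 M \<Longrightarrow> 0 \<le> gap_total z"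
  unfolding gap_total_def using gapf_continuous
  by (auto intro!: divide_nonneg_nonneg integral_nonneg integrable_continuous_real simp: gapf_def)

text \<open>The common value of the part of the lower bound that the constraints determine: the
  coupling fixes the first integral, the marginal condition the second.\<close>

definition cost :: real where
  "cost = (\<integral>x. (lam 0 x)\<^sup>2 * kin (\<phi> 0 x) \<partial>\<rho>\<^sub>0) + (\<integral>x. (LINT t:{0..T}|lborel. P t x) \<partial>\<rho>\<^sub>0)"

definition reduced :: "(real \<Rightarrow> 'a \<times> real) \<Rightarrow> real" where
  "reduced z = (snd (z 0))\<^sup>2 * kin (fst (z 0)) + pot z"

section \<open>The lower bound for an arbitrary admissible plan\<close>

context
  fixes \<nu> assumes feas: "feasible_plan T x\<^sub>0 M \<gamma> \<nu>"
begin

lemma feasD: "prob_space \<nu>" "sets \<nu> = sets \<Omega>" "space \<nu> = paths T x\<^sub>0 M"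
    "homogeneous_coupling T x\<^sub>0 M \<gamma> \<nu>" "homogeneous_marginal T M \<nu>"
proof -
  show "prob_space \<nu>" "homogeneous_coupling T x\<^sub>0 M \<gamma> \<nu>" "homogeneous_marginal T M \<nu>"
    using feas by (auto simp: feasible_plan_def borel_probs_def)
  show s: "sets \<nu> = sets \<Omega>" using feas by (auto simp: feasible_plan_def borel_probs_def)
  show "space \<nu> = paths T x\<^sub>0 M" using sets_eq_imp_space_eq[OF s] by simp
qed

text \<open>Each summand of \<open>reduced\<close> is a test function for one of the constraints:
  r^2 \<open>kin\<close> at time 0 for the coupling, and P, as a continuous function on [0, T] x M,
  for the marginal.\<close>

lemma reduced_integral: "integrable \<nu> reduced" "(\<integral>z. reduced z \<partial>\<nu>) = cost"
proof -
  have P': "continuous_on ({0..T} \<times> M) (\<lambda>p. P (fst p) (snd p))" using cont(3) by (simp add: case_prod_unfold)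
  have i: "integrable \<nu> (\<lambda>z. LINT t:{0..T}|lborel. P t (fst (z t)) * (snd (z t))\<^sup>2)"
    "(\<integral>z. (LINT t:{0..T}|lborel. P t (fst (z t)) * (snd (z t))\<^sup>2) \<partial>\<nu>) = (\<integral>x. (LINT t:{0..T}|lborel. P t x) \<partial>\<rho>\<^sub>0)"
    using feasD(5)[unfolded homogeneous_marginal_def, rule_format, OF P'] by simp_all
  have e: "(LINT t:{0..T}|lborel. P t (fst (z t)) * (snd (z t))\<^sup>2) = pot z" if "z \<in> space \<nu>" for z
    unfolding pot_def using that feasD(3) pot_continuous by (intro set_lborel_integral_continuous) auto
  have p: "integrable \<nu> pot" "(\<integral>z. pot z \<partial>\<nu>) = (\<integral>x. (LINT t:{0..T}|lborel. P t x) \<partial>\<rho>\<^sub>0)"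
  proof -
    have "integrable \<nu> pot \<longleftrightarrow> integrable \<nu> (\<lambda>z. LINT t:{0..T}|lborel. P t (fst (z t)) * (snd (z t))\<^sup>2)"
      by (intro Bochner_Integration.integrable_cong refl e[symmetric])
    moreover have "(\<integral>z. pot z \<partial>\<nu>) = (\<integral>z. (LINT t:{0..T}|lborel. P t (fst (z t)) * (snd (z t))\<^sup>2) \<partial>\<nu>)"
      by (intro Bochner_Integration.integral_cong refl e[symmetric])
    ultimately show "integrable \<nu> pot" "(\<integral>z. pot z \<partial>\<nu>) = (\<integral>x. (LINT t:{0..T}|lborel. P t x) \<partial>\<rho>\<^sub>0)"
      using i by simp_all
  qed
  note k = coupling_quadratic[OF feasD(4) kin_continuous]
  show "integrable \<nu> reduced" unfolding reduced_def using k(1) p(1) by (rule Bochner_Integration.integrable_add)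
  show "(\<integral>z. reduced z \<partial>\<nu>) = cost"
    unfolding reduced_def cost_def using k p by (simp add: Bochner_Integration.integral_add)
qed

text \<open>The squared defect of both equations in \<open>supported\<close> is a nonnegative,
  continuous and 2-homogeneous function of the endpoints. It vanishes on the endpoints of every
  solution path, so the coupling gives it integral 0 and it is 0 almost surely.\<close>

lemma supported_AE: "AE z in \<nu>. supported z"
proof -
  define f :: "('a \<times> real) \<times> ('a \<times> real) \<Rightarrow> real" where
    "f p = (norm (snd (snd p) *\<^sub>R fst (snd p) - snd (fst p) *\<^sub>R (ratio (fst (fst p)) *\<^sub>R \<phi> T (psi (fst (fst p))))))\<^sup>2
      + (snd (snd p) - snd (fst p) * ratio (fst (fst p)))\<^sup>2" for p
  have f: "continuous_map (cone2_top x\<^sub>0 M) euclideanreal f"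
    unfolding f_def
    using radial0_continuous(2)[OF continuous_on_id] radial0_continuous(2)[OF continuous_on_const[of M "1::real"]]
      radial0_continuous(1)[OF continuous_on_scaleR[OF ratio_continuous lam_psi_continuous(3)[OF T0(2)]]]
      radial0_continuous(1)[OF ratio_continuous]
    by (intro continuous_map_add continuous_map_real_pow continuous_map_norm continuous_map_diff) auto
  have h: "two_homogeneous x\<^sub>0 M f"
    unfolding two_homogeneous_def
  proof (intro ballI allI impI)
    fix z w and c :: real assume c: "0 < c"
    have "f (cone_scale c z, cone_scale c w) = (norm (c *\<^sub>R (snd w *\<^sub>R fst w - snd z *\<^sub>R (ratio (fst z) *\<^sub>R \<phi> T (psi (fst z))))))\<^sup>2
      + (c * (snd w - snd z * ratio (fst z)))\<^sup>2"
      by (simp add: f_def cone_scale_def scaleR_right_diff_distrib right_diff_distrib mult.assoc)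
    also have "\<dots> = c\<^sup>2 * f (z, w)"
      by (simp only: norm_scaleR power_mult_distrib power2_abs) (simp add: f_def distrib_left)
    finally show "f (cone_scale c z, cone_scale c w) = c\<^sup>2 * f (z, w)" .
  qed
  have 1: "integrable \<nu> (\<lambda>z. f (z 0, z T))" "(\<integral>z. f (z 0, z T) \<partial>\<nu>) = (\<integral>p. f p \<partial>\<gamma>)"
    using feasD(4) f h unfolding homogeneous_coupling_def by blast+
  have "(\<integral>p. f p \<partial>\<gamma>) = (\<integral>x. f (ends x) \<partial>\<rho>\<^sub>0)" by (rule gamma_integral(2)[OF f])
  also have "\<dots> = (\<integral>x. 0 \<partial>\<rho>\<^sub>0)"
  proof (intro Bochner_Integration.integral_cong refl)
    fix x assume "x \<in> space \<rho>\<^sub>0"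
    then have x: "x \<in> M" by (simp add: rho_basic(2))
    then show "f (ends x) = 0"
      using diffeo(3)[OF T0(1) x] by (simp add: ends_apply f_def ratio_def psi)
  qed
  finally have "(\<integral>z. f (z 0, z T) \<partial>\<nu>) = 0" using 1(2) by simp
  then have "AE z in \<nu>. f (z 0, z T) = 0"
    using integral_nonneg_eq_0_iff_AE[OF 1(1)] by (auto simp: f_def)
  then show ?thesis
  proof eventually_elim
    case (elim z)
    then show ?case
      unfolding f_def fst_conv snd_conv sum_power2_eq_zero_iff norm_eq_zero right_minus_eq supported_def by blast
  qed
qed

text \<open>The path-wise bound is integrated. The action of a path enters only through monotonicity
  of the nonnegative integral, so its measurability is never at issue; the left-hand side is first
  made nonnegative to pass to that integral.\<close>

lemma action_bound: "ennreal (cost + (\<integral>z. gap_total z \<partial>\<nu>)) \<le> plan_action T x\<^sub>0 M \<nu>"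
proof -
  interpret prob_space \<nu> by (rule feasD)
  have gm: "gap_total \<in> borel_measurable \<nu>" using gap_total_measurable measurable_cong_sets[OF feasD(2) refl] by blast
  have gi: "integrable \<nu> gap_total"
  proof (rule integrable_const_bound[of _ 1])
    show "AE z in \<nu>. norm (gap_total z) \<le> 1"
    proof (rule AE_I2)
      fix z assume "z \<in> space \<nu>"
      then have "0 \<le> gap_total z" using gap_total_nonneg by (simp add: feasD)
      moreover have "gap_total z \<le> 1" by (simp add: gap_total_def)
      ultimately show "norm (gap_total z) \<le> 1" by simp
    qed
  qed (rule gm)
  have i: "integrable \<nu> (\<lambda>z. reduced z + gap_total z)" using reduced_integral(1) gi by (rule Bochner_Integration.integrable_add)
  have "cost + (\<integral>z. gap_total z \<partial>\<nu>) = (\<integral>z. reduced z + gap_total z \<partial>\<nu>)"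
    using reduced_integral gi by (simp add: Bochner_Integration.integral_add)
  also have "\<dots> \<le> (\<integral>z. max 0 (reduced z + gap_total z) \<partial>\<nu>)" using i by (intro integral_mono) auto
  finally have "ennreal (cost + (\<integral>z. gap_total z \<partial>\<nu>)) \<le> ennreal (\<integral>z. max 0 (reduced z + gap_total z) \<partial>\<nu>)"
    by (rule ennreal_leI)
  also have "\<dots> = (\<integral>\<^sup>+z. ennreal (max 0 (reduced z + gap_total z)) \<partial>\<nu>)"
    using i by (intro nn_integral_eq_integral[symmetric]) auto
  also have "\<dots> \<le> (\<integral>\<^sup>+z. path_action T x\<^sub>0 M z \<partial>\<nu>)"
  proof (rule nn_integral_mono_AE)
    show "AE z in \<nu>. ennreal (max 0 (reduced z + gap_total z)) \<le> path_action T x\<^sub>0 M z"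
      using supported_AE AE_space
    proof eventually_elim
      case (elim z)
      then have z: "z \<in> paths T x\<^sub>0 M" by (simp add: feasD)
      have "ennreal (max 0 (reduced z + gap_total z)) = ennreal (reduced z + gap_total z)"
        by (simp add: max_def ennreal_neg)
      also have "\<dots> \<le> ennreal ((snd (z 0))\<^sup>2 * kin (fst (z 0)) + pot z + integral {0..T} (gapf z) / (2 * T\<^sup>2))"
        by (intro ennreal_leI) (simp add: reduced_def gap_total_def)
      also have "\<dots> \<le> path_action T x\<^sub>0 M z" by (rule action_lower_bound[OF z elim(1)])
      finally show ?case .
    qed
  qed
  finally show ?thesis by (simp add: plan_action_def)
qed

end

section \<open>Optimality of the solution plan and the equality case\<close>

lemma mus_AE: "AE z in \<mu>s. z \<in> zs ` M"
proof -
  interpret Metric_space "paths T x\<^sub>0 M" "mdist (path_space T x\<^sub>0 M)" by (rule Metric_space_mspace_mdist)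
  \<comment> \<open>The continuous image of the compact set M is closed, hence Borel, which allows
    the statement to be checked on M before the push-forward.\<close>
  have "compactin (path_top T x\<^sub>0 M) (zs ` M)"
    using image_compactin[OF _ zs_continuous, of M] M(1) by (simp add: compactin_subtopology)
  then have "closedin (path_top T x\<^sub>0 M) (zs ` M)"
    unfolding mtopology_of_def by (rule compactin_imp_closedin[OF Hausdorff_space_mtopology])
  then have s: "{z \<in> space \<Omega>. z \<in> zs ` M} \<in> sets \<Omega>"
  proof -
    assume C: "closedin (path_top T x\<^sub>0 M) (zs ` M)"
    then have "{z \<in> space \<Omega>. z \<in> zs ` M} = zs ` M" using closedin_subset[OF C] by auto
    then show ?thesis using closedin_borel_of[OF C] by simp
  qed
  show ?thesis
    unfolding solution_plan_def
    by (subst AE_distr_iff[OF zs_measurable s]) (auto simp: rho_basic(2) intro!: AE_I2)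
qed

text \<open>On solution paths the action equals \<open>reduced\<close>, so the solution plan attains
  the value that every admissible plan has as a lower bound.\<close>

lemma mus_action: "plan_action T x\<^sub>0 M \<mu>s = ennreal cost" "0 \<le> cost"
proof -
  have ae: "AE z in \<mu>s. path_action T x\<^sub>0 M z = ennreal (reduced z) \<and> 0 \<le> reduced z"
    using mus_AE by eventually_elim (auto simp: reduced_def solution_path_facts)
  have "plan_action T x\<^sub>0 M \<mu>s = (\<integral>\<^sup>+z. ennreal (reduced z) \<partial>\<mu>s)"
    unfolding plan_action_def using ae by (intro nn_integral_cong_AE) auto
  also have "\<dots> = ennreal cost"
    using reduced_integral[OF mus_feasible] ae by (subst nn_integral_eq_integral) auto
  finally show "plan_action T x\<^sub>0 M \<mu>s = ennreal cost" .
  show "0 \<le> cost"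
    unfolding reduced_integral(2)[OF mus_feasible, symmetric] using ae by (intro integral_nonneg_AE) auto
qed

lemma gap_integral_nonneg: "feasible_plan T x\<^sub>0 M \<gamma> \<nu> \<Longrightarrow> 0 \<le> (\<integral>z. gap_total z \<partial>\<nu>)"
  by (intro integral_nonneg_AE AE_I2) (simp add: feasD gap_total_nonneg)

lemma mus_minimizer: "generalized_Hdiv_minimizer T x\<^sub>0 M \<gamma> \<mu>s"
  unfolding generalized_Hdiv_minimizer_def
proof (intro conjI allI impI gamma_P2 mus_feasible)
  fix \<nu> assume \<nu>: "feasible_plan T x\<^sub>0 M \<gamma> \<nu>"
  have "ennreal cost \<le> ennreal (cost + (\<integral>z. gap_total z \<partial>\<nu>))"
    using gap_integral_nonneg[OF \<nu>] by (intro ennreal_leI) simp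
  also have "\<dots> \<le> plan_action T x\<^sub>0 M \<nu>" by (rule action_bound[OF \<nu>])
  finally show "plan_action T x\<^sub>0 M \<mu>s \<le> plan_action T x\<^sub>0 M \<nu>" by (simp add: mus_action)
qed

text \<open>A minimizer costs no more than the solution plan, whose action is \<open>cost\<close>.
  The lower bound leaves no room for a positive mean gap, so the gap is 0 almost surely and
  \<open>gapf_zero_imp\<close> applies.\<close>

lemma minimizer_AE:
  assumes \<mu>: "generalized_Hdiv_minimizer T x\<^sub>0 M \<gamma> \<mu>"
  shows "AE z in \<mu>. z = apex_path T x\<^sub>0 \<or> (0 < sig z \<and> z = scale_path T (sig z) (zs (xi z)))"
proof -
  have f: "feasible_plan T x\<^sub>0 M \<gamma> \<mu>" using \<mu> by (simp add: generalized_Hdiv_minimizer_def)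
  interpret prob_space \<mu> by (rule feasD[OF f])
  have "ennreal (cost + (\<integral>z. gap_total z \<partial>\<mu>)) \<le> ennreal cost"
    using action_bound[OF f] \<mu> mus_feasible unfolding generalized_Hdiv_minimizer_def
    by (metis mus_action(1) order_trans)
  then have "(\<integral>z. gap_total z \<partial>\<mu>) = 0"
    using gap_integral_nonneg[OF f] mus_action(2) by (simp add: ennreal_le_iff)
  moreover have "integrable \<mu> gap_total"
  proof (rule integrable_const_bound[of _ 1])
    show "gap_total \<in> borel_measurable \<mu>" using gap_total_measurable measurable_cong_sets[OF feasD(2)[OF f] refl] by blast
    show "AE z in \<mu>. norm (gap_total z) \<le> 1"
      using gap_total_nonneg by (intro AE_I2) (auto simp: feasD[OF f] gap_total_def)
  qed
  moreover have "AE z in \<mu>. 0 \<le> gap_total z"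
    by (intro AE_I2) (simp add: feasD[OF f] gap_total_nonneg)
  ultimately have "AE z in \<mu>. gap_total z = 0"
    using integral_nonneg_eq_0_iff_AE by blast
  then show ?thesis
    using AE_space
  proof eventually_elim
    case (elim z)
    then have "integral {0..T} (gapf z) = 0" using T by (auto simp: gap_total_def min_def split: if_splits)
    then show ?case using elim by (intro gapf_zero_imp) (simp_all add: feasD[OF f])
  qed
qed

lemma apex_path_in_paths: "apex_path T x\<^sub>0 \<in> paths T x\<^sub>0 M"
proof (rule pathsI)
  show "apex_path T x\<^sub>0 \<in> extensional {0..T}" by (simp add: apex_path_def)
  have "(x\<^sub>0, 0) \<in> cone x\<^sub>0 M" using cone_pt_in_cone[OF x0, of 0 x\<^sub>0] by (simp add: cone_pt_def)
  then have "continuous_map (top_of_set {0..T}) (cone_top x\<^sub>0 M) (\<lambda>_. (x\<^sub>0, 0))" by simp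
  then show "continuous_map (top_of_set {0..T}) (cone_top x\<^sub>0 M) (apex_path T x\<^sub>0)"
    by (rule continuous_map_eq) (simp add: apex_path_def)
qed

lemma apex_sets: "{apex_path T x\<^sub>0} \<in> sets \<Omega>"
proof -
  interpret Metric_space "paths T x\<^sub>0 M" "mdist (path_space T x\<^sub>0 M)" by (rule Metric_space_mspace_mdist)
  have "closedin (path_top T x\<^sub>0 M) {apex_path T x\<^sub>0}"
    using closedin_Hausdorff_singleton[OF Hausdorff_space_mtopology] apex_path_in_paths
    by (simp add: mtopology_of_def)
  then show ?thesis by (rule closedin_borel_of)
qed

lemma sig_apex: "sig (apex_path T x\<^sub>0) = 0"
  using T0 by (simp add: sig_def apex_path_def)

lemma sig_one_homogeneous: "one_homogeneous T x\<^sub>0 M sig"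
  using T0 by (simp add: one_homogeneous_def sig_def xi_def scale_path_def cone_scale_def)

lemma sig_measurable: "sig \<in> borel_measurable \<Omega>"
  by (rule continuous_map_borel_measurable[OF sig_continuous])

section \<open>Rescaling a minimizer to the solution plan\<close>

context
  fixes \<mu> assumes mini: "generalized_Hdiv_minimizer T x\<^sub>0 M \<gamma> \<mu>"
begin

lemma mu_feas: "feasible_plan T x\<^sub>0 M \<gamma> \<mu>"
  using mini by (simp add: generalized_Hdiv_minimizer_def)

lemmas mu = feasD[OF mu_feas]

text \<open>Tested against continuous functions, this says that \<open>xi\<close> pushes the
  minimizer weighted by \<open>sig\<close> squared forward to the normalized Lebesgue measure.
  Division of k by the squared initial radius in \<open>q\<close> converts the radius weight of the
  coupling into the weight by \<open>sig\<close>.\<close>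

lemma sig_sq_weighted:
  fixes k :: "'a \<Rightarrow> real"
  assumes k: "continuous_on M k"
  shows "integrable \<mu> (\<lambda>z. (sig z)\<^sup>2 * k (xi z))" "(\<integral>z. (sig z)\<^sup>2 * k (xi z) \<partial>\<mu>) = (\<integral>x. k x \<partial>\<rho>\<^sub>0)"
proof -
  define q where "q x = k (psi x) / (lam 0 (psi x))\<^sup>2" for x
  have q: "continuous_on M q"
    unfolding q_def using T0 lam_psi_nonzero
    by (intro continuous_intros lam_psi_continuous continuous_on_compose2[OF k psi_cont]) (auto intro: psi)
  have e: "(sig z)\<^sup>2 * k (xi z) = (snd (z 0))\<^sup>2 * q (fst (z 0))" for z
    by (simp add: sig_def q_def xi_def power_divide)
  show "integrable \<mu> (\<lambda>z. (sig z)\<^sup>2 * k (xi z))" unfolding e by (rule coupling_quadratic(1)[OF mu(4) q])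
  have "(\<integral>z. (sig z)\<^sup>2 * k (xi z) \<partial>\<mu>) = (\<integral>x. (lam 0 x)\<^sup>2 * q (\<phi> 0 x) \<partial>\<rho>\<^sub>0)"
    unfolding e by (rule coupling_quadratic(2)[OF mu(4) q])
  also have "\<dots> = (\<integral>x. k x \<partial>\<rho>\<^sub>0)"
    using diffeo(3)[OF T0(1)] by (intro Bochner_Integration.integral_cong) (force simp: rho_basic(2) q_def psi)+
  finally show "(\<integral>z. (sig z)\<^sup>2 * k (xi z) \<partial>\<mu>) = (\<integral>x. k x \<partial>\<rho>\<^sub>0)" .
qed

text \<open>The case k = 1. It shows that the normalizing constant C of the rescaling is 1.\<close>

lemma sig_sq: "integrable \<mu> (\<lambda>z. (sig z)\<^sup>2)" "(\<integral>z. (sig z)\<^sup>2 \<partial>\<mu>) = 1"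
  using sig_sq_weighted[of "\<lambda>_. 1"] by (simp_all add: rho.prob_space[unfolded rho_basic(2)] rho_basic(2))

text \<open>The distance cut-offs decrease to the indicator of the closed set \<open>C\<close>, which turns the coupling
  constraint for continuous functions into one for closed sets.\<close>

lemma sig_sq_closed:
  assumes C: "closed C" "C \<subseteq> M"
  shows "(\<integral>\<^sup>+z. ennreal ((sig z)\<^sup>2) * indicator C (xi z) \<partial>\<mu>) = emeasure \<rho>\<^sub>0 C"
proof (cases "C = {}")
  case False
  define u where "u n x = max 0 (1 - real n * infdist x C)" for n :: nat and x
  have uc: "continuous_on M (u n)" for n unfolding u_def by (intro continuous_intros)
  have u01: "0 \<le> u n x" "u n x \<le> 1" for n x by (auto simp: u_def infdist_nonneg)
  have ul: "(\<lambda>n. u n x) \<longlonglongrightarrow> indicator C x" for x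
  proof (cases "x \<in> C")
    case True
    then show ?thesis by (simp add: u_def)
  next
    case x: False
    then have d: "0 < infdist x C" using C(1) False by (metis in_closed_iff_infdist_zero infdist_nonneg order_less_le)
    obtain N :: nat where N: "1 / infdist x C < N" using reals_Archimedean2 by blast
    have "u n x = 0" if "N \<le> n" for n
    proof -
      have "1 < real N * infdist x C" using N d by (simp add: field_simps)
      also have "\<dots> \<le> real n * infdist x C" using that d by (intro mult_right_mono) auto
      finally show ?thesis by (simp add: u_def)
    qed
    then have "\<forall>\<^sub>F n in sequentially. u n x = indicator C x"
      using x by (auto simp: eventually_sequentially)
    then show ?thesis by (rule tendsto_eventually)
  qed
  have Cs: "C \<in> sets \<rho>\<^sub>0" using C by (auto simp: rho_basic(3) sets_restrict_space)
  have m: "(\<lambda>z. (sig z)\<^sup>2 * u n (xi z)) \<in> borel_measurable \<mu>" for n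
    using sig_sq_weighted(1)[OF uc] by (rule borel_measurable_integrable)
  have lim: "(\<lambda>n. (sig z)\<^sup>2 * u n (xi z)) \<longlonglongrightarrow> (sig z)\<^sup>2 * indicator C (xi z)" for z
    by (intro tendsto_intros ul)
  have m': "(\<lambda>z. (sig z)\<^sup>2 * indicator C (xi z)) \<in> borel_measurable \<mu>"
    by (rule borel_measurable_LIMSEQ_real[OF lim m])
  have bd: "norm ((sig z)\<^sup>2 * u n (xi z)) \<le> (sig z)\<^sup>2" for z n
    using u01 by (simp add: abs_mult mult_left_le)
  have 1: "(\<lambda>n. \<integral>z. (sig z)\<^sup>2 * u n (xi z) \<partial>\<mu>) \<longlonglongrightarrow> (\<integral>z. (sig z)\<^sup>2 * indicator C (xi z) \<partial>\<mu>)"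
    by (rule integral_dominated_convergence[OF m' m sig_sq(1)]) (use lim bd in auto)
  have 2: "(\<lambda>n. \<integral>x. u n x \<partial>\<rho>\<^sub>0) \<longlonglongrightarrow> (\<integral>x. indicator C x \<partial>\<rho>\<^sub>0)"
    by (rule integral_dominated_convergence[where w="\<lambda>_. 1"])
       (use Cs ul u01 rho_integrable(1)[OF uc] in auto)
  have eq: "(\<integral>z. (sig z)\<^sup>2 * indicator C (xi z) \<partial>\<mu>) = (\<integral>x. indicator C x \<partial>\<rho>\<^sub>0)"
    using LIMSEQ_unique[OF 1] 2 unfolding sig_sq_weighted(2)[OF uc] by blast
  have i: "integrable \<mu> (\<lambda>z. (sig z)\<^sup>2 * indicator C (xi z))"
    by (rule integrable_dominated_convergence[where s="\<lambda>n z. (sig z)\<^sup>2 * u n (xi z)", OF m' m sig_sq(1)]) (use lim bd in auto)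
  have "(\<integral>\<^sup>+z. ennreal ((sig z)\<^sup>2) * indicator C (xi z) \<partial>\<mu>) = (\<integral>\<^sup>+z. ennreal ((sig z)\<^sup>2 * indicator C (xi z)) \<partial>\<mu>)"
    by (intro nn_integral_cong) (auto simp: indicator_def)
  also have "\<dots> = ennreal (\<integral>z. (sig z)\<^sup>2 * indicator C (xi z) \<partial>\<mu>)"
    by (rule nn_integral_eq_integral[OF i]) auto
  also have "\<dots> = emeasure \<rho>\<^sub>0 C"
    unfolding eq using Cs by (simp add: rho.emeasure_eq_measure)
  finally show ?thesis .
qed simp

lemma mu_off_apex:
  "sets (off_apex T x\<^sub>0 \<mu>) = sets \<Omega>" "space (off_apex T x\<^sub>0 \<mu>) = paths T x\<^sub>0 M"
  "(indicator (space \<mu> - {apex_path T x\<^sub>0}) :: _ \<Rightarrow> ennreal) \<in> borel_measurable \<mu>"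
proof -
  show "sets (off_apex T x\<^sub>0 \<mu>) = sets \<Omega>" "space (off_apex T x\<^sub>0 \<mu>) = paths T x\<^sub>0 M"
    by (simp_all add: off_apex_def mu)
  have "space \<mu> - {apex_path T x\<^sub>0} \<in> sets \<mu>" using apex_sets mu(2) by (intro sets.Diff) auto
  then show "(indicator (space \<mu> - {apex_path T x\<^sub>0}) :: _ \<Rightarrow> ennreal) \<in> borel_measurable \<mu>" by simp
qed

text \<open>Removing the apex path does not change integrals against \<open>sig\<close> squared,
  since \<open>sig\<close> is 0 there, and it removes the only paths of a minimizer, up to a null
  set, on which \<open>sig\<close> fails to be positive.\<close>

lemma sig_off_apex:
  "AE z in off_apex T x\<^sub>0 \<mu>. 0 < sig z" "integrable (off_apex T x\<^sub>0 \<mu>) (\<lambda>z. (sig z)\<^sup>2)"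
  "(\<integral>z. (sig z)\<^sup>2 \<partial>off_apex T x\<^sub>0 \<mu>) = 1"
proof -
  show "AE z in off_apex T x\<^sub>0 \<mu>. 0 < sig z"
    unfolding off_apex_def AE_density[OF mu_off_apex(3)]
    using minimizer_AE[OF mini] by eventually_elim (auto simp: indicator_def split: if_splits)
  have sm: "(\<lambda>z. (sig z)\<^sup>2) \<in> borel_measurable \<mu>" using sig_sq(1) by (rule borel_measurable_integrable)
  have sm': "(\<lambda>z. (sig z)\<^sup>2) \<in> borel_measurable (off_apex T x\<^sub>0 \<mu>)"
    using sm unfolding off_apex_def by simp
  have "(\<integral>\<^sup>+z. ennreal ((sig z)\<^sup>2) \<partial>off_apex T x\<^sub>0 \<mu>) = (\<integral>\<^sup>+z. indicator (space \<mu> - {apex_path T x\<^sub>0}) z * ennreal ((sig z)\<^sup>2) \<partial>\<mu>)"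
    unfolding off_apex_def using sm by (intro nn_integral_density mu_off_apex) auto
  also have "\<dots> = (\<integral>\<^sup>+z. ennreal ((sig z)\<^sup>2) \<partial>\<mu>)"
    by (intro nn_integral_cong) (auto simp: indicator_def sig_apex)
  also have "\<dots> = 1" using sig_sq by (subst nn_integral_eq_integral) auto
  finally have n: "(\<integral>\<^sup>+z. ennreal ((sig z)\<^sup>2) \<partial>off_apex T x\<^sub>0 \<mu>) = 1" .
  show "integrable (off_apex T x\<^sub>0 \<mu>) (\<lambda>z. (sig z)\<^sup>2)"
    using n sm' by (intro integrableI_nonneg) auto
  show "(\<integral>z. (sig z)\<^sup>2 \<partial>off_apex T x\<^sub>0 \<mu>) = 1"
    using n sm' by (subst integral_eq_nn_integral) auto
qed

lemma scale_path_inverse: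
  assumes "w \<in> paths T x\<^sub>0 M" "0 < c"
  shows "scale_path T (1 / c) (scale_path T c w) = w"
proof
  fix t
  show "scale_path T (1 / c) (scale_path T c w) t = w t"
    using assms pathsD_continuous(1)[OF assms(1)]
    by (cases "t \<in> {0..T}") (auto simp: scale_path_def cone_scale_def extensional_def)
qed

text \<open>Almost every path other than the apex path is \<open>sig z\<close> times a solution
  path, and dividing by \<open>sig z\<close> returns that solution path, labelled
  \<open>xi z\<close>. So the dilation is the image under \<open>zs\<close> of the law of
  \<open>xi\<close> weighted by \<open>sig\<close> squared, which is the normalized Lebesgue
  measure. The two measures are compared on closed sets, where \<open>sig_sq_closed\<close> is
  available.\<close>

lemma mus_eq_dil: "\<mu>s = dil2 T x\<^sub>0 M sig (off_apex T x\<^sub>0 \<mu>)"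
proof (rule measure_eqI_closed[of _ "path_top T x\<^sub>0 M"])
  show "sets \<mu>s = sets \<Omega>" by (rule mus_prob)
  show "sets (dil2 T x\<^sub>0 M sig (off_apex T x\<^sub>0 \<mu>)) = sets \<Omega>" by (simp add: dil2_def)
  interpret mus: prob_space \<mu>s by (rule mus_prob)
  show "emeasure \<mu>s (topspace (path_top T x\<^sub>0 M)) \<noteq> \<infinity>" by simp
  fix C assume C: "closedin (path_top T x\<^sub>0 M) C"
  have Cs: "C \<in> sets \<Omega>" using C by (rule closedin_borel_of)
  define D where "D = {x \<in> M. zs x \<in> C}"
  have D: "closed D" "D \<subseteq> M"
  proof -
    have "closedin (top_of_set M) {x \<in> topspace (top_of_set M). zs x \<in> C}"
      by (rule closedin_continuous_map_preimage[OF zs_continuous C])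
    then show "closed D" using M(1) unfolding D_def by (simp add: compact_imp_closed closedin_closed_trans)
    show "D \<subseteq> M" by (auto simp: D_def)
  qed
  let ?p = "prod_path T sig"
  have pm: "?p \<in> \<Omega> \<rightarrow>\<^sub>M \<Omega>" by (rule prod_path_measurable[OF M(1) x0 sig_continuous])
  define A where "A = ?p -` C \<inter> paths T x\<^sub>0 M"
  have As: "A \<in> sets \<Omega>" unfolding A_def using measurable_sets[OF pm Cs] by simp
  have sm: "(\<lambda>z. ennreal ((sig z)\<^sup>2)) \<in> borel_measurable \<Omega>" using sig_measurable by measurable
  have smo: "(\<lambda>z. ennreal ((sig z)\<^sup>2)) \<in> borel_measurable (off_apex T x\<^sub>0 \<mu>)"
    using sm measurable_cong_sets[OF mu_off_apex(1) refl] by blast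
  have smu: "(\<lambda>z. ennreal ((sig z)\<^sup>2) * indicator A z) \<in> borel_measurable \<mu>"
    using sm As measurable_cong_sets[OF mu(2) refl, of borel] by (metis borel_measurable_times_ennreal borel_measurable_indicator)
  have "emeasure \<mu>s C = emeasure \<rho>\<^sub>0 (zs -` C \<inter> space \<rho>\<^sub>0)"
    unfolding solution_plan_def using zs_measurable Cs by (rule emeasure_distr)
  also have "zs -` C \<inter> space \<rho>\<^sub>0 = D" by (auto simp: D_def rho_basic(2))
  also have "emeasure \<rho>\<^sub>0 D = (\<integral>\<^sup>+z. ennreal ((sig z)\<^sup>2) * indicator D (xi z) \<partial>\<mu>)"
    using sig_sq_closed[OF D] by simp
  also have "\<dots> = (\<integral>\<^sup>+z. indicator (space \<mu> - {apex_path T x\<^sub>0}) z * (ennreal ((sig z)\<^sup>2) * indicator A z) \<partial>\<mu>)"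
  proof (rule nn_integral_cong_AE)
    show "AE z in \<mu>. ennreal ((sig z)\<^sup>2) * indicator D (xi z)
        = indicator (space \<mu> - {apex_path T x\<^sub>0}) z * (ennreal ((sig z)\<^sup>2) * indicator A z)"
      using minimizer_AE[OF mini] AE_space
    proof eventually_elim
      case (elim z)
      then have z: "z \<in> paths T x\<^sub>0 M" by (simp add: mu)
      show ?case
      proof (cases "z = apex_path T x\<^sub>0")
        case True
        then show ?thesis by (simp add: sig_apex)
      next
        case False
        then have s: "0 < sig z" "z = scale_path T (sig z) (zs (xi z))" using elim by auto
        have xM: "xi z \<in> M" by (rule path0(2)[OF z])
        have "scale_path T (1 / sig z) z = scale_path T (1 / sig z) (scale_path T (sig z) (zs (xi z)))"
          using arg_cong[OF s(2), of "scale_path T (1 / sig z)"] .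
        also have "\<dots> = zs (xi z)" by (rule scale_path_inverse[OF zs_paths[OF xM] s(1)])
        finally have "?p z = zs (xi z)" using s(1) by (simp add: prod_path_def)
        then have "z \<in> A \<longleftrightarrow> xi z \<in> D" using z xM by (simp add: A_def D_def)
        then show ?thesis using False elim(2) by (simp add: indicator_def)
      qed
    qed
  qed
  also have "\<dots> = (\<integral>\<^sup>+z. ennreal ((sig z)\<^sup>2) * indicator A z \<partial>off_apex T x\<^sub>0 \<mu>)"
    unfolding off_apex_def using smu by (intro nn_integral_density[symmetric] mu_off_apex) auto
  also have "\<dots> = emeasure (density (off_apex T x\<^sub>0 \<mu>) (\<lambda>z. ennreal ((sig z)\<^sup>2))) A"
    using smo As by (intro emeasure_density[symmetric]) (auto simp: mu_off_apex)
  also have "\<dots> = emeasure (dil2 T x\<^sub>0 M sig (off_apex T x\<^sub>0 \<mu>)) C"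
    unfolding dil2_def A_def
    using pm Cs measurable_cong_sets[of "density (off_apex T x\<^sub>0 \<mu>) (\<lambda>z. ennreal ((sig z)\<^sup>2))" \<Omega> \<Omega> \<Omega>]
    by (subst emeasure_distr) (auto simp: mu_off_apex)
  finally show "emeasure \<mu>s C = emeasure (dil2 T x\<^sub>0 M sig (off_apex T x\<^sub>0 \<mu>)) C" .
qed

lemma equal_up_to_rescaling: "equal_up_to_rescaling T x\<^sub>0 M (off_apex T x\<^sub>0 \<mu>) \<mu>s"
  unfolding equal_up_to_rescaling_def
proof (intro exI[of _ sig] conjI)
  show "\<mu>s = dil2 T x\<^sub>0 M (\<lambda>z. sig z / sqrt (\<integral>z. (sig z)\<^sup>2 \<partial>off_apex T x\<^sub>0 \<mu>)) (off_apex T x\<^sub>0 \<mu>)"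
    using mus_eq_dil by (simp add: sig_off_apex)
qed (use sig_measurable sig_one_homogeneous sig_off_apex in auto)

end

end

theorem theorem6p4:
  shows "\<exists>C\<^sub>0>0. \<forall>(M :: 'a::euclidean_space set) x\<^sub>0 T \<phi> lam P.
    lipschitz_body M \<and> convex M \<and> x\<^sub>0 \<in> M \<and> T > 0 \<and> smooth_Hdiv_solution T M \<phi> lam P \<longrightarrow>
    (let r_min = Inf ((\<lambda>(t, x). lam t x) ` ({0..T} \<times> M));
         r_max = Sup ((\<lambda>(t, x). lam t x) ` ({0..T} \<times> M));
         P_norm = Sup ((\<lambda>(t, x). \<bar>P t x\<bar>) ` ({0..T} \<times> M));
         \<rho> = 2 * r_max / r_min;
         zs = solution_path T x\<^sub>0 \<phi> lam;
         \<Psi> = (\<lambda>t p. P t (fst p) * (snd p)\<^sup>2);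
         Hess = (\<lambda>t. hessian (M \<times> {0<..}) cone_tensor (\<Psi> t));
         \<gamma> = solution_coupling T x\<^sub>0 M \<phi> lam;
         \<mu>s = solution_plan T x\<^sub>0 M \<phi> lam
     in (\<forall>x\<in>M. \<forall>t\<in>{0..T}. \<forall>w.
           \<bar>Hess t (zs x t) w\<bar> \<le> C\<^sub>0 * pi\<^sup>2 / T\<^sup>2 * cone_tensor (zs x t) w w) \<and>
        (\<forall>x\<in>M. \<forall>t\<^sub>0\<in>{0..T}. \<forall>t\<^sub>1\<in>{0..T}. cone_dist (zs x t\<^sub>0) (zs x t\<^sub>1) \<le> r_min / 4) \<and>
        (\<rho>\<^sup>2 + (\<rho> + 1)\<^sup>2) * P_norm \<le> 3 / (2 * T\<^sup>2) \<longrightarrow>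
        generalized_Hdiv_minimizer T x\<^sub>0 M \<gamma> \<mu>s \<and>
        ((\<forall>x\<in>M. \<forall>t\<in>{0..T}. \<forall>w. w \<noteq> 0 \<longrightarrow>
            \<bar>Hess t (zs x t) w\<bar> < C\<^sub>0 * pi\<^sup>2 / T\<^sup>2 * cone_tensor (zs x t) w w) \<and>
         (\<rho>\<^sup>2 + (\<rho> + 1)\<^sup>2) * P_norm < 3 / (2 * T\<^sup>2) \<longrightarrow>
         (\<forall>\<mu>. generalized_Hdiv_minimizer T x\<^sub>0 M \<gamma> \<mu> \<longrightarrow>
            equal_up_to_rescaling T x\<^sub>0 M (off_apex T x\<^sub>0 \<mu>) \<mu>s)))"
proof (rule exI[of _ "1 / (128 * pi\<^sup>2)"], intro conjI allI impI, goal_cases)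
  case 1
  show ?case by simp
next
  case (2 M x\<^sub>0 T \<phi> lam P)
  \<comment> \<open>The factor 1/pi^2 in the constant cancels the pi^2 of condition (i), and 128 = 2
    * 64 leaves the potential remainder exactly half of the margin 1/T^2.\<close>
  have C: "1 / (128 * pi\<^sup>2) * pi\<^sup>2 / T\<^sup>2 = 1 / (128 * T\<^sup>2)" by simp
  have H: "hdiv T M x\<^sub>0 \<phi> lam P"
    if "\<forall>x\<in>M. \<forall>t\<in>{0..T}. \<forall>w.
       \<bar>hessian (M \<times> {0<..}) cone_tensor (\<lambda>p. P t (fst p) * (snd p)\<^sup>2) (solution_path T x\<^sub>0 \<phi> lam x t) w\<bar>
         \<le> 1 / (128 * pi\<^sup>2) * pi\<^sup>2 / T\<^sup>2 * cone_tensor (solution_path T x\<^sub>0 \<phi> lam x t) w w"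
    using 2 that unfolding C by unfold_locales auto
  show ?case
    unfolding Let_def using hdiv.mus_minimizer[OF H] hdiv.equal_up_to_rescaling[OF H] by blast
qed

end
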